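(* For $\mathrm{Re}(s)=0$, $\mathrm{Re}(\eta)\ge0$, $|r|<1$ and $j=1,\ldots,N$, $$Z_j^w(r,s,\eta)-rp_je^{-sw}=r\sum_{i=1}^NZ_i^w(r,as,\eta)\,\beta_i^*(s)\,A_{i,j}(\eta-s)+V_j^w(r,s,\eta),$$ or equivalently, in matrix notation, $$\tilde Z^w(r,s,\eta)-r\Lambda\big(M^T(\eta-s)\big)^{-1}B^*(s)\tilde Z^w(r,as,\eta)=re^{-sw}\widehat p+\tilde V^w(r,s,\eta).$$
   Context: Let $E=\{1,\ldots,N\}$, $a\in(0,1)$. $\{X(t);t\ge0\}$ is a continuous-time Markov chain on $E$ with infinitesimal generator $Q=(q_{i,j})$ and a stationary distribution. Customers arrive at epochs $0=T_1<T_2<\cdots$; while $X(t)=i$, arrivals occur according to a Poisson process with rate $\lambda_i>0$, and a customer arriving while $X(t)=i$ has a service time with distribution function $B_i$ on $[0,\infty)$ and Laplace–Stieltjes transform (LST) $\beta_i^*$. Given the background process, the service times $S_1,S_2,\ldots$ are independent and independent of the arrival process. Put $A_n=T_n-T_{n-1}$ ($n\ge2$), $Y_n=X_{T_n}$ ($n\ge1$; so $Y_1=X_0$). The workload just before the $n$th arrival satisfies $W_{n+1}=[aW_n+S_n-A_{n+1}]^+$, $n\ge1$, with $W_1=w\ge0$. Here $[x]^+=\max(0,x)$, $[x]^-=\min(0,x)$. Notation: $A_{i,j}(s)=E(e^{-sA_n}1_{\{Y_n=j\}}\mid Y_{n-1}=i)$; the matrix $A(s)=(A_{i,j}(s))$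 equals $M^{-1}(s)\Lambda$, where $\Lambda=\mathrm{diag}(\lambda_1,\ldots,\lambda_N)$ and $M(s)=sI+\Lambda-Q$. $B^*(s)=\mathrm{diag}(\beta_1^*(s),\ldots,\beta_N^*(s))$, $p_j=P(X_0=j)$, $\widehat p=(p_1,\ldots,p_N)^T$, and $$Z_j^w(r,s,\eta)=\sum_{n=1}^\infty r^nE\big(e^{-sW_n-\eta T_n}1_{\{Y_n=j\}}\mid W_1=w\big),$$ $$V_j^w(r,s,\eta)=\sum_{n=1}^\infty r^{n+1}E\big((1-e^{-s[aW_n+S_n-A_{n+1}]^-})e^{-\eta T_{n+1}}1_{\{Y_{n+1}=j\}}\mid W_1=w\big),$$ $\tilde Z^w=(Z_1^w,\ldots,Z_N^w)^T$, $\tilde V^w=(V_1^w,\ldots,V_N^w)^T$. *)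

theory Defs
  imports "HOL-Probability.Probability"
begin

section \<open>The background Markov chain\<close>

text \<open>The state space \<open>{1, ..., N}\<close> is rendered by an arbitrary finite index type \<open>'n\<close>.\<close>

definition transition_semigroup :: "(real \<Rightarrow> real^'n^'n) \<Rightarrow> bool" where
  "transition_semigroup P \<longleftrightarrow>
     (\<forall>t\<ge>0. (\<forall>i j. 0 \<le> P t $ i $ j) \<and> (\<forall>i. (\<Sum>j\<in>UNIV. P t $ i $ j) = 1)) \<and>
     P 0 = mat 1 \<and>
     (\<forall>s\<ge>0. \<forall>t\<ge>0. P (s + t) = P s ** P t)"

definition has_generator :: "(real \<Rightarrow> real^'n^'n) \<Rightarrow> real^'n^'n \<Rightarrow> bool" where
  "has_generator P Q \<longleftrightarrow>
     (\<forall>i j. ((\<lambda>t. P t $ i $ j) has_real_derivative Q $ i $ j) (at 0 within {0..}))"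

definition stationary_distribution :: "(real \<Rightarrow> real^'n^'n) \<Rightarrow> real^'n \<Rightarrow> bool" where
  "stationary_distribution P \<pi> \<longleftrightarrow>
     (\<forall>i. 0 \<le> \<pi> $ i) \<and> (\<Sum>i\<in>UNIV. \<pi> $ i) = 1 \<and> (\<forall>t\<ge>0. \<pi> v* P t = \<pi>)"

text \<open>The law of the initial state is arbitrary; in particular the chain need not be started
  in its stationary distribution.\<close>

definition markov_process ::
  "'a measure \<Rightarrow> (real \<Rightarrow> 'a \<Rightarrow> 'n) \<Rightarrow> (real \<Rightarrow> real^'n^'n) \<Rightarrow> bool" where
  "markov_process M X P \<longleftrightarrow>
     (\<forall>t\<ge>0. X t \<in> M \<rightarrow>\<^sub>M count_space UNIV) \<and>
     (\<forall>\<omega>\<in>space M. \<forall>t\<ge>0. eventually (\<lambda>u. X u \<omega> = X t \<omega>) (at_right t)) \<and>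
     (\<forall>k (t :: nat \<Rightarrow> real) x. 0 \<le> t 0 \<longrightarrow> strict_mono t \<longrightarrow>
        measure M {\<omega>\<in>space M. \<forall>l\<le>Suc k. X (t l) \<omega> = x l} =
        measure M {\<omega>\<in>space M. \<forall>l\<le>k. X (t l) \<omega> = x l}
          * P (t (Suc k) - t k) $ x k $ x (Suc k))"

definition ctmc_with_generator ::
  "'a measure \<Rightarrow> (real \<Rightarrow> 'a \<Rightarrow> 'n) \<Rightarrow> real^'n^'n \<Rightarrow> bool" where
  "ctmc_with_generator M X Q \<longleftrightarrow>
     (\<exists>P. transition_semigroup P \<and> has_generator P Q \<and> (\<exists>\<pi>. stationary_distribution P \<pi>) \<and>
          markov_process M X P)"

section \<open>Arrivals and services\<close>

definition background_sigma :: "'a measure \<Rightarrow> (real \<Rightarrow> 'a \<Rightarrow> 'n) \<Rightarrow> 'a measure" where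
  "background_sigma M X = sigma (space M) {X t -` {i} \<inter> space M | t i. 0 \<le> t}"

definition background_arrival_sigma ::
  "'a measure \<Rightarrow> (real \<Rightarrow> 'a \<Rightarrow> 'n) \<Rightarrow> (nat \<Rightarrow> 'a \<Rightarrow> real) \<Rightarrow> 'a measure" where
  "background_arrival_sigma M X T =
     sigma (space M) ({X t -` {i} \<inter> space M | t i. 0 \<le> t} \<union>
                      {T n -` C \<inter> space M | n C. 1 \<le> n \<and> C \<in> sets borel})"

text \<open>The customer arriving at \<open>T 1 = 0\<close> is not a point of the modulated Poisson process.\<close>

definition num_arrivals :: "(nat \<Rightarrow> 'a \<Rightarrow> real) \<Rightarrow> real \<Rightarrow> real \<Rightarrow> 'a \<Rightarrow> nat" where
  "num_arrivals T u v \<omega> = card {n. 2 \<le> n \<and> T n \<omega> \<in> {u<..v}}"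

text \<open>The mean number of arrivals in \<open>(u, v]\<close>, given the path of the background process.\<close>

definition cumulative_rate ::
  "('n \<Rightarrow> real) \<Rightarrow> (real \<Rightarrow> 'a \<Rightarrow> 'n) \<Rightarrow> real \<Rightarrow> real \<Rightarrow> 'a \<Rightarrow> real" where
  "cumulative_rate lam X u v \<omega> = (LINT y:{u..v}|lborel. lam (X y \<omega>))"

definition embedded :: "(real \<Rightarrow> 'a \<Rightarrow> 'n) \<Rightarrow> (nat \<Rightarrow> 'a \<Rightarrow> real) \<Rightarrow> nat \<Rightarrow> 'a \<Rightarrow> 'n" where
  "embedded X T n \<omega> = X (T n \<omega>) \<omega>"

definition interarrival :: "(nat \<Rightarrow> 'a \<Rightarrow> real) \<Rightarrow> nat \<Rightarrow> 'a \<Rightarrow> real" where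
  "interarrival T n \<omega> = T n \<omega> - T (n - 1) \<omega>"

text \<open>The sequences \<open>T\<close>, \<open>S\<close>, \<open>W\<close> are indexed from 1; their values at index 0 are irrelevant.
  \<open>B i\<close> is the law of a service time in state \<open>i\<close>, i.e. the measure whose distribution function is
  \<open>cdf (B i)\<close>.
  Given the background process, the arrivals after time 0 form a Poisson process with
  intensity \<open>lam (X t)\<close> (assumption \<open>modulated_poisson\<close>); given the background process and the
  arrivals, the service times are independent with laws \<open>B (embedded X T n)\<close> (assumption \<open>services\<close>).\<close>

locale modulated_workload = prob_space M
  for M :: "'a measure" +
  fixes Q :: "real^'n^'n"
    and lam :: "'n \<Rightarrow> real"
    and B :: "'n \<Rightarrow> real measure"
    and a w :: real
    and X :: "real \<Rightarrow> 'a \<Rightarrow> 'n"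
    and T S W :: "nat \<Rightarrow> 'a \<Rightarrow> real"
  assumes a_range: "0 < a" "a < 1"
    and w_nonneg: "0 \<le> w"
    and lam_pos: "0 < lam i"
    and B_distribution: "real_distribution (B i)"
    and B_nonneg: "measure (B i) {0..} = 1"
    and background: "ctmc_with_generator M X Q"
    and T_measurable: "1 \<le> n \<Longrightarrow> T n \<in> borel_measurable M"
    and S_measurable: "1 \<le> n \<Longrightarrow> S n \<in> borel_measurable M"
    and T_first: "\<omega> \<in> space M \<Longrightarrow> T 1 \<omega> = 0"
    and T_increasing: "\<omega> \<in> space M \<Longrightarrow> 1 \<le> n \<Longrightarrow> T n \<omega> < T (Suc n) \<omega>"
    and T_locally_finite: "\<omega> \<in> space M \<Longrightarrow> finite {n. 1 \<le> n \<and> T n \<omega> \<le> u}"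
    and modulated_poisson: "0 \<le> t 0 \<Longrightarrow> strict_mono (t :: nat \<Rightarrow> real) \<Longrightarrow>
      AE \<omega> in M.
        real_cond_exp M (background_sigma M X)
          (indicator {\<omega>\<in>space M. \<forall>l<k. num_arrivals T (t l) (t (Suc l)) \<omega> = m l}) \<omega> =
        (\<Prod>l<k. exp (- cumulative_rate lam X (t l) (t (Suc l)) \<omega>)
                 * cumulative_rate lam X (t l) (t (Suc l)) \<omega> ^ m l / fact (m l))"
    and services: "(\<And>l. C l \<in> sets borel) \<Longrightarrow>
      AE \<omega> in M.
        real_cond_exp M (background_arrival_sigma M X T)
          (indicator {\<omega>\<in>space M. \<forall>l\<in>{1..n}. S l \<omega> \<in> C l}) \<omega> =
        (\<Prod>l=1..n. measure (B (embedded X T l \<omega>)) (C l))"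
    and W_first: "\<omega> \<in> space M \<Longrightarrow> W 1 \<omega> = w"
    and W_step: "\<omega> \<in> space M \<Longrightarrow> 1 \<le> n \<Longrightarrow>
      W (Suc n) \<omega> = max 0 (a * W n \<omega> + S n \<omega> - interarrival T (Suc n) \<omega>)"

section \<open>Transforms\<close>

definition lst :: "real measure \<Rightarrow> complex \<Rightarrow> complex" where
  "lst \<mu> s = (LINT x|\<mu>. exp (- s * of_real x))"

definition conditional_interarrival_lst ::
  "'a measure \<Rightarrow> (real \<Rightarrow> 'a \<Rightarrow> 'n) \<Rightarrow> (nat \<Rightarrow> 'a \<Rightarrow> real) \<Rightarrow> nat \<Rightarrow> 'n \<Rightarrow> 'n \<Rightarrow> complex \<Rightarrow> complex" where
  "conditional_interarrival_lst M X T n i j s =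
     (LINT \<omega>|M. exp (- s * of_real (interarrival T n \<omega>))
                  * indicator {\<omega>. embedded X T n \<omega> = j \<and> embedded X T (n - 1) \<omega> = i} \<omega>)
     / of_real (measure M {\<omega>\<in>space M. embedded X T (n - 1) \<omega> = i})"

text \<open>The conditional transform does not depend on the index \<open>n \<ge> 2\<close>; the common value is
  taken over those \<open>n\<close> for which the conditioning event is not null. For a state \<open>i\<close> that is almost
  surely never the state at an arrival the conditional expectation is meaningless and the value is
  unspecified.\<close>

definition interarrival_lst ::
  "'a measure \<Rightarrow> (real \<Rightarrow> 'a \<Rightarrow> 'n) \<Rightarrow> (nat \<Rightarrow> 'a \<Rightarrow> real) \<Rightarrow> 'n \<Rightarrow> 'n \<Rightarrow> complex \<Rightarrow> complex" where
  "interarrival_lst M X T i j s =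
     (THE c. \<forall>n\<ge>2. measure M {\<omega>\<in>space M. embedded X T (n - 1) \<omega> = i} > 0 \<longrightarrow>
                    conditional_interarrival_lst M X T n i j s = c)"

definition initial_prob :: "'a measure \<Rightarrow> (real \<Rightarrow> 'a \<Rightarrow> 'n) \<Rightarrow> complex^'n" where
  "initial_prob M X = (\<chi> j. of_real (measure M {\<omega>\<in>space M. X 0 \<omega> = j}))"

text \<open>The series over \<open>n \<ge> 1\<close> are written as series over \<open>n \<ge> 0\<close> with \<open>n\<close> replaced by \<open>Suc n\<close>.\<close>

definition Z_transform ::
  "'a measure \<Rightarrow> (real \<Rightarrow> 'a \<Rightarrow> 'n) \<Rightarrow> (nat \<Rightarrow> 'a \<Rightarrow> real) \<Rightarrow> (nat \<Rightarrow> 'a \<Rightarrow> real) \<Rightarrow>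
   complex \<Rightarrow> complex \<Rightarrow> complex \<Rightarrow> complex^'n" where
  "Z_transform M X T W r s \<eta> = (\<chi> j. \<Sum>n. r ^ Suc n *
     (LINT \<omega>|M. exp (- s * of_real (W (Suc n) \<omega>) - \<eta> * of_real (T (Suc n) \<omega>))
                  * indicator {\<omega>. embedded X T (Suc n) \<omega> = j} \<omega>))"

definition V_transform ::
  "'a measure \<Rightarrow> (real \<Rightarrow> 'a \<Rightarrow> 'n) \<Rightarrow> (nat \<Rightarrow> 'a \<Rightarrow> real) \<Rightarrow> (nat \<Rightarrow> 'a \<Rightarrow> real) \<Rightarrow>
   (nat \<Rightarrow> 'a \<Rightarrow> real) \<Rightarrow> real \<Rightarrow> complex \<Rightarrow> complex \<Rightarrow> complex \<Rightarrow> complex^'n" where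
  "V_transform M X T S W a r s \<eta> = (\<chi> j. \<Sum>n. r ^ (Suc n + 1) *
     (LINT \<omega>|M. (1 - exp (- s * of_real (min 0
                    (a * W (Suc n) \<omega> + S (Suc n) \<omega> - interarrival T (Suc n + 1) \<omega>))))
                  * exp (- \<eta> * of_real (T (Suc n + 1) \<omega>))
                  * indicator {\<omega>. embedded X T (Suc n + 1) \<omega> = j} \<omega>))"

definition diag :: "('n \<Rightarrow> complex) \<Rightarrow> complex^'n^'n" where
  "diag d = (\<chi> i j. if i = j then d i else 0)"

definition rate_matrix :: "('n \<Rightarrow> real) \<Rightarrow> complex^'n^'n" where
  "rate_matrix lam = diag (\<lambda>i. of_real (lam i))"

definition M_matrix :: "real^'n^'n \<Rightarrow> ('n \<Rightarrow> real) \<Rightarrow> complex \<Rightarrow> complex^'n^'n" where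
  "M_matrix Q lam s = mat s + rate_matrix lam - (\<chi> i j. of_real (Q $ i $ j))"

definition B_matrix :: "('n \<Rightarrow> real measure) \<Rightarrow> complex \<Rightarrow> complex^'n^'n" where
  "B_matrix B s = diag (\<lambda>i. lst (B i) s)"

end

theory Submission
  imports Defs
begin

text \<open>
  Write \<open>K\<^sub>i\<^sub>j(z)\<close> for the entries of \<open>M(z)\<^sup>-\<^sup>1 \<Lambda>\<close> (\<open>renewal_kernel\<close>). The equation follows from a single step of the
  recursion. For real \<open>x\<close> one has \<open>e\<^bsup>-s max(0,x)\<^esup> = e\<^bsup>-sx\<^esup> + (1 - e\<^bsup>-s min(0,x)\<^esup>)\<close>. With
  \<open>x = a W\<^sub>n + S\<^sub>n - A\<^sub>n\<^sub>+\<^sub>1\<close> the second summand accounts for the \<open>n\<close>th term of \<open>V\<close>, and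
  \<open>e\<^bsup>-sx - \<eta> T\<^sub>n\<^sub>+\<^sub>1\<^esup>\<close> is the product of \<open>e\<^bsup>-saW\<^sub>n - \<eta> T\<^sub>n\<^esup>\<close>, \<open>e\<^bsup>-s S\<^sub>n\<^esup>\<close> and
  \<open>e\<^bsup>-(\<eta>-s) A\<^sub>n\<^sub>+\<^sub>1\<^esup>\<close>. Given the past up to the \<open>n\<close>th arrival, with \<open>Y\<^sub>n = i\<close>, the second factor has
  mean \<open>\<beta>\<^sub>i(s)\<close> and the third one, restricted to \<open>Y\<^sub>n\<^sub>+\<^sub>1 = j\<close>, has mean \<open>K\<^sub>i\<^sub>j(\<eta> - s)\<close>
  (\<open>service_integral\<close>, \<open>renewal_integral\<close>, \<open>workload_step\<close>). Multiplication by \<open>r\<^sup>n\<^sup>+\<^sup>1\<close> and summation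
  over \<open>n\<close> gives the equation with \<open>K\<close> in place of the conditional transforms
  (\<open>workload_transform_equation\<close>). These transforms agree with \<open>K\<close> for every state that is seen by an
  arrival with positive probability, and the other states contribute nothing, because their component of
  \<open>Z\<close> vanishes.

  The substance is the Markov renewal property with the explicit kernel \<open>K\<close> (\<open>renewal_cylinder\<close>). The
  hypotheses speak only about the chain and the counts at finitely many deterministic times, whereas
  \<open>T\<^sub>n\<close> is random, so time is discretised with mesh \<open>h\<close>. On the grid, \<open>T\<^sub>n\<close> rounded up is a
  stopping time with values in a discrete set, and an event about the first \<open>n\<close> arrivals with bounded
  \<open>T\<^sub>n\<close> and at most one arrival in each cell is a finite disjoint union of histories of the form ``these
  states at the grid points, these counts in the cells''. For each history
  the chain moves to the next grid point according to \<open>P(h)\<close>, and there is no arrival on the way and the chain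
  ends in \<open>j\<close> with probability \<open>(1 - h \<lambda>\<^sub>j) P\<^sub>i\<^sub>j(h) + O(h\<^sup>2)\<close>, uniformly in the history
  (\<open>no_arrival_step\<close>): the integrated intensity over a cell differs from \<open>h \<lambda>\<close> at the end point only
  if the chain jumps in the cell.

  Let \<open>v\<^sub>p\<close> be the row vector of the probabilities that the event holds, that the next arrival is still
  missing after \<open>p\<close> further steps and that the chain is then in a given state. Then
  \<open>v\<^sub>p\<^sub>+\<^sub>1 = v\<^sub>p P(h) (I - h \<Lambda>) + O(h\<^sup>2 |v\<^sub>p|)\<close>, and the generating function of the next
  arrival is read off from \<open>h \<Sum>\<^sub>p e\<^bsup>-zph\<^esup> v\<^sub>p\<close>. As \<open>h\<close> tends to \<open>0\<close> the matrix
  \<open>(I - e\<^bsup>-zh\<^esup> P(h) (I - h \<Lambda>)) / h\<close> converges to \<open>z I + \<Lambda> - Q = M(z)\<close>, while positivity of the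
  rates makes \<open>|v\<^sub>p|\<close> decay geometrically at rate proportional to \<open>h\<close>, so that the errors add up to \<open>O(h)\<close>.
  Hence the limit is \<open>v\<^sub>0 M(z)\<^sup>-\<^sup>1 \<Lambda>\<close> (\<open>discrete_resolvent_limit\<close>). On the other side, rounded epochs
  and the states at them converge because the paths are right continuous.
\<close>

section \<open>Preliminaries from analysis and probability\<close>

text \<open>This is the form in which conditional expectations are used below: a claim ``\<open>U\<close> and \<open>V\<close> have the same
conditional mean'' becomes a claim about \<open>D = U - V\<close>, which then needs to be checked on an
intersection-stable generator only. The sets with vanishing integral form a Dynkin system, and bounded
functions are limits of simple functions that are dominated by twice their norm.\<close>
lemma (in prob_space) integral_mult_eq_0_if_zero_on_generator:
  fixes D f :: "'a \<Rightarrow> 'b :: {real_normed_field, banach, second_countable_topology}"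
  assumes G: "Int_stable G" "G \<subseteq> events" "space M \<in> G"
    and D: "integrable M D"
    and zero: "\<And>C. C \<in> G \<Longrightarrow> (LINT x|M. indicator C x *\<^sub>R D x) = 0"
    and f: "f \<in> borel_measurable (sigma (space M) G)"
    and bounded: "\<And>x. x \<in> space M \<Longrightarrow> norm (f x) \<le> K"
  shows "(LINT x|M. f x * D x) = 0"
proof -
  let ?F = "sigma (space M) G"
  have Gpow: "G \<subseteq> Pow (space M)"
    using G(2) sets.space_closed by blast
  have sets_F: "sets ?F = sigma_sets (space M) G" and space_F[simp]: "space ?F = space M"
    using Gpow by auto
  have F_events: "sets ?F \<subseteq> events"
    unfolding sets_F by (rule sets.sigma_sets_subset[OF G(2)])
  have D_meas[measurable]: "D \<in> borel_measurable M"
    using D by auto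
  have intD: "integrable M (\<lambda>x. indicator A x *\<^sub>R D x)" if "A \<in> events" for A
    using integrable_mult_indicator[OF that D] .
  have set_zero: "(LINT x|M. indicator A x *\<^sub>R D x) = 0" if "A \<in> sets ?F" for A
    using G(1) Gpow that[unfolded sets_F]
  proof (induction rule: sigma_sets_induct_disjoint)
    case (basic A)
    then show ?case by (rule zero)
  next
    case empty
    then show ?case by simp
  next
    case (compl A)
    have A: "A \<in> events"
      using compl(1) F_events sets_F by auto
    have "(LINT x|M. indicator (space M - A) x *\<^sub>R D x)
        = (LINT x|M. indicator (space M) x *\<^sub>R D x - indicator A x *\<^sub>R D x)"
      by (rule Bochner_Integration.integral_cong) (auto simp: indicator_def)
    also have "\<dots> = 0"
      using compl(2) zero[OF G(3)] A by (simp add: intD)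
    finally show ?case .
  next
    case (union A)
    have A: "A i \<in> events" for i
      using union(2) F_events sets_F by auto
    have "(LINT x:(\<Union>i. A i)|M. D x) = (\<Sum>i. (LINT x:(A i)|M. D x))"
      by (rule lebesgue_integral_countable_add)
        (use A union(1) intD[of "\<Union>i. A i"] in \<open>auto simp: set_integrable_def disjoint_family_on_def\<close>)
    then show ?case
      using union(3) by (simp add: set_lebesgue_integral_def)
  qed
  obtain s where s: "\<And>i. simple_function ?F (s i)"
      "\<And>x. x \<in> space M \<Longrightarrow> (\<lambda>i. s i x) \<longlonglongrightarrow> f x"
      "\<And>i x. x \<in> space M \<Longrightarrow> norm (s i x) \<le> 2 * norm (f x)"
    using borel_measurable_implies_sequence_metric[OF f, of 0] by (simp add: dist_norm) metis
  have sub: "subalgebra M ?F"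
    using F_events by (auto simp: subalgebra_def)
  have s_meas[measurable]: "s i \<in> borel_measurable M" for i
    using measurable_from_subalg[OF sub borel_measurable_simple_function[OF s(1)]] .
  have f_meas[measurable]: "f \<in> borel_measurable M"
    using measurable_from_subalg[OF sub f] .
  have s_zero: "(LINT x|M. s i x * D x) = 0" for i
  proof -
    let ?A = "\<lambda>y. s i -` {y} \<inter> space M"
    have A: "?A y \<in> sets ?F" if "y \<in> s i ` space M" for y
      using s(1)[of i] that by (auto simp: simple_function_def)
    have fin: "finite (s i ` space M)"
      using s(1)[of i] by (auto simp: simple_function_def)
    have eq: "s i x * D x = (\<Sum>y\<in>s i ` space M. y * (indicator (?A y) x *\<^sub>R D x))" if "x \<in> space M" for x
    proof -
      have "(\<Sum>y\<in>s i ` space M. y * (indicator (?A y) x *\<^sub>R D x))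
          = (\<Sum>y\<in>s i ` space M. if y = s i x then y * D x else 0)"
        using that by (intro sum.cong) auto
      also have "\<dots> = s i x * D x"
        using that fin by (simp add: sum.delta')
      finally show ?thesis by simp
    qed
    have "(LINT x|M. s i x * D x)
        = (LINT x|M. (\<Sum>y\<in>s i ` space M. y * (indicator (?A y) x *\<^sub>R D x)))"
      by (rule Bochner_Integration.integral_cong[OF refl]) (rule eq)
    also have "\<dots> = (\<Sum>y\<in>s i ` space M. y * (LINT x|M. indicator (?A y) x *\<^sub>R D x))"
      using A F_events intD
      by (subst Bochner_Integration.integral_sum) (auto simp del: mult_scaleR_right)
    also have "\<dots> = 0"
      using A set_zero by (intro sum.neutral) auto
    finally show ?thesis .
  qed
  have "(\<lambda>i. LINT x|M. s i x * D x) \<longlonglongrightarrow> (LINT x|M. f x * D x)"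
  proof (rule integral_dominated_convergence[where w = "\<lambda>x. (2 * K) * norm (D x)"])
    show "integrable M (\<lambda>x. (2 * K) * norm (D x))"
      using D by auto
    show "AE x in M. (\<lambda>i. s i x * D x) \<longlonglongrightarrow> f x * D x"
      using s(2) by (auto intro!: tendsto_intros)
    show "AE x in M. norm (s i x * D x) \<le> (2 * K) * norm (D x)" for i
    proof (rule AE_I2)
      fix x assume x: "x \<in> space M"
      have "norm (s i x) \<le> 2 * K"
        using s(3)[OF x, of i] bounded[OF x] by linarith
      then show "norm (s i x * D x) \<le> (2 * K) * norm (D x)"
        unfolding norm_mult by (rule mult_right_mono) auto
    qed
  qed auto
  then show ?thesis
    using s_zero LIMSEQ_unique[OF _ tendsto_const] by fastforce
qed

text \<open>The path is constant for a short time after \<open>\<tau>\<close>, so its value at \<open>\<tau>\<close> is its eventual value at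
the grid points next to the right of \<open>\<tau>\<close>, of which there are countably many. Cutting the grid points
off at \<open>u\<close> keeps the approximations measurable with respect to the information up to time \<open>u\<close>.\<close>
lemma right_constant_eval_measurable:
  fixes Y :: "real \<Rightarrow> 'b \<Rightarrow> 'n :: finite"
  assumes meas: "\<And>t. 0 \<le> t \<Longrightarrow> t \<le> u \<Longrightarrow> Y t \<in> F \<rightarrow>\<^sub>M count_space UNIV"
    and right: "\<And>x t. x \<in> space F \<Longrightarrow> 0 \<le> t \<Longrightarrow> eventually (\<lambda>v. Y v x = Y t x) (at_right t)"
    and \<tau>[measurable]: "\<tau> \<in> borel_measurable F"
    and range: "\<And>x. x \<in> space F \<Longrightarrow> 0 \<le> \<tau> x \<and> \<tau> x \<le> u"
  shows "(\<lambda>x. Y (\<tau> x) x) \<in> F \<rightarrow>\<^sub>M count_space UNIV"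
proof (cases "space F = {}")
  case True
  then show ?thesis by (simp add: measurable_def)
next
  case False
  then have u: "0 \<le> u"
    using range by fastforce
  define k where "k m x = nat \<lfloor>real (Suc m) * \<tau> x\<rfloor>" for m x
  define \<sigma> where "\<sigma> m j = min u ((real j + 1) / real (Suc m))" for m j
  have k_meas[measurable]: "k m \<in> F \<rightarrow>\<^sub>M count_space UNIV" for m
    unfolding k_def by measurable
  have \<sigma>_range: "0 \<le> \<sigma> m j" "\<sigma> m j \<le> u" for m j
    using u by (auto simp: \<sigma>_def)
  have approx_meas[measurable]: "Measurable.pred F (\<lambda>x. Y (\<sigma> m (k m x)) x = i)" for m i
  proof -
    have "(\<lambda>x. Y (\<sigma> m (k m x)) x) \<in> F \<rightarrow>\<^sub>M count_space UNIV"
      by (rule measurable_compose_countable[OF _ k_meas]) (use meas \<sigma>_range in auto)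
    then show ?thesis by measurable
  qed
  have conv: "eventually (\<lambda>m. Y (\<sigma> m (k m x)) x = Y (\<tau> x) x) sequentially" if x: "x \<in> space F" for x
  proof -
    have \<tau>x: "0 \<le> \<tau> x" "\<tau> x \<le> u"
      using range[OF x] by auto
    obtain b where b: "b > \<tau> x" "\<And>v. v > \<tau> x \<Longrightarrow> v < b \<Longrightarrow> Y v x = Y (\<tau> x) x"
      using right[OF x \<tau>x(1)] unfolding eventually_at_right_field by auto
    have "(\<lambda>m. 1 / real (Suc m)) \<longlonglongrightarrow> 0"
      using lim_1_over_n LIMSEQ_Suc by fastforce
    then have "eventually (\<lambda>m. 1 / real (Suc m) < b - \<tau> x) sequentially"
      by (rule order_tendstoD) (use b in auto)
    then show ?thesis
    proof eventually_elim
      case (elim m)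
      have fl: "real (k m x) = of_int \<lfloor>real (Suc m) * \<tau> x\<rfloor>"
        unfolding k_def using \<tau>x by simp
      have "real (k m x) \<le> real (Suc m) * \<tau> x" "real (Suc m) * \<tau> x < real (k m x) + 1"
        unfolding fl by (linarith, linarith)
      then have "(real (k m x) + 1) / real (Suc m) \<le> \<tau> x + 1 / real (Suc m)"
        "\<tau> x < (real (k m x) + 1) / real (Suc m)"
        by (simp_all add: field_simps del: of_nat_Suc)
      with elim have v: "\<tau> x < (real (k m x) + 1) / real (Suc m)" "(real (k m x) + 1) / real (Suc m) < b"
        by linarith+
      show ?case
      proof (cases "\<sigma> m (k m x) = \<tau> x")
        case True
        then show ?thesis by simp
      next
        case False
        then have "\<tau> x < \<sigma> m (k m x)" "\<sigma> m (k m x) < b"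
          using v \<tau>x unfolding \<sigma>_def min_def by (auto split: if_splits)
        then show ?thesis by (rule b(2))
      qed
    qed
  qed
  have "Measurable.pred F (\<lambda>x. Y (\<tau> x) x = i)" for i
  proof -
    have "Measurable.pred F (\<lambda>x. eventually (\<lambda>m. Y (\<sigma> m (k m x)) x = i) sequentially)"
      by measurable
    moreover have "eventually (\<lambda>m. Y (\<sigma> m (k m x)) x = i) sequentially \<longleftrightarrow> Y (\<tau> x) x = i"
      if x: "x \<in> space F" for x
    proof
      assume "eventually (\<lambda>m. Y (\<sigma> m (k m x)) x = i) sequentially"
      from eventually_conj[OF this conv[OF x]] show "Y (\<tau> x) x = i"
        using eventually_happens'[OF sequentially_bot] by fastforce
    next
      assume "Y (\<tau> x) x = i"
      then show "eventually (\<lambda>m. Y (\<sigma> m (k m x)) x = i) sequentially"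
        using conv[OF x] by simp
    qed
    ultimately show ?thesis
      using measurable_cong[of F _ _ "count_space UNIV"] by (simp cong: measurable_cong)
  qed
  then show ?thesis
    by (auto simp: measurable_count_space_eq2 pred_def vimage_def Int_def conj_commute)
qed

text \<open>The hypothesis says that, restricted to \<open>E\<close>, the law of \<open>V\<close> is a multiple of \<open>\<mu>\<close>.\<close>
lemma (in prob_space) integral_of_law:
  fixes g :: "real \<Rightarrow> complex"
  assumes E: "E \<in> events" and V[measurable]: "V \<in> borel_measurable M" and \<mu>: "real_distribution \<mu>"
    and law: "\<And>C. C \<in> sets borel \<Longrightarrow> prob (E \<inter> (V -` C \<inter> space M)) = prob E * measure \<mu> C"
    and g[measurable]: "g \<in> borel_measurable borel"
  shows "(LINT \<omega>|M. indicator E \<omega> *\<^sub>R g (V \<omega>)) = prob E *\<^sub>R (LINT x|\<mu>. g x)"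
proof -
  interpret \<mu>: real_distribution \<mu> by (rule \<mu>)
  let ?N = "distr (density M (\<lambda>\<omega>. ennreal (indicator E \<omega>))) borel V"
  have "?N = density \<mu> (\<lambda>_. ennreal (prob E))"
  proof (rule measure_eqI)
    show "sets ?N = sets (density \<mu> (\<lambda>_. ennreal (prob E)))" by simp
    fix C assume "C \<in> sets ?N"
    then have C[measurable]: "C \<in> sets borel" by simp
    have VC: "V -` C \<inter> space M \<in> events" by measurable
    have "emeasure ?N C = (\<integral>\<^sup>+\<omega>. ennreal (indicator E \<omega>) * indicator (V -` C \<inter> space M) \<omega> \<partial>M)"
      using E by (simp add: emeasure_distr emeasure_density)
    also have "\<dots> = (\<integral>\<^sup>+\<omega>. indicator (E \<inter> (V -` C \<inter> space M)) \<omega> \<partial>M)"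
      by (intro nn_integral_cong) (auto simp: indicator_def)
    also have "\<dots> = ennreal (prob E * measure \<mu> C)"
      using E VC law[OF C] by (simp add: emeasure_eq_measure)
    also have "\<dots> = emeasure (density \<mu> (\<lambda>_. ennreal (prob E))) C"
      using C by (simp add: emeasure_density_const \<mu>.emeasure_eq_measure ennreal_mult)
    finally show "emeasure ?N C = emeasure (density \<mu> (\<lambda>_. ennreal (prob E))) C" .
  qed
  then have "(LINT x|?N. g x) = (LINT x|density \<mu> (\<lambda>_. ennreal (prob E)). g x)" by simp
  moreover have "(LINT x|?N. g x) = (LINT \<omega>|M. indicator E \<omega> *\<^sub>R g (V \<omega>))"
    using E by (simp add: integral_distr integral_density)
  moreover have "(LINT x|density \<mu> (\<lambda>_. ennreal (prob E)). g x) = prob E *\<^sub>R (LINT x|\<mu>. g x)"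
    using integral_density[of g \<mu> "\<lambda>_. prob E"] by simp
  ultimately show ?thesis by simp
qed

lemma exp_minus_bounds:
  fixes x :: real
  assumes "0 \<le> x"
  shows "\<bar>exp (- x) - (1 - x)\<bar> \<le> x\<^sup>2"
proof -
  have "1 - x \<le> exp (- x)"
    using exp_ge_add_one_self[of "- x"] by simp
  moreover have "exp (- x) \<le> 1 - x + x\<^sup>2"
  proof -
    have "1 \<le> (1 - x + x\<^sup>2) * (1 + x)"
      using assms by (simp add: algebra_simps power2_eq_square)
    also have "\<dots> \<le> (1 - x + x\<^sup>2) * exp x"
    proof (rule mult_left_mono)
      have "0 \<le> (1 - x)\<^sup>2 + x" using assms by simp
      also have "\<dots> = 1 - x + x\<^sup>2" by (simp add: power2_eq_square algebra_simps)
      finally show "0 \<le> 1 - x + x\<^sup>2" .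
    qed (use exp_ge_add_one_self[of x] in simp)
    finally show ?thesis by (simp add: exp_minus field_simps)
  qed
  ultimately show ?thesis by simp
qed

definition poisson_weight :: "real \<Rightarrow> nat \<Rightarrow> real" where
  "poisson_weight c m = exp (- c) * c ^ m / fact m"

lemma poisson_weight_bounds:
  assumes "0 \<le> c"
  shows "0 \<le> poisson_weight c m" "poisson_weight c m \<le> 1"
proof -
  show "0 \<le> poisson_weight c m"
    using assms by (simp add: poisson_weight_def)
  show "poisson_weight c m \<le> 1"
  proof (cases "c = 0")
    case True
    then show ?thesis by (cases m) (auto simp: poisson_weight_def)
  next
    case False
    then have "poisson_weight c m = pmf (poisson_pmf c) m"
      using assms by (simp add: poisson_weight_def mult.commute)
    then show ?thesis by (simp add: pmf_le_1)
  qed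
qed

lemma Least_le_iff:
  fixes f :: "nat \<Rightarrow> 'a :: linorder"
  assumes "mono f" "x \<le> f k0"
  shows "(LEAST k. x \<le> f k) \<le> k \<longleftrightarrow> x \<le> f k"
proof
  assume "(LEAST k. x \<le> f k) \<le> k"
  then have "f (LEAST k. x \<le> f k) \<le> f k" using assms(1) by (rule monoD[rotated])
  moreover have "x \<le> f (LEAST k. x \<le> f k)" by (rule LeastI[of "\<lambda>k. x \<le> f k", OF assms(2)])
  ultimately show "x \<le> f k" by simp
qed (rule Least_le)

lemma eventually_eq_tendsto:
  fixes f :: "nat \<Rightarrow> 'b::topological_space"
  assumes "eventually (\<lambda>m. f m = g m) sequentially" "g \<longlonglongrightarrow> c"
  shows "f \<longlonglongrightarrow> c"
  using Lim_transform_eventually[OF assms(2)] assms(1) by (simp add: eq_commute)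

section \<open>The resolvent and its discrete approximation\<close>

lemma matrix_inv_inverse:
  fixes A :: "'a::semiring_1^'n^'m"
  assumes "invertible A"
  shows "A ** matrix_inv A = mat 1" "matrix_inv A ** A = mat 1"
  using someI_ex[OF assms[unfolded invertible_def]] by (auto simp: matrix_inv_def)

lemma matrix_inv_transpose:
  fixes A :: "'a::field^'n^'n"
  assumes A: "invertible A"
  shows "matrix_inv (transpose A) = transpose (matrix_inv A)"
proof -
  have 1: "transpose A ** transpose (matrix_inv A) = mat 1" "transpose (matrix_inv A) ** transpose A = mat 1"
    using matrix_inv_inverse[OF A] by (simp_all flip: matrix_transpose_mul add: transpose_mat)
  then have "invertible (transpose A)"
    unfolding invertible_def by blast
  note matrix_inv_inverse(2)[OF this]
  then have "matrix_inv (transpose A) ** (transpose A ** transpose (matrix_inv A)) = transpose (matrix_inv A)"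
    by (simp add: matrix_mul_assoc)
  then show ?thesis by (simp add: 1)
qed

lemma diag_mult_left: "(diag d ** A) $ i $ j = d i * A $ i $ j"
proof -
  have "(\<Sum>k\<in>UNIV. (if i = k then d i else 0) * A $ k $ j) = (\<Sum>k\<in>UNIV. if i = k then d i * A $ k $ j else 0)"
    by (intro sum.cong) auto
  then show ?thesis by (simp add: matrix_matrix_mult_def diag_def)
qed

lemma diag_mult_right: "(A ** diag d) $ i $ j = A $ i $ j * d j"
proof -
  have "(\<Sum>k\<in>UNIV. A $ i $ k * (if k = j then d k else 0)) = (\<Sum>k\<in>UNIV. if k = j then A $ i $ k * d k else 0)"
    by (intro sum.cong) auto
  then show ?thesis by (simp add: matrix_matrix_mult_def diag_def)
qed

text \<open>The matrix is strictly diagonally dominant, because \<open>Re z \<ge> 0\<close>, the rates are positive and the rows of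
a generator sum to zero: the row of a component of maximal modulus forces a kernel vector to vanish.\<close>
lemma M_matrix_invertible:
  fixes Q :: "real^'n^'n"
  assumes off: "\<And>i j. i \<noteq> j \<Longrightarrow> 0 \<le> Q $ i $ j" and rows: "\<And>i. (\<Sum>j\<in>UNIV. Q $ i $ j) = 0"
    and lam: "\<And>i. 0 < lam i" and z: "0 \<le> Re z"
  shows "invertible (M_matrix Q lam z)"
proof -
  let ?A = "M_matrix Q lam z"
  have "x = 0" if x: "?A *v x = 0" for x
  proof -
    obtain i where i: "\<And>j. cmod (x $ j) \<le> cmod (x $ i)"
    proof -
      have fin: "finite (range (\<lambda>j. cmod (x $ j)))" by simp
      have "Max (range (\<lambda>j. cmod (x $ j))) \<in> range (\<lambda>j. cmod (x $ j))"
        by (rule Max_in) auto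
      then obtain i where i: "Max (range (\<lambda>j. cmod (x $ j))) = cmod (x $ i)" by (rule imageE)
      show ?thesis using Max_ge[OF fin, unfolded i] by (intro that[of i]) auto
    qed
    have A: "?A $ i $ j = (if i = j then z + of_real (lam i) - of_real (Q $ i $ i) else - of_real (Q $ i $ j))" for j
      by (auto simp: M_matrix_def rate_matrix_def diag_def mat_def)
    have "(\<Sum>j\<in>UNIV. ?A $ i $ j * x $ j) = 0"
      using x by (simp add: matrix_vector_mult_def vec_eq_iff)
    then have row: "(z + of_real (lam i) - of_real (Q $ i $ i)) * x $ i
        = (\<Sum>j\<in>UNIV - {i}. of_real (Q $ i $ j) * x $ j)"
      by (subst (asm) sum.remove[of _ i]) (auto simp: A sum_negf eq_neg_iff_add_eq_0 algebra_simps)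
    have "cmod (\<Sum>j\<in>UNIV - {i}. of_real (Q $ i $ j) * x $ j) \<le> (\<Sum>j\<in>UNIV - {i}. Q $ i $ j * cmod (x $ i))"
    proof (rule order_trans[OF norm_sum sum_mono])
      fix j assume "j \<in> UNIV - {i}"
      then show "cmod (of_real (Q $ i $ j) * x $ j) \<le> Q $ i $ j * cmod (x $ i)"
        using off[of i j] i[of j] by (simp add: norm_mult mult_left_mono)
    qed
    also have "(\<Sum>j\<in>UNIV - {i}. Q $ i $ j * cmod (x $ i)) = - Q $ i $ i * cmod (x $ i)"
      using rows[of i] by (simp add: sum_distrib_right[symmetric] sum_diff1)
    finally have upper: "cmod (z + of_real (lam i) - of_real (Q $ i $ i)) * cmod (x $ i) \<le> - Q $ i $ i * cmod (x $ i)"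
      unfolding row[symmetric] norm_mult .
    have "lam i - Q $ i $ i \<le> cmod (z + of_real (lam i) - of_real (Q $ i $ i))"
      using complex_Re_le_cmod[of "z + of_real (lam i) - of_real (Q $ i $ i)"] z by simp
    then have "(lam i - Q $ i $ i) * cmod (x $ i) \<le> cmod (z + of_real (lam i) - of_real (Q $ i $ i)) * cmod (x $ i)"
      by (rule mult_right_mono) simp
    from order_trans[OF this upper] have "(lam i - Q $ i $ i) * cmod (x $ i) \<le> - Q $ i $ i * cmod (x $ i)" .
    then have "lam i * cmod (x $ i) \<le> 0" by (simp add: algebra_simps)
    then have "cmod (x $ i) = 0" using lam[of i] by (simp add: mult_le_0_iff)
    then have "x $ j = 0" for j using i[of j] by simp
    then show ?thesis by (simp add: vec_eq_iff)
  qed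
  then obtain A' where "A' ** ?A = mat 1"
    using matrix_left_invertible_ker[of ?A] by blast
  then show ?thesis
    using matrix_left_right_inverse[of A' ?A] by (auto simp: invertible_def)
qed

text \<open>Here \<open>v p\<close> is a positive row vector with \<open>v (Suc p) = v p A (1 - h \<Lambda>)\<close> up to an error of order
\<open>h\<^sup>2\<close>, for a stochastic matrix \<open>A\<close>. The row vector \<open>s\<close> is \<open>h\<close> times the generating function of \<open>v\<close>
at \<open>e\<close>. The mass of \<open>v p\<close> shrinks by the factor \<open>1 - h l / 2\<close> in each step, so \<open>s\<close> is bounded
independently of \<open>h\<close> and the errors add up to order \<open>h\<close>. Up to this, summing the recursion shows that
\<open>s\<close> solves a linear system whose matrix is a difference quotient, and that \<open>e s A \<Lambda>\<close> generates the
losses \<open>b p - v (Suc p)\<close>.\<close>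
lemma discrete_resolvent:
  fixes v b :: "nat \<Rightarrow> 'n::finite \<Rightarrow> real" and A :: "'n \<Rightarrow> 'n \<Rightarrow> real" and e :: complex
  assumes h: "0 < h" and C: "0 \<le> C" and l: "0 < l" "\<And>j. l \<le> lam j" "\<And>j. h * lam j \<le> 1"
    and small: "real CARD('n) * C * h \<le> l / 2"
    and e: "cmod e \<le> 1"
    and A: "\<And>i j. 0 \<le> A i j" "\<And>i. (\<Sum>j\<in>UNIV. A i j) = 1"
    and v: "\<And>p j. 0 \<le> v p j"
    and b: "\<And>p j. b p j = (\<Sum>i\<in>UNIV. v p i * A i j)"
    and step: "\<And>p j. \<bar>v (Suc p) j - (1 - h * lam j) * b p j\<bar> \<le> C * h\<^sup>2 * (\<Sum>i\<in>UNIV. v p i)"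
  obtains s :: "'n \<Rightarrow> complex" where
    "\<And>i. cmod (s i) \<le> 2 / l * (\<Sum>i\<in>UNIV. v 0 i)"
    "\<And>j. cmod ((\<Sum>i\<in>UNIV. s i * ((of_bool (i = j) - e * of_real (A i j * (1 - h * lam j))) / of_real h)) - of_real (v 0 j))
       \<le> 2 * C / l * (\<Sum>i\<in>UNIV. v 0 i) * h"
    "\<And>j. cmod ((\<Sum>p. e ^ Suc p * of_real (b p j - v (Suc p) j)) - e * of_real (lam j) * (\<Sum>i\<in>UNIV. s i * of_real (A i j)))
       \<le> 2 * C / l * (\<Sum>i\<in>UNIV. v 0 i) * h"
proof -
  define \<sigma> where "\<sigma> p = (\<Sum>i\<in>UNIV. v p i)" for p
  define \<rho> where "\<rho> = 1 - h * l / 2"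
  have hl: "h * l \<le> 1"
    using l(3)[of undefined] mult_left_mono[OF l(2)[of undefined], of h] h by linarith
  have \<rho>: "0 \<le> \<rho>" "\<rho> < 1"
    using hl h l(1) by (auto simp: \<rho>_def)
  have \<sigma>_nonneg: "0 \<le> \<sigma> p" for p unfolding \<sigma>_def by (rule sum_nonneg) (rule v)
  have v_le: "v p j \<le> \<sigma> p" for p j
    unfolding \<sigma>_def using v by (intro member_le_sum) auto
  have b_nonneg: "0 \<le> b p j" for p j unfolding b by (intro sum_nonneg mult_nonneg_nonneg v A)
  have b_sum: "(\<Sum>j\<in>UNIV. b p j) = \<sigma> p" for p
    unfolding b \<sigma>_def by (subst sum.swap) (simp add: sum_distrib_left[symmetric] A)
  have b_le: "b p j \<le> \<sigma> p" for p j
    unfolding b_sum[symmetric] using b_nonneg by (intro member_le_sum) auto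
  have \<sigma>_step: "\<sigma> (Suc p) \<le> \<rho> * \<sigma> p" for p
  proof -
    have "v (Suc p) j \<le> (1 - h * l) * b p j + C * h\<^sup>2 * \<sigma> p" for j
    proof -
      have "v (Suc p) j \<le> (1 - h * lam j) * b p j + C * h\<^sup>2 * \<sigma> p"
        using step[of p j] by (simp add: \<sigma>_def abs_le_iff)
      also have "(1 - h * lam j) * b p j \<le> (1 - h * l) * b p j"
        using b_nonneg l(2) h by (intro mult_right_mono) auto
      finally show ?thesis by simp
    qed
    then have "\<sigma> (Suc p) \<le> (\<Sum>j\<in>UNIV. (1 - h * l) * b p j + C * h\<^sup>2 * \<sigma> p)"
      unfolding \<sigma>_def[of "Suc p"] by (rule sum_mono)
    also have "\<dots> = (1 - h * l) * \<sigma> p + (real CARD('n) * C * h) * h * \<sigma> p"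
      by (simp add: sum.distrib sum_distrib_left[symmetric] b_sum power2_eq_square)
    also have "(real CARD('n) * C * h) * h * \<sigma> p \<le> (l / 2) * h * \<sigma> p"
      using small h \<sigma>_nonneg[of p] by (intro mult_right_mono) auto
    finally show ?thesis by (simp add: \<rho>_def algebra_simps)
  qed
  have \<sigma>_geo: "\<sigma> p \<le> \<sigma> 0 * \<rho> ^ p" for p
  proof (induction p)
    case (Suc p)
    have "\<sigma> (Suc p) \<le> \<rho> * (\<sigma> 0 * \<rho> ^ p)"
      using \<sigma>_step[of p] mult_left_mono[OF Suc \<rho>(1)] by linarith
    then show ?case by (simp add: mult_ac)
  qed simp
  have geo: "(\<lambda>p. \<sigma> 0 * \<rho> ^ p) sums (2 / l * \<sigma> 0 / h)"
  proof -
    have "(\<lambda>p. \<sigma> 0 * \<rho> ^ p) sums (\<sigma> 0 * (1 / (1 - \<rho>)))"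
      by (intro sums_mult geometric_sums) (use \<rho> in auto)
    then show ?thesis by (simp add: \<rho>_def mult_ac)
  qed
  have e_pow: "cmod (e ^ p) \<le> 1" for p
    using e by (simp add: norm_power power_le_one)
  have dominated: "summable (\<lambda>p. e ^ p * of_real (f p))" "cmod (\<Sum>p. e ^ p * of_real (f p)) \<le> K * (2 / l * \<sigma> 0 / h)"
    if "\<And>p. \<bar>f p\<bar> \<le> K * \<sigma> p" "0 \<le> K" for f K
  proof -
    have bound: "cmod (e ^ p * of_real (f p)) \<le> K * (\<sigma> 0 * \<rho> ^ p)" for p
    proof -
      have "cmod (e ^ p * of_real (f p)) \<le> 1 * \<bar>f p\<bar>"
        unfolding norm_mult norm_of_real by (rule mult_right_mono[OF e_pow]) simp
      also have "\<dots> \<le> K * (\<sigma> 0 * \<rho> ^ p)"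
        using that(1)[of p] mult_left_mono[OF \<sigma>_geo[of p] that(2)] by simp
      finally show ?thesis .
    qed
    note K = sums_mult[OF geo, of K]
    show sm: "summable (\<lambda>p. e ^ p * of_real (f p))"
      by (rule summable_comparison_test'[OF sums_summable[OF K]]) (rule bound)
    have "cmod (\<Sum>p. e ^ p * of_real (f p)) \<le> (\<Sum>p. K * (\<sigma> 0 * \<rho> ^ p))"
      by (rule norm_suminf_le[OF bound sums_summable[OF K]])
    then show "cmod (\<Sum>p. e ^ p * of_real (f p)) \<le> K * (2 / l * \<sigma> 0 / h)"
      using sums_unique[OF K] by simp
  qed
  define \<epsilon> where "\<epsilon> j p = v (Suc p) j - (1 - h * lam j) * b p j" for j p
  define S where "S j = (\<Sum>p. e ^ p * of_real (v p j))" for j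
  define E where "E j = (\<Sum>p. e ^ p * of_real (\<epsilon> j p))" for j
  have v_abs: "\<bar>v p j\<bar> \<le> 1 * \<sigma> p" for p j using v v_le by simp
  have b_abs: "\<bar>b p j\<bar> \<le> 1 * \<sigma> p" for p j using b_nonneg b_le by simp
  have \<epsilon>_abs: "\<bar>\<epsilon> j p\<bar> \<le> (C * h\<^sup>2) * \<sigma> p" for p j using step[of p j] by (simp add: \<epsilon>_def \<sigma>_def)
  have S_sums: "(\<lambda>p. e ^ p * of_real (v p j)) sums S j" for j
    unfolding S_def by (rule summable_sums[OF dominated(1)[OF v_abs]]) simp
  have E_sums: "(\<lambda>p. e ^ p * of_real (\<epsilon> j p)) sums E j" for j
    unfolding E_def by (rule summable_sums[OF dominated(1)[OF \<epsilon>_abs]]) (use C in simp)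
  have E_bound: "cmod (E j) \<le> 2 * C / l * \<sigma> 0 * h" for j
  proof -
    have "cmod (E j) \<le> (C * h\<^sup>2) * (2 / l * \<sigma> 0 / h)"
      unfolding E_def by (rule dominated(2)[OF \<epsilon>_abs]) (use C in simp)
    also have "\<dots> = 2 * C / l * \<sigma> 0 * h"
      using h by (simp add: power2_eq_square field_simps)
    finally show ?thesis .
  qed
  define bS where "bS j = (\<Sum>i\<in>UNIV. S i * of_real (A i j))" for j
  have b_sums: "(\<lambda>p. e ^ p * of_real (b p j)) sums bS j" for j
  proof -
    have "(\<lambda>p. \<Sum>i\<in>UNIV. (e ^ p * of_real (v p i)) * of_real (A i j)) sums bS j"
      unfolding bS_def by (intro sums_sum sums_mult2 S_sums)
    then show ?thesis by (simp add: b sum_distrib_left mult.assoc)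
  qed
  have S_eq: "S j = of_real (v 0 j) + e * ((1 - h * lam j) * bS j + E j)" for j
  proof -
    have "(\<lambda>p. e * ((1 - h * lam j) * (e ^ p * of_real (b p j)) + e ^ p * of_real (\<epsilon> j p)))
        sums (e * ((1 - h * lam j) * bS j + E j))"
      by (intro sums_mult sums_add b_sums E_sums)
    moreover have "e * ((1 - h * lam j) * (e ^ p * of_real (b p j)) + e ^ p * of_real (\<epsilon> j p))
        = e ^ Suc p * of_real (v (Suc p) j)" for p
      by (simp add: \<epsilon>_def algebra_simps)
    ultimately have "(\<lambda>p. e ^ Suc p * of_real (v (Suc p) j)) sums (e * ((1 - h * lam j) * bS j + E j))"
      by (simp only:)
    from sums_Suc[OF this] have "(\<lambda>p. e ^ p * of_real (v p j)) sums (e * ((1 - h * lam j) * bS j + E j) + of_real (v 0 j))"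
      by simp
    from sums_unique2[OF S_sums this] show ?thesis by simp
  qed
  have R_sums: "(\<lambda>p. e ^ Suc p * of_real (b p j - v (Suc p) j)) sums (e * (h * lam j * bS j - E j))" for j
  proof -
    have "(\<lambda>p. e * (h * lam j * (e ^ p * of_real (b p j)) - e ^ p * of_real (\<epsilon> j p)))
        sums (e * (h * lam j * bS j - E j))"
      by (intro sums_mult sums_diff b_sums E_sums)
    moreover have "e * (h * lam j * (e ^ p * of_real (b p j)) - e ^ p * of_real (\<epsilon> j p))
        = e ^ Suc p * of_real (b p j - v (Suc p) j)" for p
      by (simp add: \<epsilon>_def algebra_simps)
    ultimately show ?thesis by (simp only:)
  qed
  have eE: "cmod (e * E j) \<le> 2 * C / l * \<sigma> 0 * h" for j
    using mult_right_mono[OF e, of "cmod (E j)"] E_bound[of j] by (simp add: norm_mult)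
  show ?thesis
  proof (rule that[of "\<lambda>i. of_real h * S i"], unfold \<sigma>_def[symmetric])
    show "cmod (of_real h * S i) \<le> 2 / l * \<sigma> 0" for i
    proof -
      have "cmod (S i) \<le> 1 * (2 / l * \<sigma> 0 / h)"
        unfolding S_def by (rule dominated(2)[OF v_abs]) simp
      from mult_left_mono[OF this, of h] show ?thesis using h by (simp add: norm_mult)
    qed
    show "cmod ((\<Sum>i\<in>UNIV. of_real h * S i * ((of_bool (i = j) - e * of_real (A i j * (1 - h * lam j))) / of_real h)) - of_real (v 0 j))
       \<le> 2 * C / l * \<sigma> 0 * h" for j
    proof -
      have "(\<Sum>i\<in>UNIV. of_real h * S i * ((of_bool (i = j) - e * of_real (A i j * (1 - h * lam j))) / of_real h))
          = (\<Sum>i\<in>UNIV. (if i = j then S i else 0) - e * of_real (1 - h * lam j) * (S i * of_real (A i j)))"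
        using h by (intro sum.cong) (auto simp: field_simps)
      also have "\<dots> = S j - e * of_real (1 - h * lam j) * bS j"
        by (simp add: sum_subtractf bS_def sum_distrib_left)
      also have "\<dots> = of_real (v 0 j) + e * E j"
        by (subst S_eq) (simp add: algebra_simps)
      finally show ?thesis using eE[of j] by simp
    qed
    show "cmod ((\<Sum>p. e ^ Suc p * of_real (b p j - v (Suc p) j)) - e * of_real (lam j) * (\<Sum>i\<in>UNIV. of_real h * S i * of_real (A i j)))
       \<le> 2 * C / l * \<sigma> 0 * h" for j
    proof -
      have "(\<Sum>p. e ^ Suc p * of_real (b p j - v (Suc p) j)) = e * (h * lam j * bS j - E j)"
        using sums_unique[OF R_sums] by simp
      moreover have "(\<Sum>i\<in>UNIV. of_real h * S i * of_real (A i j)) = of_real h * bS j"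
        by (simp add: bS_def sum_distrib_left mult.assoc)
      ultimately have "(\<Sum>p. e ^ Suc p * of_real (b p j - v (Suc p) j)) - e * of_real (lam j) * (\<Sum>i\<in>UNIV. of_real h * S i * of_real (A i j)) = - (e * E j)"
        by (simp add: algebra_simps)
      then show ?thesis using eE[of j] by (metis norm_minus_cancel)
    qed
  qed
qed

text \<open>The matrix of the linear system for \<open>s\<close> converges to \<open>M(z)\<close>. Since \<open>s\<close> stays bounded and \<open>M(z)\<close>
is invertible, \<open>s\<close> converges to \<open>v0 M(z)\<^sup>-\<^sup>1\<close>; convergence of \<open>s\<close> need not be known in advance.\<close>
lemma discrete_resolvent_limit:
  fixes v b :: "nat \<Rightarrow> nat \<Rightarrow> 'n::finite \<Rightarrow> real" and P :: "real \<Rightarrow> real^'n^'n"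
  assumes h: "\<And>m. 0 < h m" "h \<longlonglongrightarrow> 0"
    and C: "0 \<le> C" and l: "0 < l" "\<And>j. l \<le> lam j" "\<And>m j. h m * lam j \<le> 1"
    and small: "\<And>m. real CARD('n) * C * h m \<le> l / 2"
    and z: "0 \<le> Re z"
    and P: "\<And>m i j. 0 \<le> P (h m) $ i $ j" "\<And>m i. (\<Sum>j\<in>UNIV. P (h m) $ i $ j) = 1"
    and P_deriv: "\<And>i j. (\<lambda>m. (P (h m) $ i $ j - of_bool (i = j)) / h m) \<longlonglongrightarrow> Q $ i $ j"
    and v: "\<And>m p j. 0 \<le> v m p j"
    and b: "\<And>m p j. b m p j = (\<Sum>i\<in>UNIV. v m p i * P (h m) $ i $ j)"
    and step: "\<And>m p j. \<bar>v m (Suc p) j - (1 - h m * lam j) * b m p j\<bar> \<le> C * (h m)\<^sup>2 * (\<Sum>i\<in>UNIV. v m p i)"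
    and v0: "\<And>i. (\<lambda>m. v m 0 i) \<longlonglongrightarrow> v0 i"
    and inv: "invertible (M_matrix Q lam z)"
  shows "(\<lambda>m. \<Sum>p. exp (- z * of_real (h m)) ^ Suc p * of_real (b m p j - v m (Suc p) j))
    \<longlonglongrightarrow> (\<Sum>i\<in>UNIV. of_real (v0 i) * (matrix_inv (M_matrix Q lam z) ** rate_matrix lam) $ i $ j)"
proof -
  define e where "e m = exp (- z * of_real (h m))" for m
  have e_le: "cmod (e m) \<le> 1" for m
    using z h(1)[of m] by (simp add: e_def mult_nonneg_nonneg)
  define \<sigma> where "\<sigma> m = (\<Sum>i\<in>UNIV. v m 0 i)" for m
  define c where "c m i j = (of_bool (i = j) - e m * of_real (P (h m) $ i $ j * (1 - h m * lam j))) / of_real (h m)" for m i j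
  define R where "R m j = (\<Sum>p. e m ^ Suc p * of_real (b m p j - v m (Suc p) j))" for m j
  define good where "good m s \<longleftrightarrow> (\<forall>i. cmod (s i) \<le> 2 / l * \<sigma> m) \<and>
      (\<forall>j. cmod ((\<Sum>i\<in>UNIV. s i * c m i j) - of_real (v m 0 j)) \<le> 2 * C / l * \<sigma> m * h m) \<and>
      (\<forall>j. cmod (R m j - e m * of_real (lam j) * (\<Sum>i\<in>UNIV. s i * of_real (P (h m) $ i $ j))) \<le> 2 * C / l * \<sigma> m * h m)"
    for m and s :: "'n \<Rightarrow> complex"
  have "\<exists>s. good m s" for m
    unfolding good_def \<sigma>_def c_def R_def
    by (rule discrete_resolvent[where h = "h m" and v = "v m" and b = "b m" and e = "e m" and lam = lam
          and A = "\<lambda>i j. P (h m) $ i $ j" and l = l and C = C,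
          OF h(1) C l(1,2,3) small e_le P v b step]) blast
  then obtain s where "\<And>m. good m (s m)"
    by metis
  then have s: "\<And>m i. cmod (s m i) \<le> 2 / l * \<sigma> m"
      "\<And>m j. cmod ((\<Sum>i\<in>UNIV. s m i * c m i j) - of_real (v m 0 j)) \<le> 2 * C / l * \<sigma> m * h m"
      "\<And>m j. cmod (R m j - e m * of_real (lam j) * (\<Sum>i\<in>UNIV. s m i * of_real (P (h m) $ i $ j))) \<le> 2 * C / l * \<sigma> m * h m"
    by (simp_all add: good_def)
  have \<sigma>_lim: "\<sigma> \<longlonglongrightarrow> (\<Sum>i\<in>UNIV. v0 i)"
    unfolding \<sigma>_def by (intro tendsto_sum v0)
  have s_bounded: "Bseq (\<lambda>m. s m i)" for i
  proof -
    have "Bseq \<sigma>" using \<sigma>_lim convergentI convergent_imp_Bseq by blast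
    then obtain K where K: "\<And>m. norm (\<sigma> m) \<le> K" by (auto simp: Bseq_def)
    have "norm (s m i) \<le> 2 / l * K" for m
      using s(1)[of m i] mult_left_mono[OF K[of m], of "2 / l"] l(1)
      by (smt (verit) divide_nonneg_pos mult_left_mono real_norm_def)
    then show ?thesis by (rule BseqI')
  qed
  have err0: "(\<lambda>m. 2 * C / l * \<sigma> m * h m) \<longlonglongrightarrow> 0"
    using tendsto_mult[OF tendsto_mult[OF tendsto_const[of "2 * C / l"] \<sigma>_lim] h(2)] by simp
  have hc: "(\<lambda>m. of_real (h m) :: complex) \<longlonglongrightarrow> 0"
    using tendsto_of_real[OF h(2), where 'a = complex] by simp
  have e_lim: "e \<longlonglongrightarrow> 1"
    unfolding e_def using tendsto_exp[OF tendsto_mult[OF tendsto_const[of "- z"] hc]] by simp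
  have e_deriv: "(\<lambda>m. (1 - e m) / of_real (h m)) \<longlonglongrightarrow> z"
  proof -
    have "((\<lambda>x. exp (- z * x)) has_field_derivative (- z * exp (- z * 0))) (at 0)"
      by (auto intro!: derivative_eq_intros)
    then have "((\<lambda>x. (exp (- z * x) - 1) / x) \<longlongrightarrow> - z) (at 0)"
      by (simp add: has_field_derivative_iff)
    moreover have "filterlim (\<lambda>m. of_real (h m) :: complex) (at 0) sequentially"
      unfolding filterlim_at using hc h(1) by (auto intro!: always_eventually simp: less_imp_neq[symmetric])
    ultimately have "(\<lambda>m. (exp (- z * of_real (h m)) - 1) / of_real (h m)) \<longlonglongrightarrow> - z"
      by (rule filterlim_compose)
    from tendsto_minus[OF this] show ?thesis
      by (simp add: e_def minus_divide_left)
  qed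
  have P_lim: "(\<lambda>m. P (h m) $ i $ j) \<longlonglongrightarrow> of_bool (i = j)" for i j
  proof -
    have "(\<lambda>m. of_bool (i = j) + h m * ((P (h m) $ i $ j - of_bool (i = j)) / h m)) \<longlonglongrightarrow> of_bool (i = j) + 0 * Q $ i $ j"
      by (intro tendsto_intros h(2) P_deriv)
    then show ?thesis using h(1) by (simp add: less_imp_neq[symmetric])
  qed
  have c_lim: "(\<lambda>m. c m i j) \<longlonglongrightarrow> M_matrix Q lam z $ i $ j" for i j
  proof -
    have "(\<lambda>m. - of_real ((P (h m) $ i $ j - of_bool (i = j)) / h m)
        + of_real (P (h m) $ i $ j) * ((1 - e m) / of_real (h m))
        + e m * of_real (P (h m) $ i $ j * lam j))
       \<longlonglongrightarrow> - of_real (Q $ i $ j) + of_real (of_bool (i = j)) * z + 1 * of_real (of_bool (i = j) * lam j)"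
      by (intro tendsto_intros P_deriv P_lim e_deriv e_lim)
    moreover have "- of_real ((P (h m) $ i $ j - of_bool (i = j)) / h m)
        + of_real (P (h m) $ i $ j) * ((1 - e m) / of_real (h m))
        + e m * of_real (P (h m) $ i $ j * lam j) = c m i j" for m
      using h(1)[of m] by (simp add: c_def field_simps)
    ultimately show ?thesis
      by (cases "i = j") (simp_all add: M_matrix_def rate_matrix_def diag_def mat_def algebra_simps)
  qed
  let ?M = "M_matrix Q lam z"
  have sM: "(\<lambda>m. \<Sum>i\<in>UNIV. s m i * ?M $ i $ j) \<longlonglongrightarrow> of_real (v0 j)" for j
  proof -
    have "(\<lambda>m. (\<Sum>i\<in>UNIV. s m i * c m i j) - of_real (v m 0 j)) \<longlonglongrightarrow> 0"
      by (rule Lim_null_comparison[OF _ err0]) (use s(2) in auto)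
    moreover have "(\<lambda>m. \<Sum>i\<in>UNIV. s m i * (?M $ i $ j - c m i j)) \<longlonglongrightarrow> 0"
    proof (rule tendsto_null_sum)
      fix i
      have "Zfun (\<lambda>m. ?M $ i $ j - c m i j) sequentially"
        using tendsto_diff[OF tendsto_const c_lim[of i j], of "?M $ i $ j"] by (simp add: tendsto_Zfun_iff)
      from bounded_bilinear.Bfun_prod_Zfun[OF bounded_bilinear_mult s_bounded this]
      show "(\<lambda>m. s m i * (?M $ i $ j - c m i j)) \<longlonglongrightarrow> 0" by (simp add: tendsto_Zfun_iff)
    qed
    moreover have "(\<lambda>m. of_real (v m 0 j) :: complex) \<longlonglongrightarrow> of_real (v0 j)"
      by (intro tendsto_intros v0)
    ultimately have "(\<lambda>m. ((\<Sum>i\<in>UNIV. s m i * c m i j) - of_real (v m 0 j))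
        + (\<Sum>i\<in>UNIV. s m i * (?M $ i $ j - c m i j)) + of_real (v m 0 j)) \<longlonglongrightarrow> 0 + 0 + of_real (v0 j)"
      by (intro tendsto_add)
    then show ?thesis by (simp add: algebra_simps sum_subtractf)
  qed
  have inverse: "?M ** matrix_inv ?M = mat 1"
    by (rule matrix_inv_inverse[OF inv])
  have s_lim: "(\<lambda>m. s m k) \<longlonglongrightarrow> (\<Sum>j\<in>UNIV. of_real (v0 j) * matrix_inv ?M $ j $ k)" for k
  proof -
    have "(\<lambda>m. \<Sum>j\<in>UNIV. (\<Sum>i\<in>UNIV. s m i * ?M $ i $ j) * matrix_inv ?M $ j $ k)
        \<longlonglongrightarrow> (\<Sum>j\<in>UNIV. of_real (v0 j) * matrix_inv ?M $ j $ k)"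
      by (intro tendsto_intros sM)
    moreover have "(\<Sum>j\<in>UNIV. (\<Sum>i\<in>UNIV. s m i * ?M $ i $ j) * matrix_inv ?M $ j $ k) = s m k" for m
    proof -
      have "(\<Sum>j\<in>UNIV. (\<Sum>i\<in>UNIV. s m i * ?M $ i $ j) * matrix_inv ?M $ j $ k)
          = (\<Sum>i\<in>UNIV. s m i * (\<Sum>j\<in>UNIV. ?M $ i $ j * matrix_inv ?M $ j $ k))"
        by (simp add: sum_distrib_left sum_distrib_right mult.assoc) (rule sum.swap)
      also have "\<dots> = (\<Sum>i\<in>UNIV. s m i * (?M ** matrix_inv ?M) $ i $ k)"
        by (simp add: matrix_matrix_mult_def)
      also have "\<dots> = s m k"
        by (simp add: inverse mat_def if_distrib[of "\<lambda>x. _ * x"] cong: if_cong)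
      finally show ?thesis .
    qed
    ultimately show ?thesis by simp
  qed
  have "(\<lambda>m. R m j - e m * of_real (lam j) * (\<Sum>i\<in>UNIV. s m i * of_real (P (h m) $ i $ j))) \<longlonglongrightarrow> 0"
    by (rule Lim_null_comparison[OF _ err0]) (use s(3) in auto)
  moreover have "(\<lambda>m. e m * of_real (lam j) * (\<Sum>i\<in>UNIV. s m i * of_real (P (h m) $ i $ j)))
     \<longlonglongrightarrow> 1 * of_real (lam j) * (\<Sum>i\<in>UNIV. (\<Sum>k\<in>UNIV. of_real (v0 k) * matrix_inv ?M $ k $ i) * of_real (of_bool (i = j)))"
    by (intro tendsto_intros e_lim s_lim P_lim)
  ultimately have "(\<lambda>m. (R m j - e m * of_real (lam j) * (\<Sum>i\<in>UNIV. s m i * of_real (P (h m) $ i $ j)))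
      + e m * of_real (lam j) * (\<Sum>i\<in>UNIV. s m i * of_real (P (h m) $ i $ j)))
     \<longlonglongrightarrow> 0 + 1 * of_real (lam j) * (\<Sum>i\<in>UNIV. (\<Sum>k\<in>UNIV. of_real (v0 k) * matrix_inv ?M $ k $ i) * of_real (of_bool (i = j)))"
    by (rule tendsto_add)
  moreover have "0 + 1 * of_real (lam j) * (\<Sum>i\<in>UNIV. (\<Sum>k\<in>UNIV. of_real (v0 k) * matrix_inv ?M $ k $ i) * of_real (of_bool (i = j)))
     = (\<Sum>i\<in>UNIV. of_real (v0 i) * (matrix_inv ?M ** rate_matrix lam) $ i $ j)"
  proof -
    have col: "(matrix_inv ?M ** rate_matrix lam) $ i $ j = matrix_inv ?M $ i $ j * of_real (lam j)" for i
      by (simp add: matrix_matrix_mult_def rate_matrix_def diag_def if_distrib[of "\<lambda>x. _ * x"] cong: if_cong)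
    have pick: "(\<Sum>i\<in>UNIV. f i * of_real (of_bool (i = j))) = f j" for f :: "'n \<Rightarrow> complex"
      by (simp add: of_bool_def if_distrib[of of_real] if_distrib[of "\<lambda>x. _ * x"] cong: if_cong)
    show ?thesis
      unfolding pick col add_0_left mult_1_left sum_distrib_left
      by (intro sum.cong refl) (simp only: mult_ac)
  qed
  ultimately show ?thesis
    unfolding R_def e_def by (simp only: diff_add_cancel)
qed

section \<open>The background chain and the arrival epochs\<close>

definition past_sigma :: "'a measure \<Rightarrow> (real \<Rightarrow> 'a \<Rightarrow> 'n) \<Rightarrow> real \<Rightarrow> 'a measure" where
  "past_sigma M X u = sigma (space M) {X t -` {i} \<inter> space M | t i. 0 \<le> t \<and> t \<le> u}"

definition arrivals_upto :: "(nat \<Rightarrow> 'a \<Rightarrow> real) \<Rightarrow> real \<Rightarrow> 'a \<Rightarrow> nat" where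
  "arrivals_upto T v \<omega> = card {n. 2 \<le> n \<and> T n \<omega> \<le> v}"

text \<open>The transition semigroup, whose existence is part of the assumption on the background process, is fixed
once and for all.\<close>
locale modulated_workload_semigroup = modulated_workload M Q lam B a w X T S W
  for M :: "'a measure"
    and Q :: "real^'n^'n"
    and lam :: "'n \<Rightarrow> real"
    and B :: "'n \<Rightarrow> real measure"
    and a w :: real
    and X :: "real \<Rightarrow> 'a \<Rightarrow> 'n"
    and T S W :: "nat \<Rightarrow> 'a \<Rightarrow> real" +
  fixes P :: "real \<Rightarrow> real^'n^'n"
  assumes semigroup: "transition_semigroup P"
    and generator: "has_generator P Q"
    and markov: "markov_process M X P"
begin

lemma X_measurable[measurable]: "0 \<le> t \<Longrightarrow> X t \<in> M \<rightarrow>\<^sub>M count_space UNIV"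
  using markov by (auto simp: markov_process_def)

lemma X_right_constant:
  "\<omega> \<in> space M \<Longrightarrow> 0 \<le> t \<Longrightarrow> eventually (\<lambda>u. X u \<omega> = X t \<omega>) (at_right t)"
  using markov by (auto simp: markov_process_def)

lemma P_nonneg: "0 \<le> t \<Longrightarrow> 0 \<le> P t $ i $ j"
  and P_row_sum: "0 \<le> t \<Longrightarrow> (\<Sum>j\<in>UNIV. P t $ i $ j) = 1"
  using semigroup by (auto simp: transition_semigroup_def)

lemma P_le_1: "0 \<le> t \<Longrightarrow> P t $ i $ j \<le> 1"
  using member_le_sum[of j UNIV "\<lambda>j. P t $ i $ j"] by (simp add: P_row_sum P_nonneg)

subsection \<open>Sigma-algebras\<close>

lemma space_past[simp]: "space (past_sigma M X u) = space M"
  and space_background[simp]: "space (background_sigma M X) = space M"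
  and space_background_arrival[simp]: "space (background_arrival_sigma M X T) = space M"
  unfolding past_sigma_def background_sigma_def background_arrival_sigma_def
  by (rule space_measure_of, blast)+

lemma sets_past: "sets (past_sigma M X u) = sigma_sets (space M) {X t -` {i} \<inter> space M | t i. 0 \<le> t \<and> t \<le> u}"
  and sets_background: "sets (background_sigma M X) = sigma_sets (space M) {X t -` {i} \<inter> space M | t i. 0 \<le> t}"
  and sets_background_arrival: "sets (background_arrival_sigma M X T) =
     sigma_sets (space M) ({X t -` {i} \<inter> space M | t i. 0 \<le> t} \<union>
                      {T n -` C \<inter> space M | n C. 1 \<le> n \<and> C \<in> sets borel})"
  unfolding past_sigma_def background_sigma_def background_arrival_sigma_def
  by (auto intro!: sets_measure_of)

lemma past_mono: "u \<le> v \<Longrightarrow> sets (past_sigma M X u) \<subseteq> sets (past_sigma M X v)"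
  unfolding sets_past by (rule sigma_sets_mono') fastforce

lemma past_background: "sets (past_sigma M X u) \<subseteq> sets (background_sigma M X)"
  unfolding sets_past sets_background by (rule sigma_sets_mono') fastforce

lemma background_background_arrival:
  "sets (background_sigma M X) \<subseteq> sets (background_arrival_sigma M X T)"
  unfolding sets_background sets_background_arrival by (rule sigma_sets_mono') blast

lemma background_arrival_events: "sets (background_arrival_sigma M X T) \<subseteq> events"
  unfolding sets_background_arrival
  by (rule sets.sigma_sets_subset) (auto intro!: measurable_sets[OF X_measurable] measurable_sets[OF T_measurable])

lemma background_events: "sets (background_sigma M X) \<subseteq> events"
  using background_background_arrival background_arrival_events by blast

lemma past_events: "sets (past_sigma M X u) \<subseteq> events"
  using past_background background_events by blast

lemma subalgebra_background: "finite_measure_subalgebra M (background_sigma M X)"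
  by unfold_locales (auto simp: subalgebra_def intro: subsetD[OF background_events])

lemma subalgebra_background_arrival: "finite_measure_subalgebra M (background_arrival_sigma M X T)"
  by unfold_locales (auto simp: subalgebra_def intro: subsetD[OF background_arrival_events])

lemma past_measurable_mono: "f \<in> past_sigma M X u \<rightarrow>\<^sub>M N \<Longrightarrow> u \<le> v \<Longrightarrow> f \<in> past_sigma M X v \<rightarrow>\<^sub>M N"
  using past_mono[of u v] by (auto simp: measurable_def)

lemma past_measurable_M: "f \<in> past_sigma M X u \<rightarrow>\<^sub>M N \<Longrightarrow> f \<in> M \<rightarrow>\<^sub>M N"
  using past_events[of u] by (auto simp: measurable_def)

lemma background_arrival_measurable_M: "f \<in> background_arrival_sigma M X T \<rightarrow>\<^sub>M N \<Longrightarrow> f \<in> M \<rightarrow>\<^sub>M N"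
  using background_arrival_events by (auto simp: measurable_def)

lemma X_past_measurable: "0 \<le> t \<Longrightarrow> t \<le> u \<Longrightarrow> X t \<in> past_sigma M X u \<rightarrow>\<^sub>M count_space UNIV"
  by (auto simp: measurable_count_space_eq2 sets_past intro!: sigma_sets.Basic)

lemma X_background_arrival_measurable:
  "0 \<le> t \<Longrightarrow> X t \<in> background_arrival_sigma M X T \<rightarrow>\<^sub>M count_space UNIV"
  by (auto simp: measurable_count_space_eq2 sets_background_arrival intro!: sigma_sets.Basic)

lemma T_background_arrival_measurable:
  "1 \<le> n \<Longrightarrow> T n \<in> borel_measurable (background_arrival_sigma M X T)"
  by (rule measurableI) (auto simp: sets_background_arrival intro!: sigma_sets.Basic)

subsection \<open>Arrival epochs\<close>

lemma T_strict_mono: "\<omega> \<in> space M \<Longrightarrow> 1 \<le> m \<Longrightarrow> m < n \<Longrightarrow> T m \<omega> < T n \<omega>"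
proof (induction n)
  case (Suc n)
  then show ?case
    using T_increasing[OF Suc.prems(1), of n] by (cases "m = n") auto
qed simp

lemma T_mono: "\<omega> \<in> space M \<Longrightarrow> 1 \<le> m \<Longrightarrow> m \<le> n \<Longrightarrow> T m \<omega> \<le> T n \<omega>"
  using T_strict_mono[of \<omega> m n] by (cases "m = n") auto

lemma T_nonneg: "\<omega> \<in> space M \<Longrightarrow> 1 \<le> n \<Longrightarrow> 0 \<le> T n \<omega>"
  using T_mono[of \<omega> 1 n] T_first[of \<omega>] by simp

text \<open>The customer who arrives at time \<open>0\<close> is not counted, so the \<open>l\<close>th counted arrival takes place at
\<open>T (Suc l)\<close>; for \<open>l = 0\<close> both sides are true as \<open>T 1 = 0\<close>.\<close>
lemma T_le_iff_arrivals:
  assumes \<omega>: "\<omega> \<in> space M" and v: "0 \<le> v"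
  shows "T (Suc l) \<omega> \<le> v \<longleftrightarrow> l \<le> arrivals_upto T v \<omega>"
proof -
  let ?S = "{n. 2 \<le> n \<and> T n \<omega> \<le> v}"
  have fin: "finite ?S"
    by (rule finite_subset[OF _ T_locally_finite[OF \<omega>, where u = v]]) auto
  show ?thesis
  proof
    assume "T (Suc l) \<omega> \<le> v"
    then have "T n \<omega> \<le> v" if "n \<in> {2..Suc l}" for n
      using T_mono[OF \<omega>, of n "Suc l"] that by simp
    then have "{2..Suc l} \<subseteq> ?S"
      by auto
    from card_mono[OF fin this] show "l \<le> arrivals_upto T v \<omega>"
      by (simp add: arrivals_upto_def)
  next
    assume l: "l \<le> arrivals_upto T v \<omega>"
    show "T (Suc l) \<omega> \<le> v"
    proof (rule ccontr)
      assume "\<not> T (Suc l) \<omega> \<le> v"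
      then have less: "v < T (Suc l) \<omega>" by simp
      then have "l \<noteq> 0"
        using T_first[OF \<omega>] v by (cases l) auto
      have "n \<le> l" if "T n \<omega> \<le> v" "2 \<le> n" for n
        using T_mono[OF \<omega>, of "Suc l" n] less that by (cases "n \<le> l") auto
      then have "?S \<subseteq> {2..l}" by auto
      from card_mono[OF _ this] have "arrivals_upto T v \<omega> \<le> l - 1"
        by (simp add: arrivals_upto_def)
      with l \<open>l \<noteq> 0\<close> show False by simp
    qed
  qed
qed

lemma arrivals_upto_add:
  assumes \<omega>: "\<omega> \<in> space M" and "u \<le> v"
  shows "arrivals_upto T v \<omega> = arrivals_upto T u \<omega> + num_arrivals T u v \<omega>"
proof -
  have "{n. 2 \<le> n \<and> T n \<omega> \<le> v} = {n. 2 \<le> n \<and> T n \<omega> \<le> u} \<union> {n. 2 \<le> n \<and> T n \<omega> \<in> {u<..v}}"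
    using assms by auto
  moreover have "finite {n. 2 \<le> n \<and> T n \<omega> \<le> u}" "finite {n. 2 \<le> n \<and> T n \<omega> \<in> {u<..v}}"
    by (rule finite_subset[OF _ T_locally_finite[OF \<omega>, where u = u]], auto)
      (rule finite_subset[OF _ T_locally_finite[OF \<omega>, where u = v]], auto)
  ultimately show ?thesis
    unfolding arrivals_upto_def num_arrivals_def by (simp, subst card_Un_disjoint) auto
qed

lemma arrivals_upto_measurable[measurable]:
  assumes v: "0 \<le> v"
  shows "arrivals_upto T v \<in> M \<rightarrow>\<^sub>M count_space UNIV"
proof -
  have T[measurable]: "T (Suc l) \<in> borel_measurable M" for l
    by (rule T_measurable) simp
  have "{\<omega> \<in> space M. arrivals_upto T v \<omega> = l} \<in> events" for l
  proof -
    have "{\<omega> \<in> space M. arrivals_upto T v \<omega> = l}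
        = {\<omega> \<in> space M. T (Suc l) \<omega> \<le> v \<and> \<not> T (Suc (Suc l)) \<omega> \<le> v}"
      using T_le_iff_arrivals[OF _ v] by (auto simp: not_less_eq_eq)
    also have "\<dots> \<in> events" by measurable
    finally show ?thesis .
  qed
  then show ?thesis
    by (auto simp: measurable_count_space_eq2_countable vimage_def Int_def conj_commute)
qed

lemma num_arrivals_measurable[measurable]:
  assumes "0 \<le> u" "u \<le> v"
  shows "num_arrivals T u v \<in> M \<rightarrow>\<^sub>M count_space UNIV"
proof -
  have v: "0 \<le> v"
    using assms by simp
  have "(\<lambda>\<omega>. arrivals_upto T v \<omega> - arrivals_upto T u \<omega>) \<in> M \<rightarrow>\<^sub>M count_space UNIV"
    using assms(1) v by measurable
  then show ?thesis
    using arrivals_upto_add[OF _ assms(2)] by (simp cong: measurable_cong)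
qed

lemma embedded_background_arrival_measurable:
  assumes n: "1 \<le> n"
  shows "embedded X T n \<in> background_arrival_sigma M X T \<rightarrow>\<^sub>M count_space UNIV"
proof -
  let ?F = "background_arrival_sigma M X T"
  have [measurable]: "T n \<in> borel_measurable ?F"
    by (rule T_background_arrival_measurable[OF n])
  have m: "(\<lambda>\<omega>. X (min (real k) (T n \<omega>)) \<omega>) \<in> ?F \<rightarrow>\<^sub>M count_space UNIV" for k :: nat
  proof (rule right_constant_eval_measurable[where u = "real k"])
    show "(\<lambda>\<omega>. min (real k) (T n \<omega>)) \<in> borel_measurable ?F" by measurable
  qed (use X_background_arrival_measurable X_right_constant T_nonneg n in auto)
  have "{\<omega> \<in> space ?F. embedded X T n \<omega> = i} \<in> sets ?F" for i
  proof -
    have [measurable]: "Measurable.pred ?F (\<lambda>\<omega>. X (min (real k) (T n \<omega>)) \<omega> = i)" for k :: nat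
      using m[of k] by measurable
    have "{\<omega> \<in> space ?F. embedded X T n \<omega> = i}
        = {\<omega> \<in> space ?F. \<exists>k::nat. T n \<omega> \<le> real k \<and> X (min (real k) (T n \<omega>)) \<omega> = i}"
    proof (intro Collect_cong conj_cong refl)
      fix \<omega>
      obtain k where "T n \<omega> \<le> real k"
        using real_arch_simple by blast
      then show "embedded X T n \<omega> = i \<longleftrightarrow>
          (\<exists>k::nat. T n \<omega> \<le> real k \<and> X (min (real k) (T n \<omega>)) \<omega> = i)"
        by (auto simp: embedded_def min.absorb2)
    qed
    also have "\<dots> \<in> sets ?F" by measurable
    finally show ?thesis .
  qed
  then show ?thesis
    by (auto simp: measurable_count_space_eq2 vimage_def Int_def conj_commute)
qed

lemma embedded_measurable[measurable]:
  "1 \<le> n \<Longrightarrow> embedded X T n \<in> M \<rightarrow>\<^sub>M count_space UNIV"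
  by (rule background_arrival_measurable_M[OF embedded_background_arrival_measurable])

subsection \<open>Rates\<close>

definition max_rate :: real where "max_rate = Max (range lam)"

lemma lam_le_max_rate: "lam i \<le> max_rate"
  unfolding max_rate_def by simp

lemma max_rate_pos: "0 < max_rate"
  using lam_pos lam_le_max_rate less_le_trans by blast

text \<open>Clamping the time to \<open>[0, v]\<close> makes the path as a function of both arguments depend on the information up
to \<open>v\<close> only. This is what makes integrals of the path over \<open>[u, v]\<close> functionals of the past of \<open>v\<close>.\<close>
lemma X_joint_measurable:
  assumes F: "space F = space M" "\<And>t. 0 \<le> t \<Longrightarrow> t \<le> v \<Longrightarrow> X t \<in> F \<rightarrow>\<^sub>M count_space UNIV"
    and v: "0 \<le> v"
  shows "(\<lambda>(\<omega>, y). X (max 0 (min v y)) \<omega>) \<in> F \<Otimes>\<^sub>M lborel \<rightarrow>\<^sub>M count_space UNIV"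
proof -
  have "(\<lambda>p. (\<lambda>t p. X t (fst p)) (max 0 (min v (snd p))) p) \<in> F \<Otimes>\<^sub>M lborel \<rightarrow>\<^sub>M count_space UNIV"
  proof (rule right_constant_eval_measurable[where u = v])
    show "(\<lambda>p. X t (fst p)) \<in> F \<Otimes>\<^sub>M lborel \<rightarrow>\<^sub>M count_space UNIV" if "0 \<le> t" "t \<le> v" for t
      using F(2)[OF that] by measurable
  qed (use X_right_constant F(1) v in \<open>auto simp: space_pair_measure\<close>)
  then show ?thesis by (simp add: case_prod_unfold)
qed

lemma X_path_measurable:
  assumes \<omega>: "\<omega> \<in> space M" and v: "0 \<le> v"
  shows "(\<lambda>y. X (max 0 (min v y)) \<omega>) \<in> lborel \<rightarrow>\<^sub>M count_space UNIV"
proof -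
  have "(\<lambda>y. (\<lambda>(\<omega>, y). X (max 0 (min v y)) \<omega>) (\<omega>, y)) \<in> lborel \<rightarrow>\<^sub>M count_space UNIV"
    by (rule measurable_compose[OF measurable_Pair1' X_joint_measurable[where F = M]]) (use \<omega> v in auto)
  then show ?thesis by simp
qed

lemma rate_set_integrable:
  fixes f :: "'n \<Rightarrow> real"
  assumes \<omega>: "\<omega> \<in> space M" and u: "0 \<le> u"
  shows "set_integrable lborel {u..v} (\<lambda>y. f (X y \<omega>))"
proof (cases "u \<le> v")
  case True
  let ?X = "\<lambda>y. X (max 0 (min v y)) \<omega>"
  have m[measurable]: "?X \<in> lborel \<rightarrow>\<^sub>M count_space UNIV"
    by (rule X_path_measurable) (use \<omega> u True in auto)
  have "integrable lborel (\<lambda>y. indicator {u..v} y *\<^sub>R f (?X y))"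
  proof (rule integrableI_bounded_set_indicator[where B = "Max (range (\<lambda>i. \<bar>f i\<bar>))"])
    show "AE y in lborel. y \<in> {u..v} \<longrightarrow> norm (f (?X y)) \<le> Max (range (\<lambda>i. \<bar>f i\<bar>))"
      by auto
  qed (use True in auto)
  also have "(\<lambda>y. indicator {u..v} y *\<^sub>R f (?X y)) = (\<lambda>y. indicator {u..v} y *\<^sub>R f (X y \<omega>))"
    using u by (auto simp: fun_eq_iff indicator_def)
  finally show ?thesis by (simp add: set_integrable_def)
qed (simp add: set_integrable_def)

lemma cumulative_rate_past_measurable:
  assumes "0 \<le> u" "u \<le> v"
  shows "cumulative_rate lam X u v \<in> borel_measurable (past_sigma M X v)"
proof -
  let ?F = "past_sigma M X v"
  have [measurable]: "(\<lambda>(\<omega>, y). X (max 0 (min v y)) \<omega>) \<in> ?F \<Otimes>\<^sub>M lborel \<rightarrow>\<^sub>M count_space UNIV"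
    by (rule X_joint_measurable) (use assms X_past_measurable in auto)
  have "(\<lambda>\<omega>. LINT y|lborel. indicator {u..v} y * lam (X (max 0 (min v y)) \<omega>)) \<in> borel_measurable ?F"
    by (rule lborel.borel_measurable_lebesgue_integral) measurable
  moreover have "indicator {u..v} y * lam (X (max 0 (min v y)) \<omega>) = indicator {u..v} y *\<^sub>R lam (X y \<omega>)" for y \<omega>
    using assms by (auto simp: indicator_def)
  ultimately show ?thesis
    by (simp add: cumulative_rate_def[abs_def] set_lebesgue_integral_def)
qed

lemma cumulative_rate_bounds:
  assumes \<omega>: "\<omega> \<in> space M" and u: "0 \<le> u" and uv: "u \<le> v"
  shows "0 \<le> cumulative_rate lam X u v \<omega>" "cumulative_rate lam X u v \<omega> \<le> max_rate * (v - u)"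
proof -
  show "0 \<le> cumulative_rate lam X u v \<omega>"
    unfolding cumulative_rate_def set_lebesgue_integral_def
    by (rule Bochner_Integration.integral_nonneg) (auto simp: indicator_def intro: less_imp_le[OF lam_pos])
  have "cumulative_rate lam X u v \<omega> \<le> (LINT y:{u..v}|lborel. max_rate)"
    unfolding cumulative_rate_def
    by (rule set_integral_mono) (use rate_set_integrable[OF \<omega> u] rate_set_integrable[OF \<omega> u, of _ "\<lambda>_. max_rate"] lam_le_max_rate in auto)
  also have "\<dots> = max_rate * (v - u)"
    using uv by (simp add: set_lebesgue_integral_def mult.commute)
  finally show "cumulative_rate lam X u v \<omega> \<le> max_rate * (v - u)" .
qed

section \<open>The chain and the counts over one grid step\<close>

subsection \<open>The Markov property for functionals of the past\<close>

definition cylinder :: "real set \<Rightarrow> (real \<Rightarrow> 'n) \<Rightarrow> 'a set" where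
  "cylinder I x = {\<omega>\<in>space M. \<forall>t\<in>I. X t \<omega> = x t}"

lemma cylinder_events: "finite I \<Longrightarrow> I \<subseteq> {0..u} \<Longrightarrow> cylinder I x \<in> events"
proof -
  assume I: "finite I" "I \<subseteq> {0..u}"
  have "{\<omega>\<in>space M. X t \<omega> = x t} \<in> events" if "t \<in> I" for t
  proof -
    have [measurable]: "X t \<in> M \<rightarrow>\<^sub>M count_space UNIV"
      using I that by auto
    show ?thesis by measurable
  qed
  then show ?thesis
    unfolding cylinder_def using I(1) by (rule sets.sets_Collect_finite_All)
qed

text \<open>The Markov property is given along increasing sequences of times. The finitely many times in \<open>I\<close> are
enumerated increasingly, which ends in \<open>u\<close>, and the sequence is continued by
\<open>u + y, u + 2 y, \<dots>\<close>.\<close>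
lemma markov_cylinder:
  assumes I: "finite I" "I \<subseteq> {0..u}" "u \<in> I" and y: "0 < y"
  shows "prob (cylinder I x \<inter> {\<omega>. X (u + y) \<omega> = j}) = prob (cylinder I x) * P y $ x u $ j"
proof -
  define ts where "ts = sorted_list_of_set I"
  define k where "k = card I - 1"
  define t where "t l = (if l \<le> k then ts ! l else u + y * real (l - k))" for l
  have card: "card I = Suc k"
    using I unfolding k_def by (metis One_nat_def Suc_pred card_gt_0_iff empty_iff)
  have ts: "set ts = I" "length ts = Suc k" "sorted_wrt (<) ts"
    using I(1) card by (auto simp: ts_def)
  have less: "ts ! p < ts ! q" if "p < q" "q \<le> k" for p q
    using sorted_wrt_nth_less[OF ts(3) that(1)] that(2) ts(2) by simp
  have mem: "ts ! p \<in> I" if "p \<le> k" for p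
    using that ts by (metis less_Suc_eq_le nth_mem)
  have last: "ts ! k = u"
  proof -
    obtain p where p: "p \<le> k" "u = ts ! p"
      using I(3) ts by (metis in_set_conv_nth less_Suc_eq_le)
    then show ?thesis
      using less[of p k] mem[of k] I(2) by (cases "p = k") auto
  qed
  have mono: "strict_mono t"
  proof (rule strict_monoI_Suc)
    fix l
    consider "l < k" | "l = k" | "l > k" by linarith
    then show "t l < t (Suc l)"
    proof cases
      case 1
      then show ?thesis using less[of l "Suc l"] by (simp add: t_def)
    next
      case 2
      then show ?thesis using y last by (simp add: t_def)
    next
      case 3
      then have "real (Suc l - k) = real (l - k) + 1" by simp
      with 3 show ?thesis using y by (simp add: t_def algebra_simps)
    qed
  qed
  define z where "z l = (if l \<le> k then x (t l) else j)" for l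
  have t_image: "t ` {..k} = I"
  proof -
    have "t ` {..k} = (!) ts ` {..<length ts}"
      using ts(2) by (intro image_cong) (auto simp: t_def)
    then show ?thesis using ts(1) by (auto simp: set_conv_nth)
  qed
  have all: "(\<forall>l\<le>k. X (t l) \<omega> = z l) \<longleftrightarrow> (\<forall>s\<in>I. X s \<omega> = x s)" for \<omega>
  proof -
    have "(\<forall>s\<in>I. X s \<omega> = x s) \<longleftrightarrow> (\<forall>l\<in>{..k}. X (t l) \<omega> = x (t l))"
      unfolding t_image[symmetric] by blast
    then show ?thesis by (auto simp: z_def)
  qed
  have t0: "0 \<le> t 0"
    using mem[of 0] I(2) by (auto simp: t_def)
  have "measure M {\<omega>\<in>space M. \<forall>l\<le>Suc k. X (t l) \<omega> = z l} =
        measure M {\<omega>\<in>space M. \<forall>l\<le>k. X (t l) \<omega> = z l}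
          * P (t (Suc k) - t k) $ z k $ z (Suc k)"
    using markov t0 mono unfolding markov_process_def by blast
  moreover have "{\<omega>\<in>space M. \<forall>l\<le>Suc k. X (t l) \<omega> = z l} = cylinder I x \<inter> {\<omega>. X (u + y) \<omega> = j}"
    unfolding le_Suc_eq using all by (auto simp: cylinder_def z_def t_def)
  moreover have "{\<omega>\<in>space M. \<forall>l\<le>k. X (t l) \<omega> = z l} = cylinder I x"
    using all by (auto simp: cylinder_def)
  moreover have "t (Suc k) - t k = y" "z k = x u" "z (Suc k) = j"
    using last by (auto simp: t_def z_def)
  ultimately show ?thesis by simp
qed

text \<open>Cylinders over finite sets of times generate the past of \<open>u\<close>. A cylinder that does not prescribe the
state at \<open>u\<close> is the disjoint union of those that do, to which the elementary Markov property applies.\<close>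
lemma markov_integral:
  assumes u: "0 \<le> u" and y: "0 < y"
    and \<Phi>: "\<Phi> \<in> borel_measurable (past_sigma M X u)"
    and bounded: "\<And>\<omega>. \<omega> \<in> space M \<Longrightarrow> \<bar>\<Phi> \<omega>\<bar> \<le> K"
  shows "(LINT \<omega>|M. \<Phi> \<omega> * indicator {\<omega>. X (u + y) \<omega> = j} \<omega>) = (LINT \<omega>|M. \<Phi> \<omega> * P y $ X u \<omega> $ j)"
proof -
  define D where "D \<omega> = indicator {\<omega>. X (u + y) \<omega> = j} \<omega> - P y $ X u \<omega> $ j" for \<omega>
  define G where "G = insert {} {cylinder I x | I x. finite I \<and> I \<subseteq> {0..u}}"
  have Xm[measurable]: "X u \<in> M \<rightarrow>\<^sub>M count_space UNIV" "X (u + y) \<in> M \<rightarrow>\<^sub>M count_space UNIV"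
    using u y by auto
  have int1: "integrable M (\<lambda>\<omega>. indicator {\<omega>. X (u + y) \<omega> = j} \<omega> :: real)"
    by (rule integrable_const_bound[where B = 1]) auto
  have int2: "integrable M (\<lambda>\<omega>. P y $ X u \<omega> $ j)"
    by (rule integrable_const_bound[where B = 1]) (use y P_nonneg P_le_1 in auto)
  have intD: "integrable M D"
    unfolding D_def using int1 int2 by simp
  have zero_u: "(LINT \<omega>|M. indicator (cylinder I x) \<omega> *\<^sub>R D \<omega>) = 0"
    if I: "finite I" "I \<subseteq> {0..u}" "u \<in> I" for I x
  proof -
    note C = cylinder_events[OF I(1,2), of x]
    have C': "cylinder I x \<inter> {\<omega>. X (u + y) \<omega> = j} \<in> events"
    proof -
      have "cylinder I x \<inter> {\<omega>. X (u + y) \<omega> = j} = cylinder I x \<inter> {\<omega>\<in>space M. X (u + y) \<omega> = j}"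
        by (auto simp: cylinder_def)
      also have "\<dots> \<in> events" using C by measurable
      finally show ?thesis .
    qed
    have "(LINT \<omega>|M. indicator (cylinder I x) \<omega> *\<^sub>R D \<omega>)
       = (LINT \<omega>|M. indicator (cylinder I x \<inter> {\<omega>. X (u + y) \<omega> = j}) \<omega> - P y $ x u $ j * indicator (cylinder I x) \<omega>)"
      by (rule Bochner_Integration.integral_cong)
        (use I(3) in \<open>auto simp: D_def cylinder_def indicator_def\<close>)
    also have "\<dots> = prob (cylinder I x \<inter> {\<omega>. X (u + y) \<omega> = j}) - P y $ x u $ j * prob (cylinder I x)"
      using C C' by (simp add: integrable_real_indicator emeasure_eq_measure)
    also have "\<dots> = 0"
      by (simp add: markov_cylinder[OF I y])
    finally show ?thesis .
  qed
  have zero: "(LINT \<omega>|M. indicator C \<omega> *\<^sub>R D \<omega>) = 0" if CG: "C \<in> G" for C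
  proof (cases "C = {}")
    case False
    then obtain I x where C: "C = cylinder I x" "finite I" "I \<subseteq> {0..u}"
      using CG unfolding G_def by blast
    show ?thesis
    proof (cases "u \<in> I")
      case True
      then show ?thesis using zero_u C by simp
    next
      case False
      let ?C = "\<lambda>i. cylinder (insert u I) (x(u := i))"
      have C_ev: "?C i \<in> events" for i
        by (rule cylinder_events[of _ u]) (use C u in auto)
      have split: "indicator C \<omega> *\<^sub>R D \<omega> = (\<Sum>i\<in>UNIV. indicator (?C i) \<omega> *\<^sub>R D \<omega>)" for \<omega>
      proof -
        have "indicator (?C i) \<omega> *\<^sub>R D \<omega> = (if X u \<omega> = i then indicator C \<omega> *\<^sub>R D \<omega> else 0)" for i
        proof -
          have "\<omega> \<in> ?C i \<longleftrightarrow> \<omega> \<in> C \<and> X u \<omega> = i"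
            using False by (auto simp: C(1) cylinder_def)
          then show ?thesis by (auto simp: indicator_def)
        qed
        then show ?thesis by simp
      qed
      have "(LINT \<omega>|M. indicator C \<omega> *\<^sub>R D \<omega>) = (\<Sum>i\<in>UNIV. LINT \<omega>|M. indicator (?C i) \<omega> *\<^sub>R D \<omega>)"
        unfolding split by (rule Bochner_Integration.integral_sum) (use integrable_mult_indicator[OF C_ev intD] in auto)
      also have "\<dots> = 0"
        using zero_u[of "insert u I"] C u by simp
      finally show ?thesis .
    qed
  qed simp
  have stable: "Int_stable G"
  proof (rule Int_stableI)
    fix C C' assume "C \<in> G" "C' \<in> G"
    then consider "C \<inter> C' = {}" | I x J z where "C = cylinder I x" "C' = cylinder J z" "C \<inter> C' \<noteq> {}"
        "finite I" "I \<subseteq> {0..u}" "finite J" "J \<subseteq> {0..u}"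
      unfolding G_def by auto blast
    then show "C \<inter> C' \<in> G"
    proof cases
      case 1
      then show ?thesis by (simp add: G_def)
    next
      case 2
      then obtain \<omega> where \<omega>: "\<omega> \<in> cylinder I x" "\<omega> \<in> cylinder J z" by auto
      have "C \<inter> C' = cylinder (I \<union> J) (\<lambda>t. X t \<omega>)"
        using \<omega> 2(1,2) by (auto simp: cylinder_def)
      then show ?thesis using 2 unfolding G_def by blast
    qed
  qed
  have "(LINT \<omega>|M. \<Phi> \<omega> * D \<omega>) = 0"
  proof (rule integral_mult_eq_0_if_zero_on_generator[OF stable _ _ intD zero])
    show G_events: "G \<subseteq> events"
      unfolding G_def using cylinder_events by auto
    have "cylinder {} undefined = space M" by (simp add: cylinder_def)
    then show "space M \<in> G" unfolding G_def by blast
    have "sets (past_sigma M X u) \<subseteq> sigma_sets (space M) G"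
      unfolding sets_past
    proof (rule sigma_sets_mono, clarify)
      fix t i assume t: "0 \<le> t" "t \<le> u"
      have "X t -` {i} \<inter> space M = cylinder {t} (\<lambda>_. i)"
        by (auto simp: cylinder_def)
      then show "X t -` {i} \<inter> space M \<in> sigma_sets (space M) G"
        using t unfolding G_def by (intro sigma_sets.Basic) auto
    qed
    moreover have "G \<subseteq> Pow (space M)"
      using G_events sets.space_closed by blast
    ultimately show "\<Phi> \<in> borel_measurable (sigma (space M) G)"
      using \<Phi> by (auto simp: measurable_def)
    show "norm (\<Phi> \<omega>) \<le> K" if "\<omega> \<in> space M" for \<omega>
      using bounded[OF that] by simp
  qed
  moreover have \<Phi>M[measurable]: "\<Phi> \<in> borel_measurable M"
    by (rule past_measurable_M[OF \<Phi>])
  have "integrable M \<Phi>"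
    by (rule integrable_const_bound[where B = K]) (use bounded in auto)
  then have "integrable M (\<lambda>\<omega>. \<Phi> \<omega> * indicator {\<omega>. X (u + y) \<omega> = j} \<omega>)" "integrable M (\<lambda>\<omega>. \<Phi> \<omega> * P y $ X u \<omega> $ j)"
    using integrable_mult_indicator[of "{\<omega>\<in>space M. X (u + y) \<omega> = j}" M \<Phi>]
    by (auto intro!: Bochner_Integration.integrable_bound[where f = \<Phi> and M = M]
        simp: indicator_def abs_mult P_nonneg P_le_1 y less_imp_le mult_left_le)
  ultimately show ?thesis
    by (simp add: D_def right_diff_distrib)
qed

subsection \<open>The conditional law of the counts\<close>

lemma counts_law:
  assumes t: "0 \<le> t 0" "strict_mono (t :: nat \<Rightarrow> real)" and D: "D \<in> sets (background_sigma M X)"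
  shows "prob ({\<omega>\<in>space M. \<forall>l<k. num_arrivals T (t l) (t (Suc l)) \<omega> = m l} \<inter> D)
    = (LINT \<omega>|M. indicator D \<omega> * (\<Prod>l<k. poisson_weight (cumulative_rate lam X (t l) (t (Suc l)) \<omega>) (m l)))"
proof -
  interpret F: finite_measure_subalgebra M "background_sigma M X"
    by (rule subalgebra_background)
  let ?E = "{\<omega>\<in>space M. \<forall>l<k. num_arrivals T (t l) (t (Suc l)) \<omega> = m l}"
  have t_nonneg: "0 \<le> t l" and t_step: "t l \<le> t (Suc l)" for l
    using t strict_mono_less_eq[OF t(2)] by (auto intro: order_trans[OF t(1)])
  have [measurable]: "num_arrivals T (t l) (t (Suc l)) \<in> M \<rightarrow>\<^sub>M count_space UNIV" for l
    by (rule num_arrivals_measurable) (use t_nonneg t_step in auto)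
  have E: "?E \<in> events" by measurable
  have D': "D \<in> events" using D background_events by auto
  have "prob (?E \<inter> D) = (LINT \<omega>:D|M. indicator ?E \<omega>)"
    using E D' by (simp add: set_lebesgue_integral_def flip: indicator_inter_arith)
      (simp add: Int_commute)
  also have "\<dots> = (LINT \<omega>:D|M. real_cond_exp M (background_sigma M X) (indicator ?E) \<omega>)"
    by (rule F.real_cond_exp_intA[OF _ D]) (use E in \<open>simp add: integrable_real_indicator emeasure_eq_measure\<close>)
  also have "\<dots> = (LINT \<omega>|M. indicator D \<omega> * (\<Prod>l<k. poisson_weight (cumulative_rate lam X (t l) (t (Suc l)) \<omega>) (m l)))"
    unfolding set_lebesgue_integral_def poisson_weight_def
  proof (rule integral_cong_AE)
    have [measurable]: "cumulative_rate lam X (t l) (t (Suc l)) \<in> borel_measurable M" for l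
      by (rule past_measurable_M[OF cumulative_rate_past_measurable]) (use t_nonneg t_step in auto)
    show "(\<lambda>\<omega>. indicator D \<omega> * (\<Prod>l<k. exp (- cumulative_rate lam X (t l) (t (Suc l)) \<omega>) *
        cumulative_rate lam X (t l) (t (Suc l)) \<omega> ^ m l / fact (m l))) \<in> borel_measurable M"
      using D' by measurable
    show "(\<lambda>\<omega>. indicator D \<omega> *\<^sub>R real_cond_exp M (background_sigma M X) (indicator ?E) \<omega>) \<in> borel_measurable M"
      using D' by measurable
  qed (use modulated_poisson[OF t, of k m] in \<open>auto\<close>)
  finally show ?thesis .
qed

subsection \<open>The chance of leaving a state in a short time\<close>

lemma leaving_prob_bound:
  obtains c h0 where "0 \<le> c" "0 < h0" "\<And>t i. 0 \<le> t \<Longrightarrow> t \<le> h0 \<Longrightarrow> 1 - P t $ i $ i \<le> c * t"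
proof -
  have P0: "P 0 = mat 1"
    using semigroup by (simp add: transition_semigroup_def)
  \<comment> \<open>one more than the slope at zero of each of the functions bounded here leaves room for the remainder\<close>
  define c where "c = (\<Sum>i\<in>UNIV. \<bar>Q $ i $ i\<bar>) + 1"
  have c: "\<bar>Q $ i $ i\<bar> + 1 \<le> c" for i
    unfolding c_def using member_le_sum[of i UNIV "\<lambda>i. \<bar>Q $ i $ i\<bar>"] by simp
  have "eventually (\<lambda>t. 1 - P t $ i $ i \<le> c * t) (at 0 within {0..})" for i
  proof -
    have "((\<lambda>t. (P t $ i $ i - 1) / t) \<longlongrightarrow> Q $ i $ i) (at 0 within {0..})"
      using generator[unfolded has_generator_def has_field_derivative_iff, rule_format, of i i]
      by (simp add: P0 mat_def)
    then have "eventually (\<lambda>t. (P t $ i $ i - 1) / t > Q $ i $ i - 1) (at 0 within {0..})"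
      by (rule order_tendstoD) simp
    moreover have "eventually (\<lambda>t::real. t \<in> {0..} \<and> t \<noteq> 0) (at 0 within {0..})"
      by (auto simp: eventually_at_filter)
    ultimately show ?thesis
    proof eventually_elim
      case (elim t)
      then have "(Q $ i $ i - 1) * t < P t $ i $ i - 1"
        by (simp add: field_simps)
      moreover have "(- c) * t \<le> (Q $ i $ i - 1) * t"
        using c[of i] elim by (intro mult_right_mono) auto
      ultimately show ?case by simp
    qed
  qed
  then have "eventually (\<lambda>t. \<forall>i. 1 - P t $ i $ i \<le> c * t) (at 0 within {0..})"
    by (simp add: eventually_all_finite)
  then obtain d where d: "0 < d" "\<And>t. t \<in> {0..} \<Longrightarrow> t \<noteq> 0 \<Longrightarrow> dist t 0 < d \<Longrightarrow> \<forall>i. 1 - P t $ i $ i \<le> c * t"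
    unfolding eventually_at by metis
  show ?thesis
  proof (rule that[of c "d / 2"])
    show "0 \<le> c" unfolding c_def by (simp add: sum_nonneg add_nonneg_nonneg)
    show "1 - P t $ i $ i \<le> c * t" if "0 \<le> t" "t \<le> d / 2" for t i
      using that d by (cases "t = 0") (auto simp: P0 mat_def dist_real_def)
  qed (use d in simp)
qed

subsection \<open>One grid step\<close>

text \<open>The functional \<open>\<Phi>\<close> stands for a conditional probability of a history up to \<open>u\<close>, and the exponential for the
conditional probability of no arrival in \<open>(u, u + h]\<close>. The exponent \<open>I\<close> is at most \<open>max_rate * h\<close>, so
\<open>e\<^sup>-\<^sup>I = 1 - I + O(h\<^sup>2)\<close>. The difference of \<open>I\<close> and \<open>h \<lambda>\<close> at the end point is at most
\<open>max_rate\<close> times the time \<open>N\<close> that the chain spends in \<open>[u, u + h]\<close> away from its final state. At each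
time \<open>y\<close> of the cell the chain has this property with probability at most \<open>c h\<close>, by the Markov property at
\<open>y\<close>; integrating over the cell, the mean of \<open>N\<close> is of order \<open>h\<^sup>2\<close>.\<close>
lemma no_arrival_step:
  assumes u: "0 \<le> u" and h: "0 < h"
    and leave: "\<And>t i. 0 \<le> t \<Longrightarrow> t \<le> h \<Longrightarrow> 1 - P t $ i $ i \<le> c * t" and c: "0 \<le> c"
    and \<Phi>: "\<Phi> \<in> borel_measurable (past_sigma M X u)"
    and bounds: "\<And>\<omega>. \<omega> \<in> space M \<Longrightarrow> 0 \<le> \<Phi> \<omega> \<and> \<Phi> \<omega> \<le> 1"
  shows "\<bar>(LINT \<omega>|M. \<Phi> \<omega> * exp (- cumulative_rate lam X u (u + h) \<omega>) * indicator {\<omega>. X (u + h) \<omega> = j} \<omega>)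
      - (1 - h * lam j) * (LINT \<omega>|M. \<Phi> \<omega> * indicator {\<omega>. X (u + h) \<omega> = j} \<omega>)\<bar>
    \<le> (max_rate\<^sup>2 + max_rate * c) * h\<^sup>2 * (LINT \<omega>|M. \<Phi> \<omega>)"
proof -
  define v where "v = u + h"
  have v: "0 \<le> v" "u \<le> v" using u h by (auto simp: v_def)
  define Xc where "Xc y \<omega> = X (max 0 (min v y)) \<omega>" for y \<omega>
  have Xc: "Xc y = X y" if "u \<le> y" "y \<le> v" for y
    using that u by (auto simp: Xc_def)
  define N where "N \<omega> = (LINT y:{u..v}|lborel. of_bool (X y \<omega> \<noteq> X v \<omega>) :: real)" for \<omega>
  let ?I = "cumulative_rate lam X u v"
  let ?J = "indicator {\<omega>. X v \<omega> = j} :: 'a \<Rightarrow> real"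
  have [measurable]: "\<Phi> \<in> borel_measurable M" "X v \<in> M \<rightarrow>\<^sub>M count_space UNIV"
    "?I \<in> borel_measurable M"
    using past_measurable_M[OF \<Phi>] v past_measurable_M[OF cumulative_rate_past_measurable[of u v]] u by auto
  have [measurable]: "(\<lambda>(\<omega>, y). Xc y \<omega>) \<in> M \<Otimes>\<^sub>M lborel \<rightarrow>\<^sub>M count_space UNIV"
    unfolding Xc_def by (rule X_joint_measurable) (use v in auto)
  have N_eq: "N \<omega> = (LINT y|lborel. indicator {u..v} y * of_bool (Xc y \<omega> \<noteq> X v \<omega>))" for \<omega>
    unfolding N_def set_lebesgue_integral_def
    by (rule Bochner_Integration.integral_cong) (auto simp: Xc indicator_def)
  have N_meas[measurable]: "N \<in> borel_measurable M"
    unfolding N_eq by (rule lborel.borel_measurable_lebesgue_integral) measurable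
  have N_int: "set_integrable lborel {u..v} (\<lambda>y. of_bool (X y \<omega> \<noteq> X v \<omega>) :: real)"
    if "\<omega> \<in> space M" for \<omega>
    using rate_set_integrable[OF that u, of v "\<lambda>i. of_bool (i \<noteq> X v \<omega>)"] by simp
  have N_bounds: "0 \<le> N \<omega>" "N \<omega> \<le> h" if \<omega>: "\<omega> \<in> space M" for \<omega>
  proof -
    show "0 \<le> N \<omega>" unfolding N_eq by (rule Bochner_Integration.integral_nonneg) auto
    have "N \<omega> \<le> (LINT y:{u..v}|lborel. 1)"
      unfolding N_def
      by (rule set_integral_mono) (use N_int[OF \<omega>] rate_set_integrable[OF \<omega> u, of v "\<lambda>_. 1"] in auto)
    also have "\<dots> = h" using h by (simp add: set_lebesgue_integral_def v_def)
    finally show "N \<omega> \<le> h" .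
  qed
  have rate_dev: "\<bar>?I \<omega> - h * lam (X v \<omega>)\<bar> \<le> max_rate * N \<omega>" if \<omega>: "\<omega> \<in> space M" for \<omega>
  proof -
    have i1: "set_integrable lborel {u..v} (\<lambda>y. lam (X v \<omega>))"
      using rate_set_integrable[OF \<omega> u, of v "\<lambda>_. lam (X v \<omega>)"] by simp
    have i2: "set_integrable lborel {u..v} (\<lambda>y. lam (X y \<omega>))"
      by (rule rate_set_integrable[OF \<omega> u])
    have "h * lam (X v \<omega>) = (LINT y:{u..v}|lborel. lam (X v \<omega>))"
      using h by (simp add: set_lebesgue_integral_def v_def)
    then have "?I \<omega> - h * lam (X v \<omega>) = (LINT y:{u..v}|lborel. lam (X y \<omega>) - lam (X v \<omega>))"
      unfolding cumulative_rate_def using i1 i2 by (simp add: set_integral_diff)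
    also have "\<bar>\<dots>\<bar> \<le> (LINT y:{u..v}|lborel. \<bar>lam (X y \<omega>) - lam (X v \<omega>)\<bar>)"
      using set_integral_norm_bound[of lborel "{u..v}" "\<lambda>y. lam (X y \<omega>) - lam (X v \<omega>)"] i1 i2
      by (simp add: set_integral_diff)
    also have "\<dots> \<le> (LINT y:{u..v}|lborel. max_rate * of_bool (X y \<omega> \<noteq> X v \<omega>))"
    proof (rule set_integral_mono)
      show "set_integrable lborel {u..v} (\<lambda>y. \<bar>lam (X y \<omega>) - lam (X v \<omega>)\<bar>)"
        using rate_set_integrable[OF \<omega> u, of v "\<lambda>i. \<bar>lam i - lam (X v \<omega>)\<bar>"] .
      show "set_integrable lborel {u..v} (\<lambda>y. max_rate * of_bool (X y \<omega> \<noteq> X v \<omega>))"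
        using rate_set_integrable[OF \<omega> u, of v "\<lambda>i. max_rate * of_bool (i \<noteq> X v \<omega>)"] .
      show "\<bar>lam (X y \<omega>) - lam (X v \<omega>)\<bar> \<le> max_rate * of_bool (X y \<omega> \<noteq> X v \<omega>)" for y
        using lam_le_max_rate[of "X y \<omega>"] lam_le_max_rate[of "X v \<omega>"] lam_pos[of "X y \<omega>"] lam_pos[of "X v \<omega>"]
        by (cases "X y \<omega> = X v \<omega>") (auto simp: abs_le_iff)
    qed
    also have "\<dots> = max_rate * N \<omega>"
      unfolding N_def by simp
    finally show ?thesis .
  qed
  have int: "integrable M (\<lambda>\<omega>. \<Phi> \<omega> * f \<omega>)" if "f \<in> borel_measurable M" "\<And>\<omega>. \<omega> \<in> space M \<Longrightarrow> \<bar>f \<omega>\<bar> \<le> K" for f K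
  proof (rule integrable_const_bound[where B = K])
    show "AE \<omega> in M. norm (\<Phi> \<omega> * f \<omega>) \<le> K"
    proof (rule AE_I2)
      fix \<omega> assume \<omega>: "\<omega> \<in> space M"
      have "\<bar>\<Phi> \<omega>\<bar> * \<bar>f \<omega>\<bar> \<le> 1 * K"
        using bounds[OF \<omega>] that(2)[OF \<omega>] by (intro mult_mono) auto
      then show "norm (\<Phi> \<omega> * f \<omega>) \<le> K" by (simp add: abs_mult)
    qed
  qed (use that in measurable)
  have int1: "integrable M \<Phi>" using int[of "\<lambda>_. 1" 1] by simp
  have I_abs: "\<bar>?I \<omega>\<bar> \<le> max_rate * h" "0 \<le> ?I \<omega>" if "\<omega> \<in> space M" for \<omega>
    using cumulative_rate_bounds[OF that u v(2)] by (auto simp: v_def)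
  have intN: "integrable M (\<lambda>\<omega>. \<Phi> \<omega> * N \<omega>)"
    by (rule int[of N h]) (use N_bounds in auto)
  have moved: "(LINT \<omega>|M. \<Phi> \<omega> * of_bool (Xc y \<omega> \<noteq> X v \<omega>)) \<le> c * h * (LINT \<omega>|M. \<Phi> \<omega>)"
    if y: "u \<le> y" "y \<le> v" for y
  proof (cases "y = v")
    case True
    then show ?thesis
      using v c h bounds by (auto simp: Xc intro!: mult_nonneg_nonneg Bochner_Integration.integral_nonneg)
  next
    case False
    then have yv: "0 < v - y" "v - y \<le> h" using y by (auto simp: v_def)
    have [measurable]: "X y \<in> M \<rightarrow>\<^sub>M count_space UNIV" using u y by auto
    have \<Phi>y: "(\<lambda>\<omega>. \<Phi> \<omega> * indicator {\<omega>. X y \<omega> = i} \<omega>) \<in> borel_measurable (past_sigma M X y)" for i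
    proof -
      have [measurable]: "\<Phi> \<in> borel_measurable (past_sigma M X y)"
        "X y \<in> past_sigma M X y \<rightarrow>\<^sub>M count_space UNIV"
        using past_measurable_mono[OF \<Phi>] X_past_measurable y u by auto
      show ?thesis by measurable
    qed
    have int_end: "integrable M (\<lambda>\<omega>. \<Phi> \<omega> * indicator {\<omega>. X y \<omega> = i} \<omega> * indicator {\<omega>. X (y + (v - y)) \<omega> = i} \<omega>)" for i
      using int[of "\<lambda>\<omega>. indicator {\<omega>. X y \<omega> = i} \<omega> * indicator {\<omega>. X v \<omega> = i} \<omega>" 1]
      by (simp add: mult.assoc indicator_def)
    have int_stay: "integrable M (\<lambda>\<omega>. \<Phi> \<omega> * indicator {\<omega>. X y \<omega> = i} \<omega> * P (v - y) $ X y \<omega> $ i)" for i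
      using int[of "\<lambda>\<omega>. indicator {\<omega>. X y \<omega> = i} \<omega> * P (v - y) $ X y \<omega> $ i" 1] P_nonneg P_le_1 yv
      by (simp add: mult.assoc indicator_def)
    have "(LINT \<omega>|M. \<Phi> \<omega> * of_bool (Xc y \<omega> \<noteq> X v \<omega>))
        = (LINT \<omega>|M. \<Phi> \<omega> - (\<Sum>i\<in>UNIV. \<Phi> \<omega> * indicator {\<omega>. X y \<omega> = i} \<omega> * indicator {\<omega>. X (y + (v - y)) \<omega> = i} \<omega>))"
    proof (rule Bochner_Integration.integral_cong[OF refl])
      fix \<omega>
      have "(\<Sum>i\<in>UNIV. \<Phi> \<omega> * indicator {\<omega>. X y \<omega> = i} \<omega> * indicator {\<omega>. X (y + (v - y)) \<omega> = i} \<omega>)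
         = (\<Sum>i\<in>UNIV. if X y \<omega> = i then \<Phi> \<omega> * of_bool (X v \<omega> = i) else 0)"
        by (intro sum.cong) auto
      then show "\<Phi> \<omega> * of_bool (Xc y \<omega> \<noteq> X v \<omega>) = \<Phi> \<omega> -
          (\<Sum>i\<in>UNIV. \<Phi> \<omega> * indicator {\<omega>. X y \<omega> = i} \<omega> * indicator {\<omega>. X (y + (v - y)) \<omega> = i} \<omega>)"
        by (auto simp: Xc y)
    qed
    also have "\<dots> = (LINT \<omega>|M. \<Phi> \<omega>) -
        (\<Sum>i\<in>UNIV. LINT \<omega>|M. \<Phi> \<omega> * indicator {\<omega>. X y \<omega> = i} \<omega> * indicator {\<omega>. X (y + (v - y)) \<omega> = i} \<omega>)"
    proof -
      have total: "integrable M (\<lambda>\<omega>. \<Sum>i\<in>UNIV. \<Phi> \<omega> * indicator {\<omega>. X y \<omega> = i} \<omega> * indicator {\<omega>. X (y + (v - y)) \<omega> = i} \<omega>)"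
        by (rule Bochner_Integration.integrable_sum) (rule int_end)
      show ?thesis
        by (subst Bochner_Integration.integral_diff[OF int1 total], subst Bochner_Integration.integral_sum)
          (rule int_end, rule refl)
    qed
    also have "\<dots> = (LINT \<omega>|M. \<Phi> \<omega>) -
        (\<Sum>i\<in>UNIV. LINT \<omega>|M. \<Phi> \<omega> * indicator {\<omega>. X y \<omega> = i} \<omega> * P (v - y) $ X y \<omega> $ i)"
    proof -
      have "(LINT \<omega>|M. \<Phi> \<omega> * indicator {\<omega>. X y \<omega> = i} \<omega> * indicator {\<omega>. X (y + (v - y)) \<omega> = i} \<omega>)
        = (LINT \<omega>|M. \<Phi> \<omega> * indicator {\<omega>. X y \<omega> = i} \<omega> * P (v - y) $ X y \<omega> $ i)" for i
        by (rule markov_integral[where K = 1, OF _ yv(1) \<Phi>y]) (use u y bounds in \<open>auto simp: indicator_def\<close>)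
      then show ?thesis by (simp only:)
    qed
    also have "\<dots> = (LINT \<omega>|M. \<Phi> \<omega> - (\<Sum>i\<in>UNIV. \<Phi> \<omega> * indicator {\<omega>. X y \<omega> = i} \<omega> * P (v - y) $ X y \<omega> $ i))"
    proof -
      have total: "integrable M (\<lambda>\<omega>. \<Sum>i\<in>UNIV. \<Phi> \<omega> * indicator {\<omega>. X y \<omega> = i} \<omega> * P (v - y) $ X y \<omega> $ i)"
        by (rule Bochner_Integration.integrable_sum) (rule int_stay)
      show ?thesis
        by (subst Bochner_Integration.integral_diff[OF int1 total], subst Bochner_Integration.integral_sum)
          (rule int_stay, rule refl)
    qed
    also have "\<dots> \<le> (LINT \<omega>|M. c * h * \<Phi> \<omega>)"
    proof (rule integral_mono)
      show "integrable M (\<lambda>\<omega>. \<Phi> \<omega> - (\<Sum>i\<in>UNIV. \<Phi> \<omega> * indicator {\<omega>. X y \<omega> = i} \<omega> * P (v - y) $ X y \<omega> $ i))"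
        by (intro Bochner_Integration.integrable_diff int1 Bochner_Integration.integrable_sum int_stay)
      fix \<omega> assume \<omega>: "\<omega> \<in> space M"
      have "(\<Sum>i\<in>UNIV. \<Phi> \<omega> * indicator {\<omega>. X y \<omega> = i} \<omega> * P (v - y) $ X y \<omega> $ i)
          = (\<Sum>i\<in>UNIV. if X y \<omega> = i then \<Phi> \<omega> * P (v - y) $ i $ i else 0)"
        by (intro sum.cong) auto
      then have "\<Phi> \<omega> - (\<Sum>i\<in>UNIV. \<Phi> \<omega> * indicator {\<omega>. X y \<omega> = i} \<omega> * P (v - y) $ X y \<omega> $ i)
        = (1 - P (v - y) $ X y \<omega> $ X y \<omega>) * \<Phi> \<omega>"
        by (simp add: algebra_simps)
      also have "\<dots> \<le> (c * h) * \<Phi> \<omega>"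
      proof (rule mult_right_mono)
        have "1 - P (v - y) $ X y \<omega> $ X y \<omega> \<le> c * (v - y)"
          by (rule leave) (use yv in auto)
        also have "\<dots> \<le> c * h" using yv c by (intro mult_left_mono) auto
        finally show "1 - P (v - y) $ X y \<omega> $ X y \<omega> \<le> c * h" .
      qed (use bounds[OF \<omega>] in simp)
      finally show "\<Phi> \<omega> - (\<Sum>i\<in>UNIV. \<Phi> \<omega> * indicator {\<omega>. X y \<omega> = i} \<omega> * P (v - y) $ X y \<omega> $ i) \<le> c * h * \<Phi> \<omega>" .
    qed (use int1 in simp)
    finally show ?thesis by simp
  qed
  have N_mean: "(LINT \<omega>|M. \<Phi> \<omega> * N \<omega>) \<le> c * h\<^sup>2 * (LINT \<omega>|M. \<Phi> \<omega>)"
  proof -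
    interpret pair: pair_sigma_finite M lborel by unfold_locales
    let ?f = "\<lambda>\<omega> y. \<Phi> \<omega> * (indicator {u..v} y * of_bool (Xc y \<omega> \<noteq> X v \<omega>))"
    have f_int: "integrable (M \<Otimes>\<^sub>M lborel) (\<lambda>(\<omega>, y). ?f \<omega> y)"
    proof (rule integrableI_bounded_set[where A = "space M \<times> {u..v}" and B = 1])
      show "space M \<times> {u..v} \<in> sets (M \<Otimes>\<^sub>M lborel)" by auto
      show "(\<lambda>(\<omega>, y). ?f \<omega> y) \<in> borel_measurable (M \<Otimes>\<^sub>M lborel)" by measurable
      show "emeasure (M \<Otimes>\<^sub>M lborel) (space M \<times> {u..v}) < \<infinity>"
        using v by (subst lborel.emeasure_pair_measure_Times) (auto simp: emeasure_space_1)
      show "AE x in M \<Otimes>\<^sub>M lborel. x \<in> space M \<times> {u..v} \<longrightarrow> norm (case x of (\<omega>, y) \<Rightarrow> ?f \<omega> y) \<le> 1"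
        using bounds by (intro AE_I2) (auto simp: indicator_def abs_mult)
      show "AE x in M \<Otimes>\<^sub>M lborel. x \<notin> space M \<times> {u..v} \<longrightarrow> (case x of (\<omega>, y) \<Rightarrow> ?f \<omega> y) = 0"
        by (intro AE_I2) (auto simp: space_pair_measure indicator_def split: if_splits)
    qed
    have "(LINT \<omega>|M. \<Phi> \<omega> * N \<omega>) = (LINT \<omega>|M. LINT y|lborel. ?f \<omega> y)"
      unfolding N_eq by simp
    also have "\<dots> = (LINT y|lborel. LINT \<omega>|M. ?f \<omega> y)"
      using pair.Fubini_integral[OF f_int] by simp
    also have "\<dots> \<le> (LINT y|lborel. indicator {u..v} y * (c * h * (LINT \<omega>|M. \<Phi> \<omega>)))"
    proof (rule integral_mono)
      show "integrable lborel (\<lambda>y. LINT \<omega>|M. ?f \<omega> y)"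
        using pair.integrable_snd[OF f_int] by simp
      show "integrable lborel (\<lambda>y. indicator {u..v} y * (c * h * (LINT \<omega>|M. \<Phi> \<omega>)))"
        using v by (intro integrable_mult_left integrable_real_indicator) auto
      show "(LINT \<omega>|M. ?f \<omega> y) \<le> indicator {u..v} y * (c * h * (LINT \<omega>|M. \<Phi> \<omega>))" for y
        using moved[of y] by (cases "y \<in> {u..v}") auto
    qed
    also have "\<dots> = c * h\<^sup>2 * (LINT \<omega>|M. \<Phi> \<omega>)"
      using h v by (simp add: v_def power2_eq_square)
    finally show ?thesis .
  qed
  have pointwise: "\<bar>\<Phi> \<omega> * exp (- ?I \<omega>) * ?J \<omega> - (1 - h * lam j) * (\<Phi> \<omega> * ?J \<omega>)\<bar>
      \<le> (max_rate\<^sup>2 * h\<^sup>2) * \<Phi> \<omega> + max_rate * (\<Phi> \<omega> * N \<omega>)" if \<omega>: "\<omega> \<in> space M" for \<omega>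
  proof (cases "X v \<omega> = j")
    case True
    have "\<bar>exp (- ?I \<omega>) - (1 - h * lam j)\<bar> \<le> \<bar>exp (- ?I \<omega>) - (1 - ?I \<omega>)\<bar> + \<bar>?I \<omega> - h * lam j\<bar>"
      by simp
    also have "\<dots> \<le> (?I \<omega>)\<^sup>2 + max_rate * N \<omega>"
      using exp_minus_bounds[OF I_abs(2)[OF \<omega>]] rate_dev[OF \<omega>] True by simp
    also have "(?I \<omega>)\<^sup>2 \<le> max_rate\<^sup>2 * h\<^sup>2"
      using power_mono[OF I_abs(1)[OF \<omega>], of 2] by (simp add: power_mult_distrib)
    finally have "\<bar>exp (- ?I \<omega>) - (1 - h * lam j)\<bar> \<le> max_rate\<^sup>2 * h\<^sup>2 + max_rate * N \<omega>" by simp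
    from mult_left_mono[OF this, of "\<Phi> \<omega>"] bounds[OF \<omega>]
    have "\<bar>\<Phi> \<omega> * (exp (- ?I \<omega>) - (1 - h * lam j))\<bar> \<le> \<Phi> \<omega> * (max_rate\<^sup>2 * h\<^sup>2 + max_rate * N \<omega>)"
      by (simp add: abs_mult)
    then show ?thesis using True by (simp add: algebra_simps)
  next
    case False
    then show ?thesis using bounds[OF \<omega>] N_bounds[OF \<omega>] max_rate_pos by simp
  qed
  have ie: "integrable M (\<lambda>\<omega>. \<Phi> \<omega> * exp (- ?I \<omega>) * ?J \<omega>)"
    using int[of "\<lambda>\<omega>. exp (- ?I \<omega>) * ?J \<omega>" 1] I_abs(2) by (simp add: mult.assoc indicator_def)
  have iJ: "integrable M (\<lambda>\<omega>. \<Phi> \<omega> * ?J \<omega>)"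
    by (rule int[of _ 1]) auto
  have "\<bar>(LINT \<omega>|M. \<Phi> \<omega> * exp (- ?I \<omega>) * ?J \<omega>) - (1 - h * lam j) * (LINT \<omega>|M. \<Phi> \<omega> * ?J \<omega>)\<bar>
    = \<bar>LINT \<omega>|M. \<Phi> \<omega> * exp (- ?I \<omega>) * ?J \<omega> - (1 - h * lam j) * (\<Phi> \<omega> * ?J \<omega>)\<bar>"
    using ie iJ by simp
  also have "\<dots> \<le> (LINT \<omega>|M. (max_rate\<^sup>2 * h\<^sup>2) * \<Phi> \<omega> + max_rate * (\<Phi> \<omega> * N \<omega>))"
    by (rule order_trans[OF integral_abs_bound integral_mono])
      (use ie iJ int1 intN pointwise in auto)
  also have "\<dots> = max_rate\<^sup>2 * h\<^sup>2 * (LINT \<omega>|M. \<Phi> \<omega>) + max_rate * (LINT \<omega>|M. \<Phi> \<omega> * N \<omega>)"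
    using int1 intN by simp
  also have "\<dots> \<le> max_rate\<^sup>2 * h\<^sup>2 * (LINT \<omega>|M. \<Phi> \<omega>) + max_rate * (c * h\<^sup>2 * (LINT \<omega>|M. \<Phi> \<omega>))"
    using N_mean max_rate_pos by simp
  also have "\<dots> = (max_rate\<^sup>2 + max_rate * c) * h\<^sup>2 * (LINT \<omega>|M. \<Phi> \<omega>)"
    by (simp add: algebra_simps)
  finally show ?thesis by (simp add: v_def)
qed

section \<open>The embedded chain on a time grid\<close>

definition grid_count :: "real \<Rightarrow> nat \<Rightarrow> 'a \<Rightarrow> nat" where
  "grid_count h k \<omega> = num_arrivals T (h * real k) (h * real (Suc k)) \<omega>"

definition grid_state :: "real \<Rightarrow> nat \<Rightarrow> 'a \<Rightarrow> 'n" where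
  "grid_state h k \<omega> = X (h * real k) \<omega>"

text \<open>For \<open>l \<ge> 1\<close> this is the ceiling of \<open>T l \<omega> / h\<close>.\<close>
definition grid_epoch :: "real \<Rightarrow> nat \<Rightarrow> 'a \<Rightarrow> nat" where
  "grid_epoch h l \<omega> = (LEAST k. T l \<omega> \<le> h * real k)"

lemma grid_state_measurable: "0 < h \<Longrightarrow> grid_state h k \<in> M \<rightarrow>\<^sub>M count_space UNIV"
  unfolding grid_state_def by simp

lemma grid_count_measurable: "0 < h \<Longrightarrow> grid_count h k \<in> M \<rightarrow>\<^sub>M count_space UNIV"
  unfolding grid_count_def by (rule num_arrivals_measurable) (auto intro: mult_left_mono)

lemma grid_epoch_le_iff:
  assumes "0 < h"
  shows "grid_epoch h l \<omega> \<le> k \<longleftrightarrow> T l \<omega> \<le> h * real k"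
proof -
  obtain k0 where "T l \<omega> / h \<le> real k0"
    using real_arch_simple by blast
  then have le: "T l \<omega> \<le> h * real k0" using assms by (simp add: field_simps)
  have mono: "mono (\<lambda>k. h * real k)" using assms by (simp add: mono_def)
  show ?thesis
    unfolding grid_epoch_def by (rule Least_le_iff[where f = "\<lambda>k. h * real k", OF mono le])
qed

lemma arrivals_upto_grid:
  assumes "\<omega> \<in> space M" "0 < h"
  shows "arrivals_upto T (h * real k) \<omega> = (\<Sum>i<k. grid_count h i \<omega>)"
proof (induction k)
  case 0
  have empty: "{n. 2 \<le> n \<and> T n \<omega> \<le> 0} = {}"
  proof -
    have "\<not> T n \<omega> \<le> 0" if "2 \<le> n" for n
      using T_strict_mono[OF assms(1), of 1 n] T_first[OF assms(1)] that by simp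
    then show ?thesis by blast
  qed
  show ?case by (simp add: arrivals_upto_def empty)
next
  case (Suc k)
  have "arrivals_upto T (h * real (Suc k)) \<omega> = arrivals_upto T (h * real k) \<omega> + grid_count h k \<omega>"
    unfolding grid_count_def
    by (rule arrivals_upto_add[OF assms(1)]) (use assms(2) in \<open>auto intro: mult_left_mono\<close>)
  with Suc show ?case by simp
qed

text \<open>The rounded epochs are determined by the counts in the cells, and by time \<open>k\<close> through the counts of the
first \<open>k\<close> cells only: they are stopping times of the grid history.\<close>
lemma grid_epoch_le_iff_counts:
  assumes \<omega>: "\<omega> \<in> space M" and h: "0 < h"
  shows "grid_epoch h (Suc l) \<omega> \<le> k \<longleftrightarrow> l \<le> (\<Sum>i<k. grid_count h i \<omega>)"
  using T_le_iff_arrivals[OF \<omega>, of "h * real k" l] h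
  by (simp add: grid_epoch_le_iff[OF h] arrivals_upto_grid[OF \<omega> h])

lemma grid_epoch_measurable:
  assumes l: "1 \<le> l" and h: "0 < h"
  shows "grid_epoch h l \<in> M \<rightarrow>\<^sub>M count_space UNIV"
proof -
  have [measurable]: "T l \<in> borel_measurable M" by (rule T_measurable[OF l])
  have "{\<omega>\<in>space M. grid_epoch h l \<omega> = k} \<in> events" for k
  proof -
    have "grid_epoch h l \<omega> = k \<longleftrightarrow> T l \<omega> \<le> h * real k \<and> (\<forall>i<k. \<not> T l \<omega> \<le> h * real i)" for \<omega>
      using grid_epoch_le_iff[OF h, of l \<omega>] by (metis le_antisym linorder_not_less nle_le)
    then show ?thesis by simp
  qed
  then show ?thesis
    by (auto simp: measurable_count_space_eq2_countable vimage_def Int_def conj_commute)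
qed

subsection \<open>Histories\<close>

definition grid_history :: "real \<Rightarrow> nat \<Rightarrow> (nat \<Rightarrow> 'n) \<Rightarrow> (nat \<Rightarrow> nat) \<Rightarrow> 'a set" where
  "grid_history h k x m = {\<omega>\<in>space M. (\<forall>l\<le>k. grid_state h l \<omega> = x l) \<and> (\<forall>l<k. grid_count h l \<omega> = m l)}"

lemma grid_history_events: "0 < h \<Longrightarrow> grid_history h k x m \<in> events"
proof -
  assume h: "0 < h"
  note [measurable] = grid_state_measurable[OF h] grid_count_measurable[OF h]
  show ?thesis unfolding grid_history_def by measurable
qed

text \<open>Conditionally on the whole background path, the counts in the cells are independent Poisson variables, so the
conditional probability \<open>\<Phi>\<close> of a history is a product of Poisson weights. These involve the path up to the
last grid point only; one more empty cell multiplies \<open>\<Phi>\<close> by the exponential.\<close>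
lemma grid_history_conditional:
  assumes h: "0 < h"
  obtains \<Phi> where "\<Phi> \<in> borel_measurable (past_sigma M X (h * real k))"
    "\<And>\<omega>. \<omega> \<in> space M \<Longrightarrow> 0 \<le> \<Phi> \<omega> \<and> \<Phi> \<omega> \<le> 1"
    "\<And>\<omega>. \<Phi> \<omega> \<noteq> 0 \<Longrightarrow> grid_state h k \<omega> = x k"
    "\<And>D. D \<in> sets (background_sigma M X) \<Longrightarrow> prob (grid_history h k x m \<inter> D) = (LINT \<omega>|M. \<Phi> \<omega> * indicator D \<omega>)"
    "\<And>D. D \<in> sets (background_sigma M X) \<Longrightarrow> prob (grid_history h k x m \<inter> {\<omega>. grid_count h k \<omega> = 0} \<inter> D)
      = (LINT \<omega>|M. \<Phi> \<omega> * exp (- cumulative_rate lam X (h * real k) (h * real k + h) \<omega>) * indicator D \<omega>)"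
proof -
  let ?D = "{\<omega>\<in>space M. \<forall>l\<le>k. grid_state h l \<omega> = x l}"
  let ?c = "\<lambda>l. cumulative_rate lam X (h * real l) (h * real (Suc l))"
  define \<Phi> where "\<Phi> \<omega> = indicator ?D \<omega> * (\<Prod>l<k. poisson_weight (?c l \<omega>) (m l))" for \<omega>
  have step: "0 \<le> h * real l" "h * real l \<le> h * real (Suc l)" for l
    using h by auto
  have mono: "strict_mono (\<lambda>l::nat. h * real l)"
    using h by (auto simp: strict_mono_def)
  have D_past: "?D \<in> sets (past_sigma M X (h * real k))"
  proof -
    let ?F = "past_sigma M X (h * real k)"
    have "{\<omega>\<in>space ?F. grid_state h l \<omega> = x l} \<in> sets ?F" if "l \<in> {..k}" for l
    proof -
      have [measurable]: "grid_state h l \<in> ?F \<rightarrow>\<^sub>M count_space UNIV"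
        unfolding grid_state_def by (rule X_past_measurable) (use h that in auto)
      show ?thesis by measurable
    qed
    then have "{\<omega>\<in>space ?F. \<forall>l\<in>{..k}. grid_state h l \<omega> = x l} \<in> sets ?F"
      by (intro sets.sets_Collect_finite_All) auto
    then show ?thesis by (simp only: space_past Ball_def atMost_iff)
  qed
  show ?thesis
  proof (rule that[of \<Phi>])
    have [measurable]: "?c l \<in> borel_measurable (past_sigma M X (h * real k))" if "l < k" for l
      by (rule past_measurable_mono[OF cumulative_rate_past_measurable[OF step]])
        (use h that in \<open>auto intro!: mult_left_mono\<close>)
    have [measurable]: "(\<lambda>\<omega>. \<Prod>l<k. poisson_weight (?c l \<omega>) (m l)) \<in> borel_measurable (past_sigma M X (h * real k))"
      unfolding poisson_weight_def by (rule borel_measurable_prod) (simp del: of_nat_Suc)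
    show "\<Phi> \<in> borel_measurable (past_sigma M X (h * real k))"
      unfolding \<Phi>_def using D_past by measurable
    show "0 \<le> \<Phi> \<omega> \<and> \<Phi> \<omega> \<le> 1" if \<omega>: "\<omega> \<in> space M" for \<omega>
      using poisson_weight_bounds[OF cumulative_rate_bounds(1)[OF \<omega> step]]
      by (auto simp: \<Phi>_def indicator_def intro!: prod_nonneg prod_le_1)
    show "grid_state h k \<omega> = x k" if "\<Phi> \<omega> \<noteq> 0" for \<omega>
      using that by (auto simp: \<Phi>_def indicator_def split: if_splits)
    fix D assume D: "D \<in> sets (background_sigma M X)"
    have DD: "?D \<inter> D \<in> sets (background_sigma M X)"
      using D D_past past_background by blast
    have "grid_history h k x m \<inter> D = {\<omega>\<in>space M. \<forall>l<k. num_arrivals T (h * real l) (h * real (Suc l)) \<omega> = m l} \<inter> (?D \<inter> D)"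
      by (auto simp: grid_history_def grid_count_def)
    then show "prob (grid_history h k x m \<inter> D) = (LINT \<omega>|M. \<Phi> \<omega> * indicator D \<omega>)"
      using counts_law[OF _ mono DD, of k m]
      by (simp add: \<Phi>_def indicator_inter_arith mult_ac)
    \<comment> \<open>the same history prolonged by one empty cell\<close>
    define m' where "m' = m(k := 0)"
    have "grid_history h k x m \<inter> {\<omega>. grid_count h k \<omega> = 0} \<inter> D
        = {\<omega>\<in>space M. \<forall>l<Suc k. num_arrivals T (h * real l) (h * real (Suc l)) \<omega> = m' l} \<inter> (?D \<inter> D)"
      by (auto simp: grid_history_def grid_count_def m'_def less_Suc_eq)
    moreover have "(\<Prod>l<Suc k. poisson_weight (?c l \<omega>) (m' l))
        = (\<Prod>l<k. poisson_weight (?c l \<omega>) (m l)) * exp (- ?c k \<omega>)" for \<omega>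
      by (simp add: m'_def poisson_weight_def)
    ultimately show "prob (grid_history h k x m \<inter> {\<omega>. grid_count h k \<omega> = 0} \<inter> D)
      = (LINT \<omega>|M. \<Phi> \<omega> * exp (- cumulative_rate lam X (h * real k) (h * real k + h) \<omega>) * indicator D \<omega>)"
      using counts_law[OF _ mono DD, of "Suc k" m']
      by (simp add: \<Phi>_def indicator_inter_arith mult_ac distrib_left add.commute)
  qed
qed

lemma grid_history_step:
  assumes h: "0 < h"
    and leave: "\<And>t i. 0 \<le> t \<Longrightarrow> t \<le> h \<Longrightarrow> 1 - P t $ i $ i \<le> c * t" and c: "0 \<le> c"
  shows "prob (grid_history h k x m \<inter> {\<omega>. grid_state h (Suc k) \<omega> = j}) = prob (grid_history h k x m) * P h $ x k $ j"
    and "\<bar>prob (grid_history h k x m \<inter> {\<omega>. grid_count h k \<omega> = 0} \<inter> {\<omega>. grid_state h (Suc k) \<omega> = j})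
        - (1 - h * lam j) * prob (grid_history h k x m \<inter> {\<omega>. grid_state h (Suc k) \<omega> = j})\<bar>
      \<le> (max_rate\<^sup>2 + max_rate * c) * h\<^sup>2 * prob (grid_history h k x m)"
proof -
  let ?u = "h * real k" and ?H = "grid_history h k x m"
  obtain \<Phi> where \<Phi>: "\<Phi> \<in> borel_measurable (past_sigma M X ?u)"
    "\<And>\<omega>. \<omega> \<in> space M \<Longrightarrow> 0 \<le> \<Phi> \<omega> \<and> \<Phi> \<omega> \<le> 1"
    "\<And>\<omega>. \<Phi> \<omega> \<noteq> 0 \<Longrightarrow> grid_state h k \<omega> = x k"
    "\<And>D. D \<in> sets (background_sigma M X) \<Longrightarrow> prob (?H \<inter> D) = (LINT \<omega>|M. \<Phi> \<omega> * indicator D \<omega>)"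
    "\<And>D. D \<in> sets (background_sigma M X) \<Longrightarrow> prob (?H \<inter> {\<omega>. grid_count h k \<omega> = 0} \<inter> D)
      = (LINT \<omega>|M. \<Phi> \<omega> * exp (- cumulative_rate lam X ?u (?u + h) \<omega>) * indicator D \<omega>)"
    by (rule grid_history_conditional[OF h, of k x m]) (rule that)
  have u: "0 \<le> ?u" using h by simp
  let ?D = "{\<omega>\<in>space M. grid_state h (Suc k) \<omega> = j}"
  have state: "grid_state h (Suc k) \<omega> = X (?u + h) \<omega>" for \<omega>
    by (simp add: grid_state_def algebra_simps)
  have D: "?D \<in> sets (background_sigma M X)"
  proof -
    have "?D = X (?u + h) -` {j} \<inter> space M" by (auto simp: state)
    moreover have "0 \<le> ?u + h" using u h by simp
    ultimately show ?thesis unfolding sets_background by (intro sigma_sets.Basic) blast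
  qed
  have Int: "A \<inter> {\<omega>. grid_state h (Suc k) \<omega> = j} = A \<inter> ?D" if "A \<subseteq> space M" for A
    using that by auto
  have sub: "?H \<subseteq> space M" "?H \<inter> {\<omega>. grid_count h k \<omega> = 0} \<subseteq> space M"
    by (auto simp: grid_history_def)
  have total: "prob ?H = (LINT \<omega>|M. \<Phi> \<omega>)"
  proof -
    have "space M \<in> sets (background_sigma M X)"
      using sets.top[of "background_sigma M X"] by simp
    from \<Phi>(4)[OF this] have "prob ?H = (LINT \<omega>|M. \<Phi> \<omega> * indicator (space M) \<omega>)"
      using sub by (simp add: Int_absorb2)
    also have "\<dots> = (LINT \<omega>|M. \<Phi> \<omega>)"
      by (rule Bochner_Integration.integral_cong) auto
    finally show ?thesis .
  qed
  have ind: "(LINT \<omega>|M. g \<omega> * indicator ?D \<omega>) = (LINT \<omega>|M. g \<omega> * indicator {\<omega>. X (?u + h) \<omega> = j} \<omega>)" for g :: "'a \<Rightarrow> real"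
    by (rule Bochner_Integration.integral_cong) (auto simp: state indicator_def)
  have moved: "prob (?H \<inter> {\<omega>. grid_state h (Suc k) \<omega> = j}) = (LINT \<omega>|M. \<Phi> \<omega> * indicator {\<omega>. X (?u + h) \<omega> = j} \<omega>)"
    unfolding Int[OF sub(1)] \<Phi>(4)[OF D] by (rule ind)
  also have "\<dots> = (LINT \<omega>|M. \<Phi> \<omega> * P h $ X ?u \<omega> $ j)"
    by (rule markov_integral[where K = 1, OF u h \<Phi>(1)]) (use \<Phi>(2) in auto)
  also have "\<dots> = (LINT \<omega>|M. \<Phi> \<omega> * P h $ x k $ j)"
  proof (rule Bochner_Integration.integral_cong[OF refl])
    show "\<Phi> \<omega> * P h $ X ?u \<omega> $ j = \<Phi> \<omega> * P h $ x k $ j" for \<omega>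
      using \<Phi>(3)[of \<omega>] by (cases "\<Phi> \<omega> = 0") (auto simp: grid_state_def)
  qed
  finally show "prob (?H \<inter> {\<omega>. grid_state h (Suc k) \<omega> = j}) = prob ?H * P h $ x k $ j"
    by (simp add: total)
  show "\<bar>prob (?H \<inter> {\<omega>. grid_count h k \<omega> = 0} \<inter> {\<omega>. grid_state h (Suc k) \<omega> = j})
        - (1 - h * lam j) * prob (?H \<inter> {\<omega>. grid_state h (Suc k) \<omega> = j})\<bar>
      \<le> (max_rate\<^sup>2 + max_rate * c) * h\<^sup>2 * prob ?H"
    unfolding moved total Int[OF sub(2)] \<Phi>(5)[OF D] ind
    by (rule no_arrival_step[OF u h leave c \<Phi>(1,2)])
qed

text \<open>Demanding at most one arrival in each cell leaves finitely many histories of a given length, so that estimates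
for a single history can be summed up. As the mesh tends to \<open>0\<close> this excludes no path.\<close>
definition history_event :: "real \<Rightarrow> nat \<Rightarrow> 'a set \<Rightarrow> bool" where
  "history_event h k E \<longleftrightarrow> E \<subseteq> space M \<and> (\<forall>\<omega>\<in>E. \<forall>l<k. grid_count h l \<omega> \<le> 1) \<and>
     (\<forall>\<omega>\<in>E. \<forall>\<omega>'\<in>space M. (\<forall>l\<le>k. grid_state h l \<omega>' = grid_state h l \<omega>) \<longrightarrow>
        (\<forall>l<k. grid_count h l \<omega>' = grid_count h l \<omega>) \<longrightarrow> \<omega>' \<in> E)"

lemma history_event_decompose:
  assumes h: "0 < h" and E: "history_event h k E"
  obtains A where "finite A"
    "\<And>F. F \<in> events \<Longrightarrow> prob (E \<inter> F) = (\<Sum>(x, m)\<in>A. prob (grid_history h k x m \<inter> F))" "E \<in> events"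
proof -
  define \<phi> where "\<phi> \<omega> = (restrict (\<lambda>l. grid_state h l \<omega>) {..k}, restrict (\<lambda>l. grid_count h l \<omega>) {..<k})" for \<omega>
  define A where "A = \<phi> ` E"
  have E_sub: "E \<subseteq> space M" using E by (simp add: history_event_def)
  have "A \<subseteq> PiE {..k} (\<lambda>_. UNIV) \<times> PiE {..<k} (\<lambda>_. {0, 1})"
  proof
    fix a assume "a \<in> A"
    then obtain \<omega> where \<omega>: "\<omega> \<in> E" "a = \<phi> \<omega>" by (auto simp: A_def)
    have "grid_count h l \<omega> \<in> {0, 1}" if "l < k" for l
    proof -
      have "grid_count h l \<omega> \<le> 1" using E \<omega>(1) that by (simp add: history_event_def)
      then show ?thesis by (cases "grid_count h l \<omega>") auto
    qed
    then show "a \<in> PiE {..k} (\<lambda>_. UNIV) \<times> PiE {..<k} (\<lambda>_. {0, 1})"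
      unfolding \<omega>(2) \<phi>_def by (simp add: restrict_PiE_iff)
  qed
  moreover have "finite (PiE {..k} (\<lambda>_. UNIV :: 'n set) \<times> PiE {..<k} (\<lambda>_. {0, 1::nat}))"
    by (intro finite_cartesian_product finite_PiE) auto
  ultimately have fin: "finite A" by (rule finite_subset)
  have atom: "grid_history h k x m = {\<omega>\<in>space M. \<phi> \<omega> = (x, m)}" if xmA: "(x, m) \<in> A" for x m
  proof -
    obtain \<omega>0 where "(x, m) = \<phi> \<omega>0"
      using xmA unfolding A_def by (rule imageE)
    then have xm: "x = restrict (\<lambda>l. grid_state h l \<omega>0) {..k}" "m = restrict (\<lambda>l. grid_count h l \<omega>0) {..<k}"
      by (simp_all add: \<phi>_def)
    show ?thesis
      unfolding grid_history_def \<phi>_def xm by (auto simp: fun_eq_iff restrict_def)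
  qed
  have E_eq: "E = {\<omega>\<in>space M. \<phi> \<omega> \<in> A}"
  proof
    show "E \<subseteq> {\<omega>\<in>space M. \<phi> \<omega> \<in> A}" using E_sub by (auto simp: A_def)
    show "{\<omega>\<in>space M. \<phi> \<omega> \<in> A} \<subseteq> E"
    proof clarify
      fix \<omega>' assume \<omega>': "\<omega>' \<in> space M" "\<phi> \<omega>' \<in> A"
      then obtain \<omega> where \<omega>: "\<omega> \<in> E" "\<phi> \<omega>' = \<phi> \<omega>" by (auto simp: A_def)
      have "grid_state h l \<omega>' = grid_state h l \<omega>" if "l \<le> k" for l
        using arg_cong[OF \<omega>(2), of "\<lambda>a. fst a l"] that by (simp add: \<phi>_def)
      moreover have "grid_count h l \<omega>' = grid_count h l \<omega>" if "l < k" for l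
        using arg_cong[OF \<omega>(2), of "\<lambda>a. snd a l"] that by (simp add: \<phi>_def)
      ultimately show "\<omega>' \<in> E" using E \<omega>(1) \<omega>'(1) unfolding history_event_def by blast
    qed
  qed
  have atom_events: "{\<omega>\<in>space M. \<phi> \<omega> = a} \<in> events" if "a \<in> A" for a
    using atom[of "fst a" "snd a"] grid_history_events[OF h, of k "fst a" "snd a"] that by simp
  have E_union: "E = (\<Union>a\<in>A. {\<omega>\<in>space M. \<phi> \<omega> = a})"
    using E_eq by auto
  show ?thesis
  proof (rule that[OF fin])
    show "E \<in> events" unfolding E_union using fin atom_events by (intro sets.finite_UN) auto
    fix F assume F: "F \<in> events"
    have "E \<inter> F = (\<Union>a\<in>A. {\<omega>\<in>space M. \<phi> \<omega> = a} \<inter> F)"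
      using E_eq by auto
    moreover have "prob (\<Union>a\<in>A. {\<omega>\<in>space M. \<phi> \<omega> = a} \<inter> F) = (\<Sum>a\<in>A. prob ({\<omega>\<in>space M. \<phi> \<omega> = a} \<inter> F))"
      using fin atom_events F by (intro finite_measure_finite_Union) (auto simp: disjoint_family_on_def)
    moreover have "(\<Sum>a\<in>A. prob ({\<omega>\<in>space M. \<phi> \<omega> = a} \<inter> F)) = (\<Sum>(x, m)\<in>A. prob (grid_history h k x m \<inter> F))"
      by (intro sum.cong) (auto simp: atom)
    ultimately show "prob (E \<inter> F) = (\<Sum>(x, m)\<in>A. prob (grid_history h k x m \<inter> F))" by simp
  qed
qed

lemma history_event_step:
  assumes h: "0 < h" and E: "history_event h k E"
    and leave: "\<And>t i. 0 \<le> t \<Longrightarrow> t \<le> h \<Longrightarrow> 1 - P t $ i $ i \<le> c * t" and c: "0 \<le> c"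
  shows "prob (E \<inter> {\<omega>. grid_state h (Suc k) \<omega> = j}) = (\<Sum>i\<in>UNIV. prob (E \<inter> {\<omega>. grid_state h k \<omega> = i}) * P h $ i $ j)"
    and "\<bar>prob (E \<inter> {\<omega>. grid_count h k \<omega> = 0} \<inter> {\<omega>. grid_state h (Suc k) \<omega> = j})
        - (1 - h * lam j) * prob (E \<inter> {\<omega>. grid_state h (Suc k) \<omega> = j})\<bar>
      \<le> (max_rate\<^sup>2 + max_rate * c) * h\<^sup>2 * prob E"
    and "E \<in> events"
proof -
  note [measurable] = grid_state_measurable[OF h] grid_count_measurable[OF h]
  obtain A where A: "finite A"
    "\<And>F. F \<in> events \<Longrightarrow> prob (E \<inter> F) = (\<Sum>(x, m)\<in>A. prob (grid_history h k x m \<inter> F))" and ev: "E \<in> events"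
    by (rule history_event_decompose[OF h E]) (rule that)
  show "E \<in> events" by (rule ev)
  let ?g = "grid_history h k"
  have E_sub: "E \<subseteq> space M" and g_sub: "?g x m \<subseteq> space M" for x m
    using E by (auto simp: history_event_def grid_history_def)
  have split: "prob (E \<inter> {\<omega>. R \<omega>}) = (\<Sum>(x, m)\<in>A. prob (?g x m \<inter> {\<omega>. R \<omega>}))"
    if "{\<omega>\<in>space M. R \<omega>} \<in> events" for R
  proof -
    have "E \<inter> {\<omega>. R \<omega>} = E \<inter> {\<omega>\<in>space M. R \<omega>}" "?g x m \<inter> {\<omega>. R \<omega>} = ?g x m \<inter> {\<omega>\<in>space M. R \<omega>}" for x m
      using E_sub g_sub by auto
    then show ?thesis using A(2)[OF that] by simp
  qed
  have split_j: "prob (E \<inter> {\<omega>. grid_state h l \<omega> = j}) = (\<Sum>(x, m)\<in>A. prob (?g x m \<inter> {\<omega>. grid_state h l \<omega> = j}))" for l j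
    by (rule split) measurable
  have split_0j: "prob (E \<inter> {\<omega>. grid_count h k \<omega> = 0} \<inter> {\<omega>. grid_state h (Suc k) \<omega> = j})
      = (\<Sum>(x, m)\<in>A. prob (?g x m \<inter> {\<omega>. grid_count h k \<omega> = 0} \<inter> {\<omega>. grid_state h (Suc k) \<omega> = j}))"
  proof -
    have "prob (E \<inter> {\<omega>. grid_count h k \<omega> = 0 \<and> grid_state h (Suc k) \<omega> = j})
      = (\<Sum>(x, m)\<in>A. prob (?g x m \<inter> {\<omega>. grid_count h k \<omega> = 0 \<and> grid_state h (Suc k) \<omega> = j}))"
      by (rule split) measurable
    moreover have "{\<omega>. grid_count h k \<omega> = 0 \<and> grid_state h (Suc k) \<omega> = j} = {\<omega>. grid_count h k \<omega> = 0} \<inter> {\<omega>. grid_state h (Suc k) \<omega> = j}"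
      by auto
    ultimately show ?thesis by (simp add: Int_assoc)
  qed
  have split_all: "prob E = (\<Sum>(x, m)\<in>A. prob (?g x m))"
    using split[of "\<lambda>_. True"] by simp
  have now: "(\<Sum>i\<in>UNIV. prob (?g x m \<inter> {\<omega>. grid_state h k \<omega> = i}) * P h $ i $ j) = prob (?g x m) * P h $ x k $ j" for x m
  proof -
    have "?g x m \<inter> {\<omega>. grid_state h k \<omega> = i} = (if i = x k then ?g x m else {})" for i
      by (auto simp: grid_history_def)
    then have "(\<Sum>i\<in>UNIV. prob (?g x m \<inter> {\<omega>. grid_state h k \<omega> = i}) * P h $ i $ j)
       = (\<Sum>i\<in>UNIV. if i = x k then prob (?g x m) * P h $ i $ j else 0)"
      by (intro sum.cong) auto
    then show ?thesis by simp
  qed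
  have "(\<Sum>i\<in>UNIV. prob (E \<inter> {\<omega>. grid_state h k \<omega> = i}) * P h $ i $ j)
      = (\<Sum>a\<in>A. \<Sum>i\<in>UNIV. prob (?g (fst a) (snd a) \<inter> {\<omega>. grid_state h k \<omega> = i}) * P h $ i $ j)"
    by (subst sum.swap) (simp add: split_j sum_distrib_right case_prod_unfold)
  then show "prob (E \<inter> {\<omega>. grid_state h (Suc k) \<omega> = j}) = (\<Sum>i\<in>UNIV. prob (E \<inter> {\<omega>. grid_state h k \<omega> = i}) * P h $ i $ j)"
    by (simp add: split_j case_prod_unfold now grid_history_step(1)[OF h leave c])
  let ?d = "\<lambda>x m. prob (?g x m \<inter> {\<omega>. grid_count h k \<omega> = 0} \<inter> {\<omega>. grid_state h (Suc k) \<omega> = j})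
        - (1 - h * lam j) * prob (?g x m \<inter> {\<omega>. grid_state h (Suc k) \<omega> = j})"
  have "prob (E \<inter> {\<omega>. grid_count h k \<omega> = 0} \<inter> {\<omega>. grid_state h (Suc k) \<omega> = j})
        - (1 - h * lam j) * prob (E \<inter> {\<omega>. grid_state h (Suc k) \<omega> = j}) = (\<Sum>(x, m)\<in>A. ?d x m)"
    by (simp add: split_j split_0j case_prod_unfold sum_subtractf sum_distrib_left)
  moreover have "\<bar>\<Sum>(x, m)\<in>A. ?d x m\<bar> \<le> (\<Sum>(x, m)\<in>A. (max_rate\<^sup>2 + max_rate * c) * h\<^sup>2 * prob (?g x m))"
    unfolding case_prod_unfold
    by (rule order_trans[OF sum_abs sum_mono]) (rule grid_history_step(2)[OF h leave c])
  moreover have "(\<Sum>(x, m)\<in>A. (max_rate\<^sup>2 + max_rate * c) * h\<^sup>2 * prob (?g x m)) = (max_rate\<^sup>2 + max_rate * c) * h\<^sup>2 * prob E"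
    unfolding split_all by (simp add: case_prod_unfold sum_distrib_left)
  ultimately show "\<bar>prob (E \<inter> {\<omega>. grid_count h k \<omega> = 0} \<inter> {\<omega>. grid_state h (Suc k) \<omega> = j})
        - (1 - h * lam j) * prob (E \<inter> {\<omega>. grid_state h (Suc k) \<omega> = j})\<bar>
      \<le> (max_rate\<^sup>2 + max_rate * c) * h\<^sup>2 * prob E" by simp
qed

subsection \<open>The wait for the next arrival\<close>

lemma grid_epoch_mono:
  assumes "\<omega> \<in> space M" "0 < h" "1 \<le> l" "l \<le> n"
  shows "grid_epoch h l \<omega> \<le> grid_epoch h n \<omega>"
  using T_mono[OF assms(1,3,4)] grid_epoch_le_iff[OF assms(2), of n \<omega> "grid_epoch h n \<omega>"]
  by (simp add: grid_epoch_le_iff[OF assms(2)])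

text \<open>The first part is the grid version of the event that the first \<open>n\<close> arrivals occur before the times
\<open>t l\<close> and find the states \<open>y l\<close>. The second part leaves only finitely many histories that match.\<close>
definition grid_match :: "real \<Rightarrow> nat \<Rightarrow> (nat \<Rightarrow> real) \<Rightarrow> (nat \<Rightarrow> 'n) \<Rightarrow> 'a \<Rightarrow> bool" where
  "grid_match h n t y \<omega> \<longleftrightarrow>
     (\<forall>l\<in>{1..n}. h * real (grid_epoch h l \<omega>) < t l \<and> grid_state h (grid_epoch h l \<omega>) \<omega> = y l) \<and>
     (\<forall>i<grid_epoch h n \<omega>. grid_count h i \<omega> \<le> 1)"

definition waiting_event :: "real \<Rightarrow> nat \<Rightarrow> (nat \<Rightarrow> real) \<Rightarrow> (nat \<Rightarrow> 'n) \<Rightarrow> nat \<Rightarrow> nat \<Rightarrow> 'a set" where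
  "waiting_event h n t y k p =
     {\<omega>\<in>space M. grid_epoch h n \<omega> = k \<and> grid_match h n t y \<omega> \<and> k + p < grid_epoch h (Suc n) \<omega>}"

lemma waiting_event_counts:
  assumes h: "0 < h" and n: "1 \<le> n" and \<omega>: "\<omega> \<in> waiting_event h n t y k p"
  shows "(\<Sum>i<k + p. grid_count h i \<omega>) = n - 1" and "k \<le> i \<Longrightarrow> i < k + p \<Longrightarrow> grid_count h i \<omega> = 0"
proof -
  have sp: "\<omega> \<in> space M" using \<omega> by (simp add: waiting_event_def)
  obtain n0 where n0: "n = Suc n0" using n by (cases n) auto
  have 1: "n0 \<le> (\<Sum>i<k. grid_count h i \<omega>)"
    using \<omega> grid_epoch_le_iff_counts[OF sp h, of n0 k] by (simp add: waiting_event_def n0)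
  have 2: "\<not> Suc n0 \<le> (\<Sum>i<k + p. grid_count h i \<omega>)"
    using \<omega> grid_epoch_le_iff_counts[OF sp h, of "Suc n0" "k + p"] by (auto simp: waiting_event_def n0)
  have 3: "(\<Sum>i<k. grid_count h i \<omega>) \<le> (\<Sum>i<k + p. grid_count h i \<omega>)"
    by (rule sum_mono2) auto
  show "(\<Sum>i<k + p. grid_count h i \<omega>) = n - 1"
    using 1 2 3 n0 by linarith
  assume i: "k \<le> i" "i < k + p"
  have "(\<Sum>q\<in>insert i {..<k}. grid_count h q \<omega>) \<le> (\<Sum>q<k + p. grid_count h q \<omega>)"
    using i by (intro sum_mono2) auto
  then show "grid_count h i \<omega> = 0"
    using i 1 2 by simp
qed

text \<open>The event asks nothing about the next arrival except that it is later than the grid point \<open>k + p\<close>, and the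
first \<open>n\<close> rounded epochs are at most \<open>k\<close>; all of this is visible in the first \<open>k + p\<close> cells. The
cells from \<open>k\<close> to \<open>k + p - 1\<close> are empty, so the event also meets the bound on the counts.\<close>
lemma waiting_event_history:
  assumes h: "0 < h" and n: "1 \<le> n"
  shows "history_event h (k + p) (waiting_event h n t y k p)"
  unfolding history_event_def
proof (intro conjI ballI allI impI)
  show "waiting_event h n t y k p \<subseteq> space M" by (auto simp: waiting_event_def)
next
  fix \<omega> i assume \<omega>: "\<omega> \<in> waiting_event h n t y k p" and i: "i < k + p"
  show "grid_count h i \<omega> \<le> 1"
    using waiting_event_counts(2)[OF h n \<omega>, of i] i \<omega>
    by (cases "i < k") (auto simp: waiting_event_def grid_match_def)
next
  fix \<omega> \<omega>' assume \<omega>: "\<omega> \<in> waiting_event h n t y k p" and \<omega>': "\<omega>' \<in> space M"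
    and state: "\<forall>l\<le>k + p. grid_state h l \<omega>' = grid_state h l \<omega>"
    and count: "\<forall>l<k + p. grid_count h l \<omega>' = grid_count h l \<omega>"
  have sp: "\<omega> \<in> space M" and k: "grid_epoch h n \<omega> = k" and m: "grid_match h n t y \<omega>"
    and wait: "k + p < grid_epoch h (Suc n) \<omega>"
    using \<omega> by (auto simp: waiting_event_def)
  have le_iff: "grid_epoch h l \<omega>' \<le> i \<longleftrightarrow> grid_epoch h l \<omega> \<le> i" if li: "1 \<le> l" "i \<le> k + p" for l i
  proof -
    obtain l0 where l0: "l = Suc l0" using li(1) by (cases l) auto
    have "(\<Sum>q<i. grid_count h q \<omega>') = (\<Sum>q<i. grid_count h q \<omega>)"
      using count li(2) by (intro sum.cong) auto
    then show ?thesis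
      using grid_epoch_le_iff_counts[OF sp h, of l0 i] grid_epoch_le_iff_counts[OF \<omega>' h, of l0 i] by (simp add: l0)
  qed
  have epoch: "grid_epoch h l \<omega>' = grid_epoch h l \<omega> \<and> grid_epoch h l \<omega> \<le> k" if l: "l \<in> {1..n}" for l
  proof -
    have le: "grid_epoch h l \<omega> \<le> k" using grid_epoch_mono[OF sp h, of l n] l k by simp
    then have "grid_epoch h l \<omega>' \<le> grid_epoch h l \<omega>"
      using le_iff[of l "grid_epoch h l \<omega>"] l by simp
    moreover from this have "grid_epoch h l \<omega> \<le> grid_epoch h l \<omega>'"
      using le_iff[of l "grid_epoch h l \<omega>'"] l le by simp
    ultimately show ?thesis using le by simp
  qed
  have kn: "grid_epoch h n \<omega>' = k" using epoch[of n] n k by simp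
  have "grid_match h n t y \<omega>'"
    unfolding grid_match_def kn
  proof (intro conjI ballI allI impI)
    fix l assume l: "l \<in> {1..n}"
    show "h * real (grid_epoch h l \<omega>') < t l" "grid_state h (grid_epoch h l \<omega>') \<omega>' = y l"
      using m epoch[OF l] l state by (auto simp: grid_match_def)
  next
    fix i assume "i < k"
    then show "grid_count h i \<omega>' \<le> 1" using m k count by (simp add: grid_match_def)
  qed
  moreover have "k + p < grid_epoch h (Suc n) \<omega>'"
    using le_iff[of "Suc n" "k + p"] wait by simp
  ultimately show "\<omega>' \<in> waiting_event h n t y k p"
    using kn \<omega>' by (simp add: waiting_event_def)
qed

lemma waiting_event_Suc:
  assumes h: "0 < h" and n: "1 \<le> n"
  shows "waiting_event h n t y k (Suc p) = waiting_event h n t y k p \<inter> {\<omega>. grid_count h (k + p) \<omega> = 0}"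
proof -
  have "\<omega> \<in> waiting_event h n t y k (Suc p) \<longleftrightarrow> grid_count h (k + p) \<omega> = 0"
    if \<omega>: "\<omega> \<in> waiting_event h n t y k p" for \<omega>
  proof -
    have sp: "\<omega> \<in> space M" using \<omega> by (simp add: waiting_event_def)
    have "k + Suc p < grid_epoch h (Suc n) \<omega> \<longleftrightarrow> \<not> n \<le> (\<Sum>i<k + Suc p. grid_count h i \<omega>)"
      using grid_epoch_le_iff_counts[OF sp h, of n "k + Suc p"] by auto
    also have "(\<Sum>i<k + Suc p. grid_count h i \<omega>) = (n - 1) + grid_count h (k + p) \<omega>"
      using waiting_event_counts(1)[OF h n \<omega>] by simp
    also have "\<not> n \<le> (n - 1) + grid_count h (k + p) \<omega> \<longleftrightarrow> grid_count h (k + p) \<omega> = 0"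
      using n by auto
    finally show ?thesis using \<omega> by (auto simp: waiting_event_def)
  qed
  moreover have "waiting_event h n t y k (Suc p) \<subseteq> waiting_event h n t y k p"
    by (auto simp: waiting_event_def)
  ultimately show ?thesis by blast
qed

text \<open>No arrival in the \<open>p\<close> cells after the \<open>n\<close>th rounded epoch, and state \<open>i\<close> another \<open>d\<close> cells
after their end. The probabilities for \<open>d = 0\<close> and \<open>d = 1\<close> play the roles of \<open>v p\<close> and
\<open>b p\<close> in the discrete resolvent equation.\<close>
definition waiting_in :: "real \<Rightarrow> nat \<Rightarrow> (nat \<Rightarrow> real) \<Rightarrow> (nat \<Rightarrow> 'n) \<Rightarrow> nat \<Rightarrow> nat \<Rightarrow> 'n \<Rightarrow> 'a set" where
  "waiting_in h n t y p d i = {\<omega>\<in>space M. grid_match h n t y \<omega> \<and>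
     grid_epoch h n \<omega> + p < grid_epoch h (Suc n) \<omega> \<and> grid_state h (grid_epoch h n \<omega> + p + d) \<omega> = i}"

text \<open>Since \<open>t n\<close> bounds the \<open>n\<close>th epoch, only finitely many grid points \<open>k\<close> can be its rounded value.\<close>
lemma waiting_in_decompose:
  fixes t :: "nat \<Rightarrow> real"
  assumes h: "0 < h" and n: "1 \<le> n"
  defines "K \<equiv> {k. h * real k < t n}"
  shows "waiting_in h n t y p d i \<in> events"
    and "prob (waiting_in h n t y p d i) = (\<Sum>k\<in>K. prob (waiting_event h n t y k p \<inter> {\<omega>. grid_state h (k + p + d) \<omega> = i}))"
    and "(\<Sum>i\<in>UNIV. prob (waiting_in h n t y p 0 i)) = (\<Sum>k\<in>K. prob (waiting_event h n t y k p))"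
    and "finite K"
proof -
  have "K \<subseteq> {..nat \<lceil>t n / h\<rceil>}"
  proof
    fix k assume "k \<in> K"
    then have "real k < t n / h" using h by (simp add: K_def field_simps)
    then show "k \<in> {..nat \<lceil>t n / h\<rceil>}" by simp linarith
  qed
  then show fin: "finite K" by (rule finite_subset) simp
  have ev: "waiting_event h n t y k p \<in> events" for k
    by (rule history_event_decompose[OF h waiting_event_history[OF h n]])
  have ev_state: "waiting_event h n t y k p \<inter> {\<omega>. grid_state h m \<omega> = i} \<in> events" for k m i
  proof -
    have [measurable]: "grid_state h m \<in> M \<rightarrow>\<^sub>M count_space UNIV" by (rule grid_state_measurable[OF h])
    have "waiting_event h n t y k p \<inter> {\<omega>. grid_state h m \<omega> = i} = waiting_event h n t y k p \<inter> {\<omega>\<in>space M. grid_state h m \<omega> = i}"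
      by (auto simp: waiting_event_def)
    also have "\<dots> \<in> events" using ev[of k] by measurable
    finally show ?thesis .
  qed
  have union: "waiting_in h n t y p d i = (\<Union>k\<in>K. waiting_event h n t y k p \<inter> {\<omega>. grid_state h (k + p + d) \<omega> = i})" for d i
    using n by (auto simp: waiting_in_def waiting_event_def K_def grid_match_def)
  show "waiting_in h n t y p d i \<in> events"
    unfolding union using fin ev_state by (intro sets.finite_UN) auto
  show split: "prob (waiting_in h n t y p d i) = (\<Sum>k\<in>K. prob (waiting_event h n t y k p \<inter> {\<omega>. grid_state h (k + p + d) \<omega> = i}))" for d i
    unfolding union using fin ev_state
    by (intro finite_measure_finite_Union) (auto simp: disjoint_family_on_def waiting_event_def)
  have "prob (waiting_event h n t y k p) = (\<Sum>i\<in>UNIV. prob (waiting_event h n t y k p \<inter> {\<omega>. grid_state h (k + p + 0) \<omega> = i}))" for k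
  proof -
    have "waiting_event h n t y k p = (\<Union>i\<in>UNIV. waiting_event h n t y k p \<inter> {\<omega>. grid_state h (k + p + 0) \<omega> = i})"
      by auto
    also have "prob \<dots> = (\<Sum>i\<in>UNIV. prob (waiting_event h n t y k p \<inter> {\<omega>. grid_state h (k + p + 0) \<omega> = i}))"
      using ev_state by (intro finite_measure_finite_Union) (auto simp: disjoint_family_on_def)
    finally show ?thesis .
  qed
  then show "(\<Sum>i\<in>UNIV. prob (waiting_in h n t y p 0 i)) = (\<Sum>k\<in>K. prob (waiting_event h n t y k p))"
    unfolding split by (subst sum.swap) (simp only:)
qed

lemma waiting_in_step:
  assumes h: "0 < h" and n: "1 \<le> n"
    and leave: "\<And>t i. 0 \<le> t \<Longrightarrow> t \<le> h \<Longrightarrow> 1 - P t $ i $ i \<le> c * t" and c: "0 \<le> c"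
  shows "prob (waiting_in h n t y p 1 j) = (\<Sum>i\<in>UNIV. prob (waiting_in h n t y p 0 i) * P h $ i $ j)"
    and "\<bar>prob (waiting_in h n t y (Suc p) 0 j) - (1 - h * lam j) * prob (waiting_in h n t y p 1 j)\<bar>
      \<le> (max_rate\<^sup>2 + max_rate * c) * h\<^sup>2 * (\<Sum>i\<in>UNIV. prob (waiting_in h n t y p 0 i))"
proof -
  define K where "K = {k. h * real k < t n}"
  note decompose = waiting_in_decompose(2)[OF h n, of t y, folded K_def]
  note step = history_event_step[OF h waiting_event_history[OF h n, of _ p t y] leave c]
  have "prob (waiting_in h n t y p 1 j) = (\<Sum>k\<in>K. prob (waiting_event h n t y k p \<inter> {\<omega>. grid_state h (Suc (k + p)) \<omega> = j}))"
    unfolding decompose by simp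
  also have "\<dots> = (\<Sum>k\<in>K. \<Sum>i\<in>UNIV. prob (waiting_event h n t y k p \<inter> {\<omega>. grid_state h (k + p) \<omega> = i}) * P h $ i $ j)"
    by (intro sum.cong refl step(1)) auto
  also have "\<dots> = (\<Sum>i\<in>UNIV. prob (waiting_in h n t y p 0 i) * P h $ i $ j)"
    unfolding decompose by (subst sum.swap) (simp add: sum_distrib_right)
  finally show "prob (waiting_in h n t y p 1 j) = (\<Sum>i\<in>UNIV. prob (waiting_in h n t y p 0 i) * P h $ i $ j)" .
  let ?d = "\<lambda>k. prob (waiting_event h n t y k p \<inter> {\<omega>. grid_count h (k + p) \<omega> = 0} \<inter> {\<omega>. grid_state h (Suc (k + p)) \<omega> = j})
      - (1 - h * lam j) * prob (waiting_event h n t y k p \<inter> {\<omega>. grid_state h (Suc (k + p)) \<omega> = j})"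
  have "prob (waiting_in h n t y (Suc p) 0 j) - (1 - h * lam j) * prob (waiting_in h n t y p 1 j) = (\<Sum>k\<in>K. ?d k)"
    unfolding decompose by (simp add: waiting_event_Suc[OF h n] sum_subtractf sum_distrib_left)
  moreover have "\<bar>\<Sum>k\<in>K. ?d k\<bar> \<le> (\<Sum>k\<in>K. (max_rate\<^sup>2 + max_rate * c) * h\<^sup>2 * prob (waiting_event h n t y k p))"
    by (rule order_trans[OF sum_abs sum_mono]) (rule step(2), auto)
  moreover have "(\<Sum>k\<in>K. (max_rate\<^sup>2 + max_rate * c) * h\<^sup>2 * prob (waiting_event h n t y k p))
      = (max_rate\<^sup>2 + max_rate * c) * h\<^sup>2 * (\<Sum>i\<in>UNIV. prob (waiting_in h n t y p 0 i))"
    unfolding waiting_in_decompose(3)[OF h n, of t y p, folded K_def] by (simp add: sum_distrib_left)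
  ultimately show "\<bar>prob (waiting_in h n t y (Suc p) 0 j) - (1 - h * lam j) * prob (waiting_in h n t y p 1 j)\<bar>
      \<le> (max_rate\<^sup>2 + max_rate * c) * h\<^sup>2 * (\<Sum>i\<in>UNIV. prob (waiting_in h n t y p 0 i))" by simp
qed

definition grid_renewal :: "real \<Rightarrow> nat \<Rightarrow> (nat \<Rightarrow> real) \<Rightarrow> (nat \<Rightarrow> 'n) \<Rightarrow> complex \<Rightarrow> 'n \<Rightarrow> 'a \<Rightarrow> complex" where
  "grid_renewal h n t y z j \<omega> =
     indicator {\<omega>\<in>space M. grid_match h n t y \<omega> \<and> grid_epoch h n \<omega> < grid_epoch h (Suc n) \<omega> \<and>
         grid_state h (grid_epoch h (Suc n) \<omega>) \<omega> = j} \<omega> *\<^sub>R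
       exp (- z * of_real h) ^ (grid_epoch h (Suc n) \<omega> - grid_epoch h n \<omega>)"

text \<open>The next arrival falls into the cell number \<open>p\<close> after the \<open>n\<close>th rounded epoch exactly if the first \<open>p\<close> cells
are empty and the next one is not, which is the difference of two waiting events.\<close>
lemma grid_renewal_integral:
  assumes h: "0 < h" and n: "1 \<le> n" and z: "0 \<le> Re z"
  shows "(LINT \<omega>|M. grid_renewal h n t y z j \<omega>)
     = (\<Sum>p. exp (- z * of_real h) ^ Suc p *
          of_real (prob (waiting_in h n t y p 1 j) - prob (waiting_in h n t y (Suc p) 0 j)))"
    and "grid_renewal h n t y z j \<in> borel_measurable M"
    and "cmod (grid_renewal h n t y z j \<omega>) \<le> 1"
proof -
  define e where "e = exp (- z * of_real h)"
  have e: "cmod e \<le> 1" using z h by (simp add: e_def)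
  define A where "A p = waiting_in h n t y p 1 j - waiting_in h n t y (Suc p) 0 j" for p
  have A_eq: "A p = {\<omega>\<in>space M. grid_match h n t y \<omega> \<and> grid_epoch h (Suc n) \<omega> = grid_epoch h n \<omega> + Suc p \<and>
         grid_state h (grid_epoch h (Suc n) \<omega>) \<omega> = j}" for p
  proof (rule set_eqI)
    fix \<omega>
    show "\<omega> \<in> A p \<longleftrightarrow> \<omega> \<in> {\<omega>\<in>space M. grid_match h n t y \<omega> \<and> grid_epoch h (Suc n) \<omega> = grid_epoch h n \<omega> + Suc p \<and>
         grid_state h (grid_epoch h (Suc n) \<omega>) \<omega> = j}"
    proof (cases "grid_epoch h (Suc n) \<omega> = grid_epoch h n \<omega> + Suc p")
      case True
      then show ?thesis by (auto simp: A_def waiting_in_def)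
    next
      case False
      then have "grid_epoch h n \<omega> + p < grid_epoch h (Suc n) \<omega> \<longleftrightarrow> grid_epoch h n \<omega> + Suc p < grid_epoch h (Suc n) \<omega>"
        by linarith
      then show ?thesis using False by (auto simp: A_def waiting_in_def)
    qed
  qed
  have A_events: "A p \<in> events" for p
    unfolding A_def using waiting_in_decompose(1)[OF h n] by blast
  have A_disj: "disjoint_family A"
    by (auto simp: disjoint_family_on_def A_eq)
  have A_union: "{\<omega>\<in>space M. grid_match h n t y \<omega> \<and> grid_epoch h n \<omega> < grid_epoch h (Suc n) \<omega> \<and>
         grid_state h (grid_epoch h (Suc n) \<omega>) \<omega> = j} = (\<Union>p. A p)"
    by (auto simp: A_eq less_iff_Suc_add)
  have [measurable]: "grid_epoch h n \<in> M \<rightarrow>\<^sub>M count_space UNIV" "grid_epoch h (Suc n) \<in> M \<rightarrow>\<^sub>M count_space UNIV"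
    using grid_epoch_measurable[OF _ h] n by auto
  let ?f = "\<lambda>\<omega>. e ^ (grid_epoch h (Suc n) \<omega> - grid_epoch h n \<omega>)"
  have f_meas[measurable]: "?f \<in> borel_measurable M"
    by measurable
  have f_le: "cmod (?f \<omega>) \<le> 1" for \<omega>
    using e by (simp add: norm_power power_le_one)
  have eq: "grid_renewal h n t y z j \<omega> = indicator (\<Union>p. A p) \<omega> *\<^sub>R ?f \<omega>" for \<omega>
    by (simp add: grid_renewal_def A_union e_def)
  have U: "(\<Union>p. A p) \<in> events" using A_events by auto
  have "(\<lambda>\<omega>. indicator (\<Union>p. A p) \<omega> *\<^sub>R ?f \<omega>) \<in> borel_measurable M" using U by measurable
  then show meas: "grid_renewal h n t y z j \<in> borel_measurable M"
    unfolding eq[abs_def] .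
  show le1: "cmod (grid_renewal h n t y z j \<omega>) \<le> 1" for \<omega>
    unfolding eq using f_le[of \<omega>] by (simp add: indicator_def)
  have int: "set_integrable M (\<Union>p. A p) ?f"
    unfolding set_integrable_def eq[symmetric]
    by (rule integrable_const_bound[where B = 1, OF _ meas]) (use le1 in auto)
  have "(LINT \<omega>|M. grid_renewal h n t y z j \<omega>) = (LINT \<omega>:(\<Union>p. A p)|M. ?f \<omega>)"
    by (simp add: set_lebesgue_integral_def eq)
  also have "\<dots> = (\<Sum>p. LINT \<omega>:A p|M. ?f \<omega>)"
    by (rule lebesgue_integral_countable_add[OF A_events _ int])
      (use A_disj in \<open>auto simp: disjoint_family_on_def\<close>)
  also have "\<dots> = (\<Sum>p. e ^ Suc p * of_real (prob (A p)))"
  proof (rule suminf_cong)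
    fix p
    have "(LINT \<omega>:A p|M. ?f \<omega>) = (LINT \<omega>|M. indicator (A p) \<omega> *\<^sub>R e ^ Suc p)"
      unfolding set_lebesgue_integral_def
      by (rule Bochner_Integration.integral_cong) (auto simp: A_eq indicator_def)
    also have "\<dots> = prob (A p) *\<^sub>R e ^ Suc p"
      using A_events[of p] by (subst integral_scaleR_left) (simp_all add: integrable_real_indicator emeasure_eq_measure)
    finally show "(LINT \<omega>:A p|M. ?f \<omega>) = e ^ Suc p * of_real (prob (A p))"
      by (simp add: scaleR_conv_of_real)
  qed
  also have "\<dots> = (\<Sum>p. e ^ Suc p * of_real (prob (waiting_in h n t y p 1 j) - prob (waiting_in h n t y (Suc p) 0 j)))"
  proof (rule suminf_cong)
    fix p
    have "waiting_in h n t y (Suc p) 0 j \<subseteq> waiting_in h n t y p 1 j"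
      by (auto simp: waiting_in_def)
    then have "prob (A p) = prob (waiting_in h n t y p 1 j) - prob (waiting_in h n t y (Suc p) 0 j)"
      unfolding A_def by (intro finite_measure_Diff waiting_in_decompose(1)[OF h n])
    then show "e ^ Suc p * of_real (prob (A p))
        = e ^ Suc p * of_real (prob (waiting_in h n t y p 1 j) - prob (waiting_in h n t y (Suc p) 0 j))"
      by simp
  qed
  finally show "(LINT \<omega>|M. grid_renewal h n t y z j \<omega>)
     = (\<Sum>p. exp (- z * of_real h) ^ Suc p *
          of_real (prob (waiting_in h n t y p 1 j) - prob (waiting_in h n t y (Suc p) 0 j)))"
    by (simp add: e_def)
qed

subsection \<open>Refining the grid\<close>

lemma grid_epoch_bounds:
  assumes "\<omega> \<in> space M" "0 < h" "1 \<le> l"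
  shows "T l \<omega> \<le> h * real (grid_epoch h l \<omega>)" "h * real (grid_epoch h l \<omega>) < T l \<omega> + h"
proof -
  show "T l \<omega> \<le> h * real (grid_epoch h l \<omega>)"
    using grid_epoch_le_iff[OF assms(2), of l \<omega> "grid_epoch h l \<omega>"] by simp
  show "h * real (grid_epoch h l \<omega>) < T l \<omega> + h"
  proof (cases "grid_epoch h l \<omega>")
    case 0
    then show ?thesis using T_nonneg[OF assms(1,3)] assms(2) by simp
  next
    case (Suc k)
    then have "\<not> T l \<omega> \<le> h * real k"
      using grid_epoch_le_iff[OF assms(2), of l \<omega> k] by simp
    then show ?thesis using Suc by (simp add: algebra_simps)
  qed
qed

context
  fixes h :: "nat \<Rightarrow> real"
  assumes h_pos: "\<And>m. 0 < h m" and h_lim: "h \<longlonglongrightarrow> 0"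
begin

lemma grid_epoch_tendsto:
  assumes "\<omega> \<in> space M" "1 \<le> l"
  shows "(\<lambda>m. h m * real (grid_epoch (h m) l \<omega>)) \<longlonglongrightarrow> T l \<omega>"
proof (rule tendsto_sandwich[of "\<lambda>_. T l \<omega>" _ _ "\<lambda>m. T l \<omega> + h m"])
  show "(\<lambda>m. T l \<omega> + h m) \<longlonglongrightarrow> T l \<omega>"
    using tendsto_add[OF tendsto_const h_lim] by simp
  show "eventually (\<lambda>m. T l \<omega> \<le> h m * real (grid_epoch (h m) l \<omega>)) sequentially"
    using grid_epoch_bounds(1)[OF assms(1) h_pos assms(2)] by simp
  show "eventually (\<lambda>m. h m * real (grid_epoch (h m) l \<omega>) \<le> T l \<omega> + h m) sequentially"
    using grid_epoch_bounds(2)[OF assms(1) h_pos assms(2)] by (simp add: less_imp_le)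
qed simp

lemma grid_state_eventually:
  assumes \<omega>: "\<omega> \<in> space M" and l: "1 \<le> l"
  shows "eventually (\<lambda>m. grid_state (h m) (grid_epoch (h m) l \<omega>) \<omega> = embedded X T l \<omega>) sequentially"
proof -
  obtain b where b: "b > T l \<omega>" "\<And>v. v > T l \<omega> \<Longrightarrow> v < b \<Longrightarrow> X v \<omega> = X (T l \<omega>) \<omega>"
    using X_right_constant[OF \<omega> T_nonneg[OF \<omega> l]] unfolding eventually_at_right_field by auto
  have "eventually (\<lambda>m. h m * real (grid_epoch (h m) l \<omega>) < b) sequentially"
    by (rule order_tendstoD(2)[OF grid_epoch_tendsto[OF \<omega> l] b(1)])
  then show ?thesis
  proof eventually_elim
    case (elim m)
    then show ?case
      using grid_epoch_bounds(1)[OF \<omega> h_pos[of m] l] b(2)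
      by (cases "h m * real (grid_epoch (h m) l \<omega>) = T l \<omega>") (auto simp: grid_state_def embedded_def)
  qed
qed

lemma grid_epoch_less_eventually:
  assumes \<omega>: "\<omega> \<in> space M" and l: "1 \<le> l"
  shows "eventually (\<lambda>m. h m * real (grid_epoch (h m) l \<omega>) < c \<longleftrightarrow> T l \<omega> < c) sequentially"
proof (cases "T l \<omega> < c")
  case True
  then show ?thesis
    using order_tendstoD(2)[OF grid_epoch_tendsto[OF \<omega> l] True] by simp
next
  case False
  then show ?thesis
    using grid_epoch_bounds(1)[OF \<omega> h_pos l] by (auto intro!: always_eventually simp: not_less intro: order_trans)
qed

text \<open>As soon as the mesh is smaller than all gaps between the first \<open>n + 1\<close> arrivals, these arrivals lie in
different cells.\<close>
lemma grid_separates_eventually: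
  assumes \<omega>: "\<omega> \<in> space M" and n: "1 \<le> n"
  shows "eventually (\<lambda>m. (\<forall>i<grid_epoch (h m) n \<omega>. grid_count (h m) i \<omega> \<le> 1) \<and>
     grid_epoch (h m) n \<omega> < grid_epoch (h m) (Suc n) \<omega>) sequentially"
proof -
  \<comment> \<open>the smallest gap between consecutive arrivals up to the one with number n + 1\<close>
  define g where "g = Min ((\<lambda>l. T (Suc l) \<omega> - T l \<omega>) ` {1..n})"
  have g_le: "g \<le> T (Suc l) \<omega> - T l \<omega>" if "l \<in> {1..n}" for l
    unfolding g_def using that by (intro Min_le) auto
  have "g \<in> (\<lambda>l. T (Suc l) \<omega> - T l \<omega>) ` {1..n}"
    unfolding g_def using n by (intro Min_in) auto
  then have "0 < g" using T_increasing[OF \<omega>] by auto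
  from order_tendstoD(2)[OF h_lim this] show ?thesis
  proof eventually_elim
    case (elim m)
    let ?h = "h m"
    note h = h_pos[of m]
    have near: "?h * real (grid_epoch ?h n \<omega>) < T n \<omega> + ?h"
      by (rule grid_epoch_bounds(2)[OF \<omega> h n])
    have next_gap: "T n \<omega> + g \<le> T (Suc n) \<omega>" using g_le[of n] n by simp
    have "?h * real (grid_epoch ?h n \<omega>) < ?h * real (grid_epoch ?h (Suc n) \<omega>)"
      using near next_gap elim grid_epoch_bounds(1)[OF \<omega> h, of "Suc n"] by simp
    then have less: "grid_epoch ?h n \<omega> < grid_epoch ?h (Suc n) \<omega>" using h by simp
    have single: False if i: "i < grid_epoch ?h n \<omega>" and ab: "a < b" "2 \<le> a"
      and Ta: "?h * real i < T a \<omega>" "T a \<omega> \<le> ?h * real (Suc i)" and Tb: "T b \<omega> \<le> ?h * real (Suc i)" for i a b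
    proof (cases "a \<le> n")
      case True
      then have "T a \<omega> + g \<le> T b \<omega>"
        using g_le[of a] T_mono[OF \<omega>, of "Suc a" b] ab by simp
      then show False using Ta(1) Tb elim by (simp add: algebra_simps)
    next
      case False
      then have "T (Suc n) \<omega> \<le> T a \<omega>" using T_mono[OF \<omega>, of "Suc n" a] by simp
      moreover have "?h * real (Suc i) \<le> ?h * real (grid_epoch ?h n \<omega>)"
        using i h by (intro mult_left_mono) auto
      ultimately show False using Ta(2) near next_gap elim by linarith
    qed
    have "grid_count ?h i \<omega> \<le> 1" if i: "i < grid_epoch ?h n \<omega>" for i
    proof -
      let ?S = "{q. 2 \<le> q \<and> T q \<omega> \<in> {?h * real i<..?h * real (Suc i)}}"
      have "finite ?S"
        by (rule finite_subset[OF _ T_locally_finite[OF \<omega>, of "?h * real (Suc i)"]]) auto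
      moreover have "a = b" if "a \<in> ?S" "b \<in> ?S" for a b
        using single[OF i, of a b] single[OF i, of b a] that by (cases a b rule: linorder_cases) auto
      ultimately have "card ?S \<le> Suc 0" by (subst card_le_Suc0_iff_eq) auto
      then show ?thesis by (simp add: grid_count_def num_arrivals_def)
    qed
    with less show ?case by simp
  qed
qed

end

section \<open>The Markov renewal property\<close>

definition renewal_kernel :: "complex \<Rightarrow> complex^'n^'n" where
  "renewal_kernel z = matrix_inv (M_matrix Q lam z) ** rate_matrix lam"

definition arrival_cylinder :: "nat \<Rightarrow> (nat \<Rightarrow> real) \<Rightarrow> (nat \<Rightarrow> 'n) \<Rightarrow> 'a set" where
  "arrival_cylinder n t y = {\<omega>\<in>space M. \<forall>l\<in>{1..n}. T l \<omega> < t l \<and> embedded X T l \<omega> = y l}"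

lemma P_difference_quotient:
  assumes h: "\<And>m. 0 < h m" "h \<longlonglongrightarrow> 0"
  shows "(\<lambda>m. (P (h m) $ i $ j - of_bool (i = j)) / h m) \<longlonglongrightarrow> Q $ i $ j"
proof -
  have P0: "P 0 $ i $ j = of_bool (i = j)"
    using semigroup by (simp add: transition_semigroup_def mat_def)
  have "((\<lambda>t. (P t $ i $ j - P 0 $ i $ j) / (t - 0)) \<longlongrightarrow> Q $ i $ j) (at 0 within {0..})"
    using generator[unfolded has_generator_def has_field_derivative_iff, rule_format, of i j] .
  moreover have "filterlim h (at 0 within {0..}) sequentially"
    unfolding filterlim_at using h by (auto intro!: always_eventually simp: less_imp_le less_imp_neq[symmetric])
  ultimately have "(\<lambda>m. (P (h m) $ i $ j - P 0 $ i $ j) / (h m - 0)) \<longlonglongrightarrow> Q $ i $ j"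
    by (rule filterlim_compose)
  then show ?thesis by (simp add: P0)
qed

lemma generator_signs: "i \<noteq> j \<Longrightarrow> 0 \<le> Q $ i $ j"
  and generator_row_sum: "(\<Sum>j\<in>UNIV. Q $ i $ j) = 0"
proof -
  define h where "h m = 1 / real (Suc m)" for m
  have h: "\<And>m. 0 < h m" "h \<longlonglongrightarrow> 0"
    using LIMSEQ_Suc[OF lim_1_over_n[where 'a = real]] by (auto simp: h_def[abs_def])
  show "0 \<le> Q $ i $ j" if "i \<noteq> j"
    by (rule LIMSEQ_le_const[OF P_difference_quotient[OF h]])
      (use that in \<open>auto intro!: divide_nonneg_nonneg P_nonneg less_imp_le[OF h(1)]\<close>)
  have "(\<lambda>m. \<Sum>j\<in>UNIV. (P (h m) $ i $ j - of_bool (i = j)) / h m) \<longlonglongrightarrow> (\<Sum>j\<in>UNIV. Q $ i $ j)"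
    by (intro tendsto_sum P_difference_quotient h)
  moreover have "(\<Sum>j\<in>UNIV. (P (h m) $ i $ j - of_bool (i = j)) / h m) = 0" for m
    using P_row_sum[of "h m" i] h(1)[of m]
    by (simp add: sum_divide_distrib[symmetric] sum_subtractf less_imp_le of_bool_def)
  ultimately show "(\<Sum>j\<in>UNIV. Q $ i $ j) = 0"
    using LIMSEQ_unique[OF _ tendsto_const] by fastforce
qed

lemma M_invertible: "0 \<le> Re z \<Longrightarrow> invertible (M_matrix Q lam z)"
  by (rule M_matrix_invertible[OF generator_signs generator_row_sum lam_pos])

lemma arrival_cylinder_background_arrival:
  "arrival_cylinder n t y \<in> sets (background_arrival_sigma M X T)"
proof -
  let ?F = "background_arrival_sigma M X T"
  have "{\<omega>\<in>space ?F. \<forall>l\<in>{1..n}. T l \<omega> < t l \<and> embedded X T l \<omega> = y l} \<in> sets ?F"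
  proof (rule sets.sets_Collect_finite_All)
    fix l assume l: "l \<in> {1..n}"
    have [measurable]: "T l \<in> borel_measurable ?F" "embedded X T l \<in> ?F \<rightarrow>\<^sub>M count_space UNIV"
      using T_background_arrival_measurable embedded_background_arrival_measurable l by auto
    show "{\<omega>\<in>space ?F. T l \<omega> < t l \<and> embedded X T l \<omega> = y l} \<in> sets ?F" by measurable
  qed simp
  then show ?thesis by (simp only: arrival_cylinder_def space_background_arrival)
qed

lemma arrival_cylinder_events: "arrival_cylinder n t y \<in> events"
  using arrival_cylinder_background_arrival background_arrival_events by blast

definition renewal_factor :: "complex \<Rightarrow> nat \<Rightarrow> 'n \<Rightarrow> 'a \<Rightarrow> complex" where
  "renewal_factor z n j \<omega> = exp (- z * of_real (interarrival T (Suc n) \<omega>)) * indicator {\<omega>. embedded X T (Suc n) \<omega> = j} \<omega>"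

lemma renewal_factor_background_arrival:
  assumes n: "1 \<le> n"
  shows "renewal_factor z n j \<in> borel_measurable (background_arrival_sigma M X T)"
proof -
  let ?F = "background_arrival_sigma M X T"
  have [measurable]: "T n \<in> borel_measurable ?F" "T (Suc n) \<in> borel_measurable ?F"
    "embedded X T (Suc n) \<in> ?F \<rightarrow>\<^sub>M count_space UNIV"
    using T_background_arrival_measurable embedded_background_arrival_measurable n by auto
  show ?thesis
    unfolding renewal_factor_def[abs_def] interarrival_def by simp
qed

lemma renewal_factor_le_1:
  assumes "\<omega> \<in> space M" "1 \<le> n" "0 \<le> Re z"
  shows "cmod (renewal_factor z n j \<omega>) \<le> 1"
  using T_increasing[OF assms(1,2)] assms(3)
  by (simp add: renewal_factor_def norm_mult interarrival_def indicator_def mult_nonneg_nonneg)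

lemma renewal_factor_measurable: "1 \<le> n \<Longrightarrow> renewal_factor z n j \<in> borel_measurable M"
  by (rule background_arrival_measurable_M[OF renewal_factor_background_arrival])

text \<open>Both sides of the identity for the grid of mesh \<open>h m\<close> converge: the expectation by dominated convergence, as for each
path the rounded quantities converge or are eventually constant, and the series by the resolvent limit.\<close>
lemma renewal_cylinder:
  assumes n: "1 \<le> n" and z: "0 \<le> Re z"
  shows "(LINT \<omega>|M. indicator (arrival_cylinder n t y) \<omega> *\<^sub>R renewal_factor z n j \<omega>)
     = of_real (prob (arrival_cylinder n t y)) * renewal_kernel z $ y n $ j"
proof -
  obtain c h0 where c: "0 \<le> c" and h0: "0 < h0"
    and leave: "\<And>t i. 0 \<le> t \<Longrightarrow> t \<le> h0 \<Longrightarrow> 1 - P t $ i $ i \<le> c * t"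
    by (rule leaving_prob_bound) (rule that)
  define C where "C = max_rate\<^sup>2 + max_rate * c"
  have C: "0 \<le> C" using c max_rate_pos by (simp add: C_def)
  define l where "l = Min (range lam)"
  have l: "0 < l" "l \<le> lam i" for i
    using lam_pos by (auto simp: l_def)
  define D where "D = real CARD('n) * C + 1"
  \<comment> \<open>the mesh starts so small that all hypotheses of the discrete resolvent equation hold along the whole sequence\<close>
  define d where "d = min h0 (min (1 / max_rate) (l / (2 * D)))"
  have CC: "0 < D" using C by (simp add: D_def add_nonneg_pos)
  have d: "0 < d" using h0 max_rate_pos l(1) CC by (simp add: d_def)
  define h where "h m = d / real (Suc m)" for m
  have h_pos: "0 < h m" for m using d by (simp add: h_def)
  have h_le: "h m \<le> d" for m using d by (simp add: h_def field_simps)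
  have h_lim: "h \<longlonglongrightarrow> 0"
    using tendsto_mult[OF tendsto_const[of d] LIMSEQ_Suc[OF lim_1_over_n]] by (simp add: h_def[abs_def])
  have leave_h: "1 - P t $ i $ i \<le> c * t" if "0 \<le> t" "t \<le> h m" for t i m
    using leave[OF that(1)] that(2) h_le[of m] by (simp add: d_def)
  have rate_h: "h m * lam i \<le> 1" for m i
  proof -
    have "h m * lam i \<le> (1 / max_rate) * max_rate"
      using h_le[of m] lam_le_max_rate[of i] lam_pos[of i] h_pos[of m] max_rate_pos
      by (intro mult_mono) (auto simp: d_def less_imp_le)
    then show ?thesis using max_rate_pos by simp
  qed
  have small: "real CARD('n) * C * h m \<le> l / 2" for m
  proof -
    have "real CARD('n) * C * h m \<le> D * (l / (2 * D))"
      using h_le[of m] C h_pos[of m] by (intro mult_mono) (auto simp: d_def D_def less_imp_le)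
    also have "\<dots> = l / 2" using CC by simp
    finally show ?thesis .
  qed
  let ?C = "arrival_cylinder n t y"
  have match: "eventually (\<lambda>m. grid_match (h m) n t y \<omega> \<longleftrightarrow> \<omega> \<in> ?C) sequentially" if \<omega>: "\<omega> \<in> space M" for \<omega>
  proof -
    have "eventually (\<lambda>m. \<forall>l\<in>{1..n}. h m * real (grid_epoch (h m) l \<omega>) < t l \<longleftrightarrow> T l \<omega> < t l) sequentially"
      by (rule eventually_ball_finite) (auto intro: grid_epoch_less_eventually[OF h_pos h_lim \<omega>])
    moreover have "eventually (\<lambda>m. \<forall>l\<in>{1..n}. grid_state (h m) (grid_epoch (h m) l \<omega>) \<omega> = embedded X T l \<omega>) sequentially"
      by (rule eventually_ball_finite) (auto intro: grid_state_eventually[OF h_pos h_lim \<omega>])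
    ultimately show ?thesis
      using grid_separates_eventually[OF h_pos h_lim \<omega> n]
      by eventually_elim (use \<omega> in \<open>auto simp: grid_match_def arrival_cylinder_def\<close>)
  qed
  have v0: "(\<lambda>m. prob (waiting_in (h m) n t y 0 0 i)) \<longlonglongrightarrow> (if i = y n then prob ?C else 0)" for i
  proof -
    have ev: "waiting_in (h m) n t y 0 0 i \<in> events" for m
      by (rule waiting_in_decompose(1)[OF h_pos n])
    have "(\<lambda>m. LINT \<omega>|M. (indicator (waiting_in (h m) n t y 0 0 i) \<omega> :: real)) \<longlonglongrightarrow> (LINT \<omega>|M. (if i = y n then indicator ?C \<omega> else 0))"
    proof (rule integral_dominated_convergence[where w = "\<lambda>_. 1"])
      show "(\<lambda>\<omega>. if i = y n then indicator ?C \<omega> else (0 :: real)) \<in> borel_measurable M"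
        using arrival_cylinder_events[of n t y] by simp
      show "AE \<omega> in M. (\<lambda>m. indicator (waiting_in (h m) n t y 0 0 i) \<omega> :: real) \<longlonglongrightarrow> (if i = y n then indicator ?C \<omega> else 0)"
      proof (rule AE_I2)
        fix \<omega> assume \<omega>: "\<omega> \<in> space M"
        show "(\<lambda>m. indicator (waiting_in (h m) n t y 0 0 i) \<omega> :: real) \<longlonglongrightarrow> (if i = y n then indicator ?C \<omega> else 0)"
        proof (rule eventually_eq_tendsto[OF _ tendsto_const])
          show "eventually (\<lambda>m. indicator (waiting_in (h m) n t y 0 0 i) \<omega> = (if i = y n then indicator ?C \<omega> else (0 :: real))) sequentially"
            using match[OF \<omega>] grid_separates_eventually[OF h_pos h_lim \<omega> n] grid_state_eventually[OF h_pos h_lim \<omega> n]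
          proof eventually_elim
            case (elim m)
            then have "\<omega> \<in> waiting_in (h m) n t y 0 0 i \<longleftrightarrow> \<omega> \<in> ?C \<and> embedded X T n \<omega> = i"
              using \<omega> by (simp add: waiting_in_def)
            moreover have "embedded X T n \<omega> = y n" if "\<omega> \<in> ?C"
              using that n by (simp add: arrival_cylinder_def)
            ultimately show ?case by (auto simp: indicator_def)
          qed
        qed
      qed
    qed (use ev in auto)
    then show ?thesis
      using ev arrival_cylinder_events[of n t y] by (cases "i = y n") simp_all
  qed
  have "(\<lambda>m. LINT \<omega>|M. grid_renewal (h m) n t y z j \<omega>)
      \<longlonglongrightarrow> (\<Sum>i\<in>UNIV. of_real (if i = y n then prob ?C else 0) * renewal_kernel z $ i $ j)"
    unfolding grid_renewal_integral(1)[OF h_pos n z] renewal_kernel_def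
  proof (rule discrete_resolvent_limit[where h = h and l = l and C = C and P = P and z = z and lam = lam and Q = Q
        and v = "\<lambda>m p. \<lambda>i. prob (waiting_in (h m) n t y p 0 i)" and b = "\<lambda>m p. \<lambda>j. prob (waiting_in (h m) n t y p 1 j)",
        OF h_pos h_lim C l rate_h small z])
    show "prob (waiting_in (h m) n t y p 1 i) = (\<Sum>k\<in>UNIV. prob (waiting_in (h m) n t y p 0 k) * P (h m) $ k $ i)" for m p i
      by (rule waiting_in_step(1)[OF h_pos n leave_h c])
    show "\<bar>prob (waiting_in (h m) n t y (Suc p) 0 i) - (1 - h m * lam i) * prob (waiting_in (h m) n t y p 1 i)\<bar>
        \<le> C * (h m)\<^sup>2 * (\<Sum>k\<in>UNIV. prob (waiting_in (h m) n t y p 0 k))" for m p i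
      unfolding C_def by (rule waiting_in_step(2)[OF h_pos n leave_h c])
  qed (rule P_nonneg P_row_sum P_difference_quotient measure_nonneg v0 M_invertible z h_pos h_lim less_imp_le)+
  moreover have "(\<lambda>m. LINT \<omega>|M. grid_renewal (h m) n t y z j \<omega>)
      \<longlonglongrightarrow> (LINT \<omega>|M. indicator ?C \<omega> *\<^sub>R renewal_factor z n j \<omega>)"
  proof (rule integral_dominated_convergence[where w = "\<lambda>_. 1"])
    show "(\<lambda>\<omega>. indicator ?C \<omega> *\<^sub>R renewal_factor z n j \<omega>) \<in> borel_measurable M"
      using arrival_cylinder_events[of n t y] renewal_factor_measurable[OF n] by measurable
    show "AE \<omega> in M. (\<lambda>m. grid_renewal (h m) n t y z j \<omega>) \<longlonglongrightarrow> indicator ?C \<omega> *\<^sub>R renewal_factor z n j \<omega>"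
    proof (rule AE_I2)
      fix \<omega> assume \<omega>: "\<omega> \<in> space M"
      have n': "1 \<le> Suc n" by simp
      let ?u = "\<lambda>m. of_real (h m * real (grid_epoch (h m) (Suc n) \<omega>) - h m * real (grid_epoch (h m) n \<omega>)) :: complex"
      have "(\<lambda>m. indicator ?C \<omega> *\<^sub>R (exp (- z * ?u m) * indicator {\<omega>. embedded X T (Suc n) \<omega> = j} \<omega>))
          \<longlonglongrightarrow> indicator ?C \<omega> *\<^sub>R (exp (- z * of_real (T (Suc n) \<omega> - T n \<omega>)) * indicator {\<omega>. embedded X T (Suc n) \<omega> = j} \<omega>)"
        by (intro tendsto_intros grid_epoch_tendsto[OF h_pos h_lim \<omega>] n n')
      also have "indicator ?C \<omega> *\<^sub>R (exp (- z * of_real (T (Suc n) \<omega> - T n \<omega>)) * indicator {\<omega>. embedded X T (Suc n) \<omega> = j} \<omega>)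
          = indicator ?C \<omega> *\<^sub>R renewal_factor z n j \<omega>"
        by (simp add: renewal_factor_def interarrival_def)
      finally show "(\<lambda>m. grid_renewal (h m) n t y z j \<omega>) \<longlonglongrightarrow> indicator ?C \<omega> *\<^sub>R renewal_factor z n j \<omega>"
      proof (rule eventually_eq_tendsto[rotated])
        show "eventually (\<lambda>m. grid_renewal (h m) n t y z j \<omega>
           = indicator ?C \<omega> *\<^sub>R (exp (- z * ?u m) * indicator {\<omega>. embedded X T (Suc n) \<omega> = j} \<omega>)) sequentially"
          using match[OF \<omega>] grid_separates_eventually[OF h_pos h_lim \<omega> n] grid_state_eventually[OF h_pos h_lim \<omega> n']
        proof eventually_elim
          case (elim m)
          let ?k = "grid_epoch (h m) n \<omega>" and ?k' = "grid_epoch (h m) (Suc n) \<omega>"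
          have "exp (- z * of_real (h m)) ^ (?k' - ?k) = exp (of_nat (?k' - ?k) * (- z * of_real (h m)))"
            by (simp only: exp_of_nat_mult)
          also have "of_nat (?k' - ?k) * (- z * of_real (h m)) = - z * ?u m"
            using elim by (simp add: of_nat_diff less_imp_le algebra_simps)
          finally show ?case
            using elim \<omega> by (auto simp: grid_renewal_def indicator_def)
        qed
      qed
    qed
  qed (use grid_renewal_integral(2,3)[OF h_pos n z] in auto)
  ultimately have "(LINT \<omega>|M. indicator ?C \<omega> *\<^sub>R renewal_factor z n j \<omega>)
      = (\<Sum>i\<in>UNIV. of_real (if i = y n then prob ?C else 0) * renewal_kernel z $ i $ j)"
    using LIMSEQ_unique by blast
  also have "\<dots> = (\<Sum>i\<in>UNIV. if i = y n then of_real (prob ?C) * renewal_kernel z $ i $ j else 0)"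
    by (intro sum.cong) auto
  finally show ?thesis by simp
qed

section \<open>Service times\<close>

definition service_event :: "nat set \<Rightarrow> (nat \<Rightarrow> real set) \<Rightarrow> 'a set" where
  "service_event L C = {\<omega>\<in>space M. \<forall>l\<in>L. S l \<omega> \<in> C l}"

lemma service_event_events:
  assumes "\<And>l. l \<in> L \<Longrightarrow> 1 \<le> l" "finite L" "\<And>l. C l \<in> sets borel"
  shows "service_event L C \<in> events"
  unfolding service_event_def
proof (rule sets.sets_Collect_finite_All)
  fix l assume "l \<in> L"
  then have [measurable]: "S l \<in> borel_measurable M" using assms(1) S_measurable by blast
  show "{\<omega>\<in>space M. S l \<omega> \<in> C l} \<in> events" using assms(3) by measurable
qed (rule assms(2))

definition service_prob :: "nat \<Rightarrow> (nat \<Rightarrow> real set) \<Rightarrow> 'a \<Rightarrow> real" where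
  "service_prob n C \<omega> = (\<Prod>l=1..n. measure (B (embedded X T l \<omega>)) (C l))"

lemma B_prob_space: "prob_space (B i)"
  using B_distribution[of i] by (simp add: real_distribution_def)

lemma service_prob_bounds: "0 \<le> service_prob n C \<omega>" "service_prob n C \<omega> \<le> 1"
  unfolding service_prob_def
  by (auto intro!: prod_nonneg prod_le_1 prob_space.prob_le_1 B_prob_space)

lemma service_prob_measurable: "service_prob n C \<in> borel_measurable (background_arrival_sigma M X T)"
proof -
  have "(\<lambda>\<omega>. measure (B (embedded X T l \<omega>)) (C l)) \<in> borel_measurable (background_arrival_sigma M X T)"
    if "l \<in> {1..n}" for l
  proof -
    have "embedded X T l \<in> background_arrival_sigma M X T \<rightarrow>\<^sub>M count_space UNIV"
      by (rule embedded_background_arrival_measurable) (use that in simp)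
    then show ?thesis
      by (rule measurable_compose[where g = "\<lambda>i. measure (B i) (C l)"]) simp
  qed
  then show ?thesis unfolding service_prob_def[abs_def] by (rule borel_measurable_prod)
qed

lemma service_law:
  assumes C: "\<And>l. C l \<in> sets borel" and G: "G \<in> sets (background_arrival_sigma M X T)"
  shows "prob (G \<inter> service_event {1..n} C) = (LINT \<omega>|M. indicator G \<omega> * service_prob n C \<omega>)"
proof -
  interpret F: finite_measure_subalgebra M "background_arrival_sigma M X T"
    by (rule subalgebra_background_arrival)
  let ?E = "service_event {1..n} C"
  have E: "?E \<in> events" by (rule service_event_events) (use C in auto)
  have G': "G \<in> events" using G background_arrival_events by auto
  have "prob (G \<inter> ?E) = (LINT \<omega>:G|M. indicator ?E \<omega>)"
    using E G' by (simp add: set_lebesgue_integral_def flip: indicator_inter_arith)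
  also have "\<dots> = (LINT \<omega>:G|M. real_cond_exp M (background_arrival_sigma M X T) (indicator ?E) \<omega>)"
    by (rule F.real_cond_exp_intA[OF _ G]) (use E in \<open>simp add: integrable_real_indicator emeasure_eq_measure\<close>)
  also have "\<dots> = (LINT \<omega>|M. indicator G \<omega> * service_prob n C \<omega>)"
    unfolding set_lebesgue_integral_def
  proof (rule integral_cong_AE)
    have [measurable]: "service_prob n C \<in> borel_measurable M"
      by (rule background_arrival_measurable_M[OF service_prob_measurable])
    show "(\<lambda>\<omega>. indicator G \<omega> * service_prob n C \<omega>) \<in> borel_measurable M"
      using G' by measurable
    show "(\<lambda>\<omega>. indicator G \<omega> *\<^sub>R real_cond_exp M (background_arrival_sigma M X T) (indicator ?E) \<omega>) \<in> borel_measurable M"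
      using G' by measurable
  qed (use services[where C = C and n = n, OF C] in \<open>auto simp: service_event_def service_prob_def\<close>)
  finally show ?thesis .
qed

lemma service_past_integral:
  fixes f :: "'a \<Rightarrow> complex"
  assumes C: "\<And>l. C l \<in> sets borel"
    and f: "f \<in> borel_measurable (background_arrival_sigma M X T)"
    and bounded: "\<And>\<omega>. \<omega> \<in> space M \<Longrightarrow> cmod (f \<omega>) \<le> K"
  shows "(LINT \<omega>|M. f \<omega> * indicator (service_event {1..n} C) \<omega>) = (LINT \<omega>|M. f \<omega> * of_real (service_prob n C \<omega>))"
proof -
  let ?F = "background_arrival_sigma M X T"
  let ?E = "service_event {1..n} C"
  have E[measurable]: "?E \<in> events" by (rule service_event_events) (use C in auto)
  have [measurable]: "service_prob n C \<in> borel_measurable M" "f \<in> borel_measurable M"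
    by (rule background_arrival_measurable_M, rule service_prob_measurable f)+
  define D :: "'a \<Rightarrow> complex" where "D \<omega> = indicator ?E \<omega> - of_real (service_prob n C \<omega>)" for \<omega>
  have i1: "integrable M (\<lambda>\<omega>. indicator ?E \<omega> :: complex)"
    by (rule integrable_const_bound[where B = 1, OF _ borel_measurable_indicator[OF E]]) (auto simp: indicator_def)
  have i2: "integrable M (service_prob n C)"
    by (rule integrable_const_bound[where B = 1]) (auto simp: service_prob_bounds)
  have i2': "integrable M (\<lambda>\<omega>. of_real (service_prob n C \<omega>) :: complex)"
    using i2 by simp
  have "(LINT \<omega>|M. f \<omega> * D \<omega>) = 0"
  proof (rule integral_mult_eq_0_if_zero_on_generator[where G = "sets ?F"])
    show "Int_stable (sets ?F)" by (auto simp: Int_stable_def)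
    show "sets ?F \<subseteq> events" by (rule background_arrival_events)
    show "space M \<in> sets ?F" using sets.top[of ?F] by simp
    show "integrable M D" unfolding D_def using i1 i2' by simp
    show "f \<in> borel_measurable (sigma (space M) (sets ?F))"
      using f sets.sigma_sets_eq[of ?F] sets.space_closed[of ?F] by (simp add: measurable_def)
    show "cmod (f \<omega>) \<le> K" if "\<omega> \<in> space M" for \<omega> by (rule bounded[OF that])
    fix G assume G: "G \<in> sets ?F"
    then have G'[measurable]: "G \<in> events" using background_arrival_events by auto
    have j1: "integrable M (\<lambda>\<omega>. indicator G \<omega> * service_prob n C \<omega>)"
      using integrable_mult_indicator[OF G' i2] by simp
    have "(LINT \<omega>|M. indicator G \<omega> *\<^sub>R D \<omega>)
        = (LINT \<omega>|M. of_real (indicator (G \<inter> ?E) \<omega> - indicator G \<omega> * service_prob n C \<omega>))"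
      by (rule Bochner_Integration.integral_cong) (auto simp: D_def indicator_def)
    also have "\<dots> = of_real (LINT \<omega>|M. indicator (G \<inter> ?E) \<omega> - indicator G \<omega> * service_prob n C \<omega>)"
      by (rule integral_complex_of_real)
    also have "\<dots> = of_real (prob (G \<inter> ?E) - (LINT \<omega>|M. indicator G \<omega> * service_prob n C \<omega>))"
    proof -
      have mean: "(LINT \<omega>|M. indicator A \<omega>) = prob A" and int: "integrable M (\<lambda>\<omega>. indicator A \<omega> :: real)" if "A \<in> events" for A
        using that by (simp_all add: integrable_real_indicator emeasure_eq_measure)
      have GE: "G \<inter> ?E \<in> events" by (rule sets.Int[OF G' E])
      show ?thesis
        by (simp only: Bochner_Integration.integral_diff[OF int[OF GE] j1] mean[OF GE])
    qed
    also have "\<dots> = 0" by (simp only: service_law[OF C G] diff_self of_real_0)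
    finally show "(LINT \<omega>|M. indicator G \<omega> *\<^sub>R D \<omega>) = 0" .
  qed
  moreover have "integrable M (\<lambda>\<omega>. f \<omega> * indicator ?E \<omega>)"
  proof (rule integrable_const_bound[where B = K])
    show "AE \<omega> in M. norm (f \<omega> * indicator ?E \<omega>) \<le> K"
    proof (rule AE_I2)
      fix \<omega> assume \<omega>: "\<omega> \<in> space M"
      have "norm (f \<omega> * indicator ?E \<omega>) \<le> norm (f \<omega>)"
        unfolding indicator_def by simp
      then show "norm (f \<omega> * indicator ?E \<omega>) \<le> K"
        using bounded[OF \<omega>] by linarith
    qed
  qed measurable
  moreover have "integrable M (\<lambda>\<omega>. f \<omega> * of_real (service_prob n C \<omega>))"
  proof (rule integrable_const_bound[where B = K])
    show "AE \<omega> in M. norm (f \<omega> * of_real (service_prob n C \<omega>)) \<le> K"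
      using bounded service_prob_bounds[of n C]
      by (intro AE_I2) (auto simp: norm_mult intro: order_trans[OF mult_left_le])
  qed measurable
  ultimately show ?thesis by (simp add: D_def right_diff_distrib)
qed

definition history_generator :: "nat \<Rightarrow> 'a set set" where
  "history_generator n =
     {G \<inter> service_event {1..<n} C | G C. G \<in> sets (background_arrival_sigma M X T) \<and> (\<forall>l. C l \<in> sets borel)}"

text \<open>Everything about the background process and all arrivals, future ones included, together with the service
times of the customers before the \<open>n\<close>th one. The service time of the \<open>n\<close>th customer is conditionally
independent of it given \<open>Y\<^sub>n\<close>.\<close>
definition history_sigma :: "nat \<Rightarrow> 'a measure" where
  "history_sigma n = sigma (space M) (history_generator n)"

lemma service_event_insert:
  assumes "1 \<le> n"
  shows "service_event {1..<n} C \<inter> (S n -` D \<inter> space M) = service_event {1..n} (C(n := D))"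
    and "service_event {1..<n} C = service_event {1..n} (C(n := UNIV))"
proof -
  have "{1..n} = insert n {1..<n}" using assms by auto
  then show "service_event {1..<n} C \<inter> (S n -` D \<inter> space M) = service_event {1..n} (C(n := D))"
    "service_event {1..<n} C = service_event {1..n} (C(n := UNIV))"
    by (auto simp: service_event_def)
qed

lemma lst_le_1:
  assumes "Re s = 0"
  shows "cmod (lst (B i) s) \<le> 1"
proof -
  interpret B: prob_space "B i" by (rule B_prob_space)
  have "cmod (lst (B i) s) \<le> (LINT x|B i. cmod (exp (- s * of_real x)))"
    unfolding lst_def by (rule integral_norm_bound)
  then show ?thesis using assms by (simp add: B.prob_space)
qed

text \<open>On the part where \<open>Y\<^sub>n = i\<close> the joint law of the first \<open>n\<close> service times has the factor \<open>B i\<close> for the last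
one. The remaining factors depend on the arrivals, but they are the same for all sets that the \<open>n\<close>th service
time is required to lie in, so they add up to the probability of \<open>E i\<close>.\<close>
lemma service_factor_generator:
  assumes n: "1 \<le> n" and s: "Re s = 0"
    and C: "\<And>l. C l \<in> sets borel" and G: "G \<in> sets (background_arrival_sigma M X T)"
  shows "(LINT \<omega>|M. indicator (G \<inter> service_event {1..<n} C) \<omega> *\<^sub>R
     (exp (- s * of_real (S n \<omega>)) - lst (B (embedded X T n \<omega>)) s)) = 0"
proof -
  let ?F = "background_arrival_sigma M X T"
  have S_meas[measurable]: "S n \<in> borel_measurable M" by (rule S_measurable[OF n])
  define Gi where "Gi i = G \<inter> {\<omega>\<in>space M. embedded X T n \<omega> = i}" for i
  have Gi: "Gi i \<in> sets ?F" for i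
  proof -
    have [measurable]: "embedded X T n \<in> ?F \<rightarrow>\<^sub>M count_space UNIV"
      by (rule embedded_background_arrival_measurable[OF n])
    have "{\<omega>\<in>space ?F. embedded X T n \<omega> = i} \<in> sets ?F" by measurable
    then show ?thesis using G unfolding Gi_def by auto
  qed
  define E where "E i = Gi i \<inter> service_event {1..<n} C" for i
  have E_events: "E i \<in> events" for i
    unfolding E_def using Gi background_arrival_events service_event_events[of "{1..<n}" C] C by auto
  have law_n: "prob (E i \<inter> (S n -` D \<inter> space M))
      = (LINT \<omega>|M. indicator (Gi i) \<omega> * (\<Prod>l=1..<n. measure (B (embedded X T l \<omega>)) (C l))) * measure (B i) D"
    if D: "D \<in> sets borel" for D i
  proof -
    have C': "(C(n := D)) l \<in> sets borel" for l using C D by simp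
    have "E i \<inter> (S n -` D \<inter> space M) = Gi i \<inter> service_event {1..n} (C(n := D))"
      unfolding E_def service_event_insert(1)[OF n, symmetric] by (rule Int_assoc)
    then have "prob (E i \<inter> (S n -` D \<inter> space M)) = (LINT \<omega>|M. indicator (Gi i) \<omega> * service_prob n (C(n := D)) \<omega>)"
      using service_law[where C = "C(n := D)", OF C' Gi] by simp
    also have "\<dots> = (LINT \<omega>|M. indicator (Gi i) \<omega> * (\<Prod>l=1..<n. measure (B (embedded X T l \<omega>)) (C l)) * measure (B i) D)"
    proof (rule Bochner_Integration.integral_cong[OF refl])
      fix \<omega>
      have "{1..n} = insert n {1..<n}" using n by auto
      then have "service_prob n (C(n := D)) \<omega> = measure (B (embedded X T n \<omega>)) D * (\<Prod>l=1..<n. measure (B (embedded X T l \<omega>)) (C l))"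
        by (simp add: service_prob_def)
      then show "indicator (Gi i) \<omega> * service_prob n (C(n := D)) \<omega>
          = indicator (Gi i) \<omega> * (\<Prod>l=1..<n. measure (B (embedded X T l \<omega>)) (C l)) * measure (B i) D"
        by (auto simp: indicator_def Gi_def)
    qed
    finally show ?thesis by simp
  qed
  have law: "prob (E i \<inter> (S n -` D \<inter> space M)) = prob (E i) * measure (B i) D" if D: "D \<in> sets borel" for D i
  proof -
    interpret Bi: real_distribution "B i" by (rule B_distribution)
    have "prob (E i) = prob (E i \<inter> (S n -` UNIV \<inter> space M))"
      using sets.sets_into_space[OF E_events[of i]] by (simp add: Int_absorb2)
    also have "\<dots> = (LINT \<omega>|M. indicator (Gi i) \<omega> * (\<Prod>l=1..<n. measure (B (embedded X T l \<omega>)) (C l)))"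
      using law_n[of UNIV i] Bi.prob_space by simp
    finally show ?thesis using law_n[OF D] by simp
  qed
  have "(LINT \<omega>|M. indicator (G \<inter> service_event {1..<n} C) \<omega> *\<^sub>R
     (exp (- s * of_real (S n \<omega>)) - lst (B (embedded X T n \<omega>)) s))
     = (LINT \<omega>|M. (\<Sum>i\<in>UNIV. indicator (E i) \<omega> *\<^sub>R exp (- s * of_real (S n \<omega>)) - indicator (E i) \<omega> *\<^sub>R lst (B i) s))"
  proof (rule Bochner_Integration.integral_cong[OF refl])
    fix \<omega> assume \<omega>: "\<omega> \<in> space M"
    have "indicator (E i) \<omega> *\<^sub>R exp (- s * of_real (S n \<omega>)) - indicator (E i) \<omega> *\<^sub>R lst (B i) s
        = (if embedded X T n \<omega> = i then indicator (G \<inter> service_event {1..<n} C) \<omega> *\<^sub>R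
           (exp (- s * of_real (S n \<omega>)) - lst (B (embedded X T n \<omega>)) s) else 0)" for i
      using \<omega> by (auto simp: E_def Gi_def indicator_def)
    then show "indicator (G \<inter> service_event {1..<n} C) \<omega> *\<^sub>R
     (exp (- s * of_real (S n \<omega>)) - lst (B (embedded X T n \<omega>)) s)
     = (\<Sum>i\<in>UNIV. indicator (E i) \<omega> *\<^sub>R exp (- s * of_real (S n \<omega>)) - indicator (E i) \<omega> *\<^sub>R lst (B i) s)"
      by simp
  qed
  also have "\<dots> = (\<Sum>i\<in>UNIV. (LINT \<omega>|M. indicator (E i) \<omega> *\<^sub>R exp (- s * of_real (S n \<omega>))) - prob (E i) *\<^sub>R lst (B i) s)"
  proof -
    have i1: "integrable M (\<lambda>\<omega>. indicator (E i) \<omega> *\<^sub>R exp (- s * of_real (S n \<omega>)))" for i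
    proof (rule integrable_const_bound[where B = 1])
      show "AE \<omega> in M. norm (indicator (E i) \<omega> *\<^sub>R exp (- s * of_real (S n \<omega>))) \<le> 1"
        using s by (auto simp: indicator_def)
      show "(\<lambda>\<omega>. indicator (E i) \<omega> *\<^sub>R exp (- s * of_real (S n \<omega>))) \<in> borel_measurable M"
        using E_events[of i] by measurable
    qed
    have i2: "integrable M (\<lambda>\<omega>. indicator (E i) \<omega> *\<^sub>R lst (B i) s)" for i
      using E_events[of i] by (intro integrable_scaleR_left) (simp add: integrable_real_indicator emeasure_eq_measure)
    have "(LINT \<omega>|M. indicator (E i) \<omega> *\<^sub>R lst (B i) s) = prob (E i) *\<^sub>R lst (B i) s" for i
      using E_events[of i] by (subst integral_scaleR_left) (simp_all add: integrable_real_indicator emeasure_eq_measure)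
    then show ?thesis
      using i1 i2 by (subst Bochner_Integration.integral_sum) (auto simp: Bochner_Integration.integral_diff)
  qed
  also have "\<dots> = 0"
  proof (rule sum.neutral, rule ballI)
    fix i
    have "(LINT \<omega>|M. indicator (E i) \<omega> *\<^sub>R exp (- s * of_real (S n \<omega>))) = prob (E i) *\<^sub>R (LINT x|B i. exp (- s * of_real x))"
      by (rule integral_of_law[OF E_events S_meas B_distribution law])
        (auto intro!: borel_measurable_continuous_onI continuous_intros)
    then show "(LINT \<omega>|M. indicator (E i) \<omega> *\<^sub>R exp (- s * of_real (S n \<omega>))) - prob (E i) *\<^sub>R lst (B i) s = 0"
      by (simp add: lst_def)
  qed
  finally show ?thesis .
qed

lemma history_generator_properties:
  shows "Int_stable (history_generator n)" "history_generator n \<subseteq> events" "space M \<in> history_generator n"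
proof -
  show "Int_stable (history_generator n)"
  proof (rule Int_stableI)
    fix A A' assume "A \<in> history_generator n" "A' \<in> history_generator n"
    then obtain G C G' C' where
      A: "A = G \<inter> service_event {1..<n} C" "G \<in> sets (background_arrival_sigma M X T)" "\<And>l. C l \<in> sets borel" and
      A': "A' = G' \<inter> service_event {1..<n} C'" "G' \<in> sets (background_arrival_sigma M X T)" "\<And>l. C' l \<in> sets borel"
      unfolding history_generator_def by blast
    have "A \<inter> A' = (G \<inter> G') \<inter> service_event {1..<n} (\<lambda>l. C l \<inter> C' l)"
      unfolding A A' by (auto simp: service_event_def)
    moreover have "G \<inter> G' \<in> sets (background_arrival_sigma M X T)" "\<forall>l. C l \<inter> C' l \<in> sets borel"
      using A A' by auto
    ultimately show "A \<inter> A' \<in> history_generator n" unfolding history_generator_def by blast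
  qed
  show "history_generator n \<subseteq> events"
    unfolding history_generator_def using background_arrival_events service_event_events[of "{1..<n}"] by auto
  have "space M = space M \<inter> service_event {1..<n} (\<lambda>_. UNIV)" by (auto simp: service_event_def)
  moreover have "space M \<in> sets (background_arrival_sigma M X T)"
    using sets.top[of "background_arrival_sigma M X T"] by simp
  ultimately show "space M \<in> history_generator n"
    unfolding history_generator_def mem_Collect_eq
    by (intro exI[of _ "space M"] exI[of _ "\<lambda>_. UNIV"] conjI) auto
qed

lemma service_integral:
  assumes n: "1 \<le> n" and s: "Re s = 0"
    and f: "f \<in> borel_measurable (history_sigma n)"
    and bounded: "\<And>\<omega>. \<omega> \<in> space M \<Longrightarrow> cmod (f \<omega>) \<le> K"
  shows "(LINT \<omega>|M. f \<omega> * (exp (- s * of_real (S n \<omega>)) - lst (B (embedded X T n \<omega>)) s)) = 0"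
proof (rule integral_mult_eq_0_if_zero_on_generator[OF history_generator_properties _ _ f[unfolded history_sigma_def] bounded])
  have [measurable]: "S n \<in> borel_measurable M" "embedded X T n \<in> M \<rightarrow>\<^sub>M count_space UNIV"
    using S_measurable embedded_measurable n by auto
  show "integrable M (\<lambda>\<omega>. exp (- s * of_real (S n \<omega>)) - lst (B (embedded X T n \<omega>)) s)"
  proof (rule integrable_const_bound[where B = 2])
    show "AE \<omega> in M. cmod (exp (- s * of_real (S n \<omega>)) - lst (B (embedded X T n \<omega>)) s) \<le> 2"
    proof (rule AE_I2)
      fix \<omega>
      have "cmod (exp (- s * of_real (S n \<omega>)) - lst (B (embedded X T n \<omega>)) s)
          \<le> cmod (exp (- s * of_real (S n \<omega>))) + cmod (lst (B (embedded X T n \<omega>)) s)"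
        by (rule norm_triangle_ineq4)
      also have "\<dots> \<le> 1 + 1"
        using s lst_le_1[OF s] by (intro add_mono) auto
      finally show "cmod (exp (- s * of_real (S n \<omega>)) - lst (B (embedded X T n \<omega>)) s) \<le> 2" by simp
    qed
  qed measurable
  fix A assume "A \<in> history_generator n"
  then obtain G C where A: "A = G \<inter> service_event {1..<n} C" "G \<in> sets (background_arrival_sigma M X T)" "\<And>l. C l \<in> sets borel"
    unfolding history_generator_def by blast
  show "(LINT \<omega>|M. indicator A \<omega> *\<^sub>R (exp (- s * of_real (S n \<omega>)) - lst (B (embedded X T n \<omega>)) s)) = 0"
    unfolding A(1) by (rule service_factor_generator[OF n s A(3,2)])
qed

section \<open>The renewal property with services\<close>

text \<open>The sets describe the past of the \<open>n\<close>th arrival as far as the workload \<open>W\<^sub>n\<close> depends on it. All epochs are bounded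
and all states are prescribed in a cylinder, so the empty set and the whole space are added to obtain an
intersection-stable family that contains the whole space.\<close>
definition renewal_generator :: "nat \<Rightarrow> 'a set set" where
  "renewal_generator n = insert {} (insert (space M)
     {arrival_cylinder n t y \<inter> service_event {1..<n} C | t y C. \<forall>l. C l \<in> sets borel})"

definition renewal_sigma :: "nat \<Rightarrow> 'a measure" where
  "renewal_sigma n = sigma (space M) (renewal_generator n)"

lemma renewal_generator_stable: "Int_stable (renewal_generator n)"
proof (rule Int_stableI)
  fix A A' assume AA: "A \<in> renewal_generator n" "A' \<in> renewal_generator n"
  have sub: "A \<subseteq> space M" "A' \<subseteq> space M"
    using AA by (auto simp: renewal_generator_def arrival_cylinder_def)
  show "A \<inter> A' \<in> renewal_generator n"
  proof (cases "A \<in> {{}, space M} \<or> A' \<in> {{}, space M}")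
    case True
    then have "A \<inter> A' \<in> {{}, A, A'}" using sub by auto
    then show ?thesis using AA by (auto simp: renewal_generator_def)
  next
    case False
    then obtain t y C t' y' C' where
      A: "A = arrival_cylinder n t y \<inter> service_event {1..<n} C" "\<forall>l. C l \<in> sets borel" and
      A': "A' = arrival_cylinder n t' y' \<inter> service_event {1..<n} C'" "\<forall>l. C' l \<in> sets borel"
      using AA unfolding renewal_generator_def by blast
    show ?thesis
    proof (cases "\<forall>l\<in>{1..n}. y l = y' l")
      case True
      have "A \<inter> A' = arrival_cylinder n (\<lambda>l. min (t l) (t' l)) y \<inter> service_event {1..<n} (\<lambda>l. C l \<inter> C' l)"
        unfolding A(1) A'(1) using True by (auto simp: arrival_cylinder_def service_event_def)
      moreover have "\<forall>l. C l \<inter> C' l \<in> sets borel" using A(2) A'(2) by auto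
      ultimately show ?thesis unfolding renewal_generator_def by blast
    next
      case False
      then have "A \<inter> A' = {}"
        unfolding A(1) A'(1) by (auto simp: arrival_cylinder_def)
      then show ?thesis by (simp add: renewal_generator_def)
    qed
  qed
qed

lemma renewal_generator_events: "renewal_generator n \<subseteq> events"
  using arrival_cylinder_events service_event_events[of "{1..<n}"] by (auto simp: renewal_generator_def)

lemma space_renewal[simp]: "space (renewal_sigma n) = space M"
  and sets_renewal: "sets (renewal_sigma n) = sigma_sets (space M) (renewal_generator n)"
proof -
  have "renewal_generator n \<subseteq> Pow (space M)"
    using renewal_generator_events sets.space_closed by blast
  then show "space (renewal_sigma n) = space M" "sets (renewal_sigma n) = sigma_sets (space M) (renewal_generator n)"
    by (simp_all add: renewal_sigma_def)
qed

text \<open>A cylinder prescribes all the epochs and states at once. An event that concerns only one of them is recovered by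
letting the bound on the epochs grow and the states vary.\<close>
lemma renewal_sigma_localize:
  assumes n: "1 \<le> n" and A: "A \<subseteq> space M"
    and local: "\<And>k y. A \<inter> arrival_cylinder n (\<lambda>_. real k) y \<in> sets (renewal_sigma n)"
  shows "A \<in> sets (renewal_sigma n)"
proof -
  let ?Y = "PiE {1..n} (\<lambda>_. UNIV :: 'n set)"
  have "A = (\<Union>k. \<Union>y\<in>?Y. A \<inter> arrival_cylinder n (\<lambda>_. real k) y)"
  proof
    show "A \<subseteq> (\<Union>k. \<Union>y\<in>?Y. A \<inter> arrival_cylinder n (\<lambda>_. real k) y)"
    proof
      fix \<omega> assume \<omega>: "\<omega> \<in> A"
      obtain k where k: "T n \<omega> < real k" using reals_Archimedean2 by blast
      have "T l \<omega> < real k" if "l \<in> {1..n}" for l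
        using T_mono[of \<omega> l n] that \<omega> A k by fastforce
      then have "\<omega> \<in> arrival_cylinder n (\<lambda>_. real k) (restrict (\<lambda>l. embedded X T l \<omega>) {1..n})"
        using \<omega> A by (auto simp: arrival_cylinder_def)
      moreover have "restrict (\<lambda>l. embedded X T l \<omega>) {1..n} \<in> ?Y" by (simp add: restrict_PiE_iff)
      ultimately show "\<omega> \<in> (\<Union>k. \<Union>y\<in>?Y. A \<inter> arrival_cylinder n (\<lambda>_. real k) y)" using \<omega> by blast
    qed
  qed auto
  moreover have "(\<Union>k. \<Union>y\<in>?Y. A \<inter> arrival_cylinder n (\<lambda>_. real k) y) \<in> sets (renewal_sigma n)"
  proof (rule sets.countable_UN, rule image_subsetI)
    fix k :: nat
    show "(\<Union>y\<in>?Y. A \<inter> arrival_cylinder n (\<lambda>_. real k) y) \<in> sets (renewal_sigma n)"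
      by (rule sets.finite_UN[OF finite_PiE local]) auto
  qed
  ultimately show ?thesis by simp
qed

lemma arrival_service_renewal:
  "\<forall>l. C l \<in> sets borel \<Longrightarrow> arrival_cylinder n t y \<inter> service_event {1..<n} C \<in> sets (renewal_sigma n)"
  unfolding sets_renewal renewal_generator_def by (rule sigma_sets.Basic) blast

lemma arrival_cylinder_renewal: "arrival_cylinder n t y \<in> sets (renewal_sigma n)"
proof -
  have "arrival_cylinder n t y = arrival_cylinder n t y \<inter> service_event {1..<n} (\<lambda>_. UNIV)"
    by (auto simp: arrival_cylinder_def service_event_def)
  also have "\<dots> \<in> sets (renewal_sigma n)" by (rule arrival_service_renewal) simp
  finally show ?thesis .
qed

lemma T_renewal_measurable:
  assumes n: "1 \<le> n" and l: "l \<in> {1..n}"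
  shows "T l \<in> borel_measurable (renewal_sigma n)"
proof (rule borel_measurable_iff_less[THEN iffD2], rule allI)
  fix c
  have "{\<omega>\<in>space M. T l \<omega> < c} \<in> sets (renewal_sigma n)"
  proof (rule renewal_sigma_localize[OF n])
    fix k y
    have "{\<omega>\<in>space M. T l \<omega> < c} \<inter> arrival_cylinder n (\<lambda>_. real k) y
        = arrival_cylinder n ((\<lambda>_. real k)(l := min c (real k))) y"
      using l by (auto simp: arrival_cylinder_def)
    then show "{\<omega>\<in>space M. T l \<omega> < c} \<inter> arrival_cylinder n (\<lambda>_. real k) y \<in> sets (renewal_sigma n)"
      by (simp add: arrival_cylinder_renewal)
  qed auto
  then show "{\<omega>\<in>space (renewal_sigma n). T l \<omega> < c} \<in> sets (renewal_sigma n)" by simp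
qed

lemma embedded_renewal_measurable:
  assumes n: "1 \<le> n" and l: "l \<in> {1..n}"
  shows "embedded X T l \<in> renewal_sigma n \<rightarrow>\<^sub>M count_space UNIV"
proof -
  have "{\<omega>\<in>space M. embedded X T l \<omega> = i} \<in> sets (renewal_sigma n)" for i
  proof (rule renewal_sigma_localize[OF n])
    fix k y
    have "{\<omega>\<in>space M. embedded X T l \<omega> = i} \<inter> arrival_cylinder n (\<lambda>_. real k) y
        = (if y l = i then arrival_cylinder n (\<lambda>_. real k) y else {})"
      using l by (auto simp: arrival_cylinder_def)
    then show "{\<omega>\<in>space M. embedded X T l \<omega> = i} \<inter> arrival_cylinder n (\<lambda>_. real k) y \<in> sets (renewal_sigma n)"
      by (simp add: arrival_cylinder_renewal)
  qed auto
  then show ?thesis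
    by (auto simp: measurable_count_space_eq2 vimage_def Int_def conj_commute)
qed

lemma S_renewal_measurable:
  assumes n: "1 \<le> n" and l: "l \<in> {1..<n}"
  shows "S l \<in> borel_measurable (renewal_sigma n)"
proof (rule measurableI)
  fix D :: "real set" assume D: "D \<in> sets borel"
  have "S l -` D \<inter> space M \<in> sets (renewal_sigma n)"
  proof (rule renewal_sigma_localize[OF n])
    fix k y
    have "(S l -` D \<inter> space M) \<inter> arrival_cylinder n (\<lambda>_. real k) y
        = arrival_cylinder n (\<lambda>_. real k) y \<inter> service_event {1..<n} ((\<lambda>_. UNIV)(l := D))"
      using l by (auto simp: arrival_cylinder_def service_event_def)
    also have "\<dots> \<in> sets (renewal_sigma n)" by (rule arrival_service_renewal) (use D in simp)
    finally show "(S l -` D \<inter> space M) \<inter> arrival_cylinder n (\<lambda>_. real k) y \<in> sets (renewal_sigma n)" .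
  qed auto
  then show "S l -` D \<inter> space (renewal_sigma n) \<in> sets (renewal_sigma n)" by simp
qed simp

lemma W_measurable_from:
  assumes F: "space F = space M"
    and T: "\<And>l. l \<in> {1..n} \<Longrightarrow> T l \<in> borel_measurable F"
    and S: "\<And>l. l \<in> {1..<n} \<Longrightarrow> S l \<in> borel_measurable F"
    and n: "1 \<le> n"
  shows "W n \<in> borel_measurable F"
  using n T S
proof (induction n rule: nat_induct_at_least)
  case base
  have "W 1 \<in> borel_measurable F \<longleftrightarrow> (\<lambda>_. w) \<in> borel_measurable F"
    by (rule measurable_cong) (use F W_first in auto)
  then show ?case by simp
next
  case (Suc n)
  have [measurable]: "W n \<in> borel_measurable F" "S n \<in> borel_measurable F"
    "T n \<in> borel_measurable F" "T (Suc n) \<in> borel_measurable F"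
    using Suc by auto
  have "W (Suc n) \<in> borel_measurable F \<longleftrightarrow>
      (\<lambda>\<omega>. max 0 (a * W n \<omega> + S n \<omega> - (T (Suc n) \<omega> - T n \<omega>))) \<in> borel_measurable F"
    by (rule measurable_cong) (use F W_step Suc(1) in \<open>auto simp: interarrival_def\<close>)
  then show ?case by simp
qed

lemma space_history[simp]: "space (history_sigma n) = space M"
  and sets_history: "sets (history_sigma n) = sigma_sets (space M) (history_generator n)"
proof -
  have "history_generator n \<subseteq> Pow (space M)"
    using history_generator_properties(2)[of n] sets.space_closed[of M] by blast
  then show "space (history_sigma n) = space M" "sets (history_sigma n) = sigma_sets (space M) (history_generator n)"
    by (simp_all add: history_sigma_def)
qed

lemma background_arrival_history: "sets (background_arrival_sigma M X T) \<subseteq> sets (history_sigma n)"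
proof
  fix G assume G: "G \<in> sets (background_arrival_sigma M X T)"
  then have "G \<subseteq> space M" using sets.sets_into_space by fastforce
  then have "G = G \<inter> service_event {1..<n} (\<lambda>_. UNIV)" by (auto simp: service_event_def)
  then show "G \<in> sets (history_sigma n)"
    unfolding sets_history history_generator_def
    by (intro sigma_sets.Basic CollectI exI[of _ G] exI[of _ "\<lambda>_. UNIV"] conjI) (use G in auto)
qed

lemma history_measurable: "f \<in> background_arrival_sigma M X T \<rightarrow>\<^sub>M N \<Longrightarrow> f \<in> history_sigma n \<rightarrow>\<^sub>M N"
  using background_arrival_history[of n] by (auto simp: measurable_def)

lemma S_history_measurable:
  assumes l: "l \<in> {1..<n}"
  shows "S l \<in> borel_measurable (history_sigma n)"
proof (rule measurableI)
  fix D :: "real set" assume D: "D \<in> sets borel"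
  have "S l -` D \<inter> space M = space M \<inter> service_event {1..<n} ((\<lambda>_. UNIV)(l := D))"
    using l by (auto simp: service_event_def)
  moreover have "space M \<in> sets (background_arrival_sigma M X T)"
    using sets.top[of "background_arrival_sigma M X T"] by simp
  moreover have "\<forall>q. ((\<lambda>_. UNIV)(l := D)) q \<in> sets borel" using D by simp
  ultimately have "S l -` D \<inter> space M \<in> sets (history_sigma n)"
    unfolding sets_history history_generator_def
    by (intro sigma_sets.Basic CollectI exI[of _ "space M"] exI[of _ "(\<lambda>_. UNIV)(l := D)"] conjI)
  then show "S l -` D \<inter> space (history_sigma n) \<in> sets (history_sigma n)" by simp
qed simp

definition renewal_error :: "complex \<Rightarrow> nat \<Rightarrow> 'n \<Rightarrow> 'a \<Rightarrow> complex" where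
  "renewal_error z n j \<omega> = renewal_factor z n j \<omega> - renewal_kernel z $ embedded X T n \<omega> $ j"

lemma renewal_error_bounded:
  assumes "1 \<le> n" "0 \<le> Re z"
  obtains K where "\<And>\<omega>. \<omega> \<in> space M \<Longrightarrow> cmod (renewal_error z n j \<omega>) \<le> K"
proof (rule that[of "1 + (\<Sum>i\<in>UNIV. cmod (renewal_kernel z $ i $ j))"])
  fix \<omega> assume \<omega>: "\<omega> \<in> space M"
  have "cmod (renewal_kernel z $ embedded X T n \<omega> $ j) \<le> (\<Sum>i\<in>UNIV. cmod (renewal_kernel z $ i $ j))"
    by (rule member_le_sum) auto
  then show "cmod (renewal_error z n j \<omega>) \<le> 1 + (\<Sum>i\<in>UNIV. cmod (renewal_kernel z $ i $ j))"
    unfolding renewal_error_def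
    using norm_triangle_ineq4[of "renewal_factor z n j \<omega>" "renewal_kernel z $ embedded X T n \<omega> $ j"]
      renewal_factor_le_1[OF \<omega> assms, of j] by linarith
qed

lemma function_of_embedded_measurable:
  assumes n: "1 \<le> n"
  shows "(\<lambda>\<omega>. g (embedded X T n \<omega>)) \<in> borel_measurable (background_arrival_sigma M X T)"
  by (rule measurable_compose[OF embedded_background_arrival_measurable[OF n]]) simp

lemma renewal_error_background_arrival:
  assumes n: "1 \<le> n"
  shows "renewal_error z n j \<in> borel_measurable (background_arrival_sigma M X T)"
  unfolding renewal_error_def[abs_def]
  by (intro borel_measurable_diff renewal_factor_background_arrival n
      function_of_embedded_measurable[OF n, of "\<lambda>i. renewal_kernel z $ i $ j"])

text \<open>Given the background process and the arrivals, the events on the service times have a probability that is a function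
of the states, hence is constant on the cylinder. It factors out and leaves the renewal property of the
arrivals.\<close>
lemma renewal_error_cylinder:
  assumes n: "1 \<le> n" and z: "0 \<le> Re z" and C: "\<And>l. C l \<in> sets borel"
  shows "(LINT \<omega>|M. indicator (arrival_cylinder n t y \<inter> service_event {1..<n} C) \<omega> *\<^sub>R renewal_error z n j \<omega>) = 0"
proof -
  let ?A = "arrival_cylinder n t y"
  obtain K where K: "\<And>\<omega>. \<omega> \<in> space M \<Longrightarrow> cmod (renewal_error z n j \<omega>) \<le> K"
    by (rule renewal_error_bounded[OF n z, of j]) (rule that)
  define f where "f \<omega> = indicator ?A \<omega> *\<^sub>R renewal_error z n j \<omega>" for \<omega>
  have f: "f \<in> borel_measurable (background_arrival_sigma M X T)"
    unfolding f_def[abs_def] using arrival_cylinder_background_arrival[of n t y] renewal_error_background_arrival[OF n]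
    by measurable
  have f_le: "cmod (f \<omega>) \<le> K" if "\<omega> \<in> space M" for \<omega>
    using K[OF that] order_trans[OF norm_ge_zero K[OF that]] by (simp add: f_def indicator_def)
  define c where "c = (\<Prod>l=1..n-1. measure (B (y l)) (C l))"
  have A: "?A \<in> events" by (rule arrival_cylinder_events)
  have f_zero: "(LINT \<omega>|M. f \<omega>) = 0"
  proof -
    have R[measurable]: "renewal_factor z n j \<in> borel_measurable M" by (rule renewal_factor_measurable[OF n])
    have i1: "integrable M (\<lambda>\<omega>. indicator ?A \<omega> *\<^sub>R renewal_factor z n j \<omega>)"
      by (intro integrable_mult_indicator[OF A] integrable_const_bound[where B = 1])
        (use renewal_factor_le_1[OF _ n z] in auto)
    have i2: "integrable M (\<lambda>\<omega>. indicator ?A \<omega> *\<^sub>R renewal_kernel z $ y n $ j)"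
      using A by (intro integrable_scaleR_left) (simp add: integrable_real_indicator emeasure_eq_measure)
    have "(LINT \<omega>|M. f \<omega>) = (LINT \<omega>|M. indicator ?A \<omega> *\<^sub>R renewal_factor z n j \<omega> - indicator ?A \<omega> *\<^sub>R renewal_kernel z $ y n $ j)"
      by (rule Bochner_Integration.integral_cong)
        (use n in \<open>auto simp: f_def renewal_error_def indicator_def arrival_cylinder_def\<close>)
    also have "\<dots> = (LINT \<omega>|M. indicator ?A \<omega> *\<^sub>R renewal_factor z n j \<omega>) - (LINT \<omega>|M. indicator ?A \<omega> *\<^sub>R renewal_kernel z $ y n $ j)"
      by (rule Bochner_Integration.integral_diff[OF i1 i2])
    also have "(LINT \<omega>|M. indicator ?A \<omega> *\<^sub>R renewal_kernel z $ y n $ j) = prob ?A *\<^sub>R renewal_kernel z $ y n $ j"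
      using A by (subst integral_scaleR_left) (simp_all add: integrable_real_indicator emeasure_eq_measure)
    finally show ?thesis
      unfolding renewal_cylinder[OF n z] by (simp add: scaleR_conv_of_real)
  qed
  have range: "{1..<n} = {1..n-1}" using n by auto
  have "(LINT \<omega>|M. indicator (?A \<inter> service_event {1..<n} C) \<omega> *\<^sub>R renewal_error z n j \<omega>)
      = (LINT \<omega>|M. f \<omega> * indicator (service_event {1..n-1} C) \<omega>)"
    unfolding range by (rule Bochner_Integration.integral_cong) (auto simp: f_def indicator_def)
  also have "\<dots> = (LINT \<omega>|M. f \<omega> * of_real (service_prob (n-1) C \<omega>))"
    by (rule service_past_integral[OF C f f_le])
  also have "\<dots> = (LINT \<omega>|M. f \<omega> * of_real c)"
  proof (rule Bochner_Integration.integral_cong[OF refl])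
    fix \<omega>
    have "service_prob (n-1) C \<omega> = c" if "\<omega> \<in> ?A"
      using that unfolding service_prob_def c_def by (intro prod.cong) (auto simp: arrival_cylinder_def)
    then show "f \<omega> * of_real (service_prob (n-1) C \<omega>) = f \<omega> * of_real c"
      by (cases "\<omega> \<in> ?A") (auto simp: f_def)
  qed
  also have "\<dots> = 0" by (simp add: f_zero)
  finally show ?thesis .
qed

text \<open>For the whole space, the claim follows from the cylinders, which exhaust it as the bound on the \<open>n\<close>th epoch
grows.\<close>
lemma renewal_integral:
  assumes n: "1 \<le> n" and z: "0 \<le> Re z"
    and f: "f \<in> borel_measurable (renewal_sigma n)"
    and bounded: "\<And>\<omega>. \<omega> \<in> space M \<Longrightarrow> cmod (f \<omega>) \<le> L"
  shows "(LINT \<omega>|M. f \<omega> * renewal_error z n j \<omega>) = 0"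
proof -
  obtain K where K: "\<And>\<omega>. \<omega> \<in> space M \<Longrightarrow> cmod (renewal_error z n j \<omega>) \<le> K"
    by (rule renewal_error_bounded[OF n z, of j]) (rule that)
  have meas[measurable]: "renewal_error z n j \<in> borel_measurable M"
    by (rule background_arrival_measurable_M[OF renewal_error_background_arrival[OF n]])
  have int: "integrable M (renewal_error z n j)"
    by (rule integrable_const_bound[where B = K]) (use K in auto)
  have [measurable]: "T n \<in> borel_measurable M" by (rule T_measurable[OF n])
  let ?Y = "PiE {1..n} (\<lambda>_. UNIV :: 'n set)"
  have slice: "(LINT \<omega>|M. indicator (arrival_cylinder n t y) \<omega> *\<^sub>R renewal_error z n j \<omega>) = 0" for t y
  proof -
    have "arrival_cylinder n t y = arrival_cylinder n t y \<inter> service_event {1..<n} (\<lambda>_. UNIV)"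
      by (auto simp: arrival_cylinder_def service_event_def)
    then show ?thesis using renewal_error_cylinder[OF n z, of "\<lambda>_. UNIV" t y j] by simp
  qed
  have total: "(LINT \<omega>|M. renewal_error z n j \<omega>) = 0"
  proof -
    have trunc: "(LINT \<omega>|M. indicator {\<omega>\<in>space M. T n \<omega> < real k} \<omega> *\<^sub>R renewal_error z n j \<omega>) = 0" for k :: nat
    proof -
      have fin: "finite ?Y" by (rule finite_PiE) auto
      have "indicator {\<omega>\<in>space M. T n \<omega> < real k} \<omega> *\<^sub>R renewal_error z n j \<omega>
          = (\<Sum>y\<in>?Y. indicator (arrival_cylinder n (\<lambda>_. real k) y) \<omega> *\<^sub>R renewal_error z n j \<omega>)"
        if \<omega>: "\<omega> \<in> space M" for \<omega>
      proof -
        let ?y = "restrict (\<lambda>l. embedded X T l \<omega>) {1..n}"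
        have mem: "\<omega> \<in> arrival_cylinder n (\<lambda>_. real k) y \<longleftrightarrow> T n \<omega> < real k \<and> y = ?y" if y: "y \<in> ?Y" for y
        proof -
          have "(\<forall>l\<in>{1..n}. T l \<omega> < real k) \<longleftrightarrow> T n \<omega> < real k"
          proof
            assume "T n \<omega> < real k"
            then show "\<forall>l\<in>{1..n}. T l \<omega> < real k"
              using T_mono[OF \<omega>, where n = n] by (meson atLeastAtMost_iff le_less_trans)
          qed (use n in simp)
          moreover have "(\<forall>l\<in>{1..n}. embedded X T l \<omega> = y l) \<longleftrightarrow> y = ?y"
            using y by (auto simp: PiE_def extensional_def fun_eq_iff)
          ultimately show ?thesis using \<omega> by (auto simp: arrival_cylinder_def)
        qed
        have "(\<Sum>y\<in>?Y. indicator (arrival_cylinder n (\<lambda>_. real k) y) \<omega> *\<^sub>R renewal_error z n j \<omega>)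
           = (\<Sum>y\<in>?Y. if y = ?y then indicator {\<omega>\<in>space M. T n \<omega> < real k} \<omega> *\<^sub>R renewal_error z n j \<omega> else 0)"
          by (intro sum.cong refl) (use mem \<omega> in \<open>auto simp: indicator_def\<close>)
        also have "\<dots> = indicator {\<omega>\<in>space M. T n \<omega> < real k} \<omega> *\<^sub>R renewal_error z n j \<omega>"
          using fin by (simp add: restrict_PiE_iff)
        finally show ?thesis by simp
      qed
      then have "(LINT \<omega>|M. indicator {\<omega>\<in>space M. T n \<omega> < real k} \<omega> *\<^sub>R renewal_error z n j \<omega>)
          = (LINT \<omega>|M. (\<Sum>y\<in>?Y. indicator (arrival_cylinder n (\<lambda>_. real k) y) \<omega> *\<^sub>R renewal_error z n j \<omega>))"
        by (intro Bochner_Integration.integral_cong refl)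
      also have "\<dots> = (\<Sum>y\<in>?Y. LINT \<omega>|M. indicator (arrival_cylinder n (\<lambda>_. real k) y) \<omega> *\<^sub>R renewal_error z n j \<omega>)"
        by (intro Bochner_Integration.integral_sum integrable_mult_indicator[OF arrival_cylinder_events int])
      also have "\<dots> = 0" by (intro sum.neutral ballI slice)
      finally show ?thesis .
    qed
    have "(\<lambda>k. LINT \<omega>|M. indicator {\<omega>\<in>space M. T n \<omega> < real k} \<omega> *\<^sub>R renewal_error z n j \<omega>) \<longlonglongrightarrow> (LINT \<omega>|M. renewal_error z n j \<omega>)"
    proof (rule integral_dominated_convergence[where w = "\<lambda>\<omega>. norm (renewal_error z n j \<omega>)"])
      show "AE \<omega> in M. (\<lambda>k. indicator {\<omega>\<in>space M. T n \<omega> < real k} \<omega> *\<^sub>R renewal_error z n j \<omega>) \<longlonglongrightarrow> renewal_error z n j \<omega>"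
      proof (rule AE_I2, rule eventually_eq_tendsto[OF _ tendsto_const])
        fix \<omega> assume \<omega>: "\<omega> \<in> space M"
        obtain k0 where k0: "T n \<omega> < real k0" using reals_Archimedean2 by blast
        show "eventually (\<lambda>k. indicator {\<omega>\<in>space M. T n \<omega> < real k} \<omega> *\<^sub>R renewal_error z n j \<omega> = renewal_error z n j \<omega>) sequentially"
          using eventually_ge_at_top[of k0]
        proof eventually_elim
          case (elim k)
          then have "T n \<omega> < real k" using k0 by linarith
          then show ?case using \<omega> by simp
        qed
      qed
      show "AE \<omega> in M. norm (indicator {\<omega>\<in>space M. T n \<omega> < real k} \<omega> *\<^sub>R renewal_error z n j \<omega>) \<le> norm (renewal_error z n j \<omega>)" for k :: nat
        by (intro AE_I2) (simp add: indicator_def)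
    qed (use int in auto)
    then show ?thesis unfolding trunc using LIMSEQ_unique tendsto_const by blast
  qed
  show ?thesis
  proof (rule integral_mult_eq_0_if_zero_on_generator[OF renewal_generator_stable renewal_generator_events _ int _ f[unfolded renewal_sigma_def] bounded])
    show "space M \<in> renewal_generator n" by (simp add: renewal_generator_def)
    fix A assume "A \<in> renewal_generator n"
    then consider "A = {}" | "A = space M" | t y C where "A = arrival_cylinder n t y \<inter> service_event {1..<n} C" "\<And>l. C l \<in> sets borel"
      unfolding renewal_generator_def by blast
    then show "(LINT \<omega>|M. indicator A \<omega> *\<^sub>R renewal_error z n j \<omega>) = 0"
    proof cases
      case 2
      have "(LINT \<omega>|M. indicator A \<omega> *\<^sub>R renewal_error z n j \<omega>) = (LINT \<omega>|M. renewal_error z n j \<omega>)"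
        by (rule Bochner_Integration.integral_cong) (auto simp: 2)
      then show ?thesis by (simp add: total)
    next
      case 3
      show ?thesis unfolding 3(1) by (rule renewal_error_cylinder[OF n z 3(2)])
    qed simp
  qed
qed

section \<open>One step of the workload recursion\<close>

lemma W_measurable: "1 \<le> n \<Longrightarrow> W n \<in> borel_measurable M"
  by (rule W_measurable_from) (auto intro: T_measurable S_measurable)

definition past_factor :: "complex \<Rightarrow> complex \<Rightarrow> nat \<Rightarrow> 'a \<Rightarrow> complex" where
  "past_factor s \<eta> n \<omega> = exp (- s * of_real (W n \<omega>) - \<eta> * of_real (T n \<omega>))"

lemma past_factor_le_1:
  assumes "\<omega> \<in> space M" "1 \<le> n" "Re s = 0" "0 \<le> Re \<eta>"
  shows "cmod (past_factor s \<eta> n \<omega>) \<le> 1"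
  using assms T_nonneg[OF assms(1,2)] by (simp add: past_factor_def mult_nonneg_nonneg)

lemma past_factor_measurable_from:
  assumes [measurable]: "W n \<in> borel_measurable F" "T n \<in> borel_measurable F"
  shows "past_factor s \<eta> n \<in> borel_measurable F"
  unfolding past_factor_def[abs_def] by measurable

text \<open>The order of the two replacements matters. The service factor is replaced first, conditionally on all arrivals,
while the product still contains the next arrival; what remains multiplies the renewal factor by a function of
the past of the \<open>n\<close>th arrival.\<close>
lemma workload_step:
  assumes n: "1 \<le> n" and s: "Re s = 0" and \<eta>: "0 \<le> Re \<eta>"
  shows "(LINT \<omega>|M. exp (- s * of_real (a * W n \<omega> + S n \<omega> - interarrival T (Suc n) \<omega>) - \<eta> * of_real (T (Suc n) \<omega>))
          * indicator {\<omega>. embedded X T (Suc n) \<omega> = j} \<omega>)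
    = (\<Sum>i\<in>UNIV. (LINT \<omega>|M. past_factor (of_real a * s) \<eta> n \<omega> * indicator {\<omega>. embedded X T n \<omega> = i} \<omega>)
         * lst (B i) s * renewal_kernel (\<eta> - s) $ i $ j)"
proof -
  let ?z = "\<eta> - s"
  have z: "0 \<le> Re ?z" using s \<eta> by simp
  have as: "Re (of_real a * s) = 0" using s by simp
  let ?F = "past_factor (of_real a * s) \<eta> n" and ?R = "renewal_factor ?z n j"
  let ?\<beta> = "\<lambda>\<omega>. lst (B (embedded X T n \<omega>)) s"
  note F_le = past_factor_le_1[OF _ n as \<eta>]
  note R_le = renewal_factor_le_1[OF _ n z, of _ j]
  have [measurable]: "?F \<in> borel_measurable M"
    by (rule past_factor_measurable_from[OF W_measurable[OF n] T_measurable[OF n]])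
  have [measurable]: "?R \<in> borel_measurable M" by (rule renewal_factor_measurable[OF n])
  have [measurable]: "S n \<in> borel_measurable M" "embedded X T n \<in> M \<rightarrow>\<^sub>M count_space UNIV"
    using S_measurable embedded_measurable n by auto
  have \<beta>_bg: "?\<beta> \<in> borel_measurable (background_arrival_sigma M X T)"
    by (rule function_of_embedded_measurable[OF n, of "\<lambda>i. lst (B i) s"])
  have [measurable]: "?\<beta> \<in> borel_measurable M"
    by (rule background_arrival_measurable_M[OF \<beta>_bg])
  have le: "cmod (u * v) \<le> 1" if "cmod u \<le> 1" "cmod v \<le> 1" for u v :: complex
    using mult_mono[OF that] by (simp add: norm_mult)
  have FR_le: "cmod (?F \<omega> * ?R \<omega>) \<le> 1" and F\<beta>_le: "cmod (?F \<omega> * ?\<beta> \<omega>) \<le> 1" if "\<omega> \<in> space M" for \<omega>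
    using F_le R_le lst_le_1[OF s] that by (auto intro!: le)
  have int: "integrable M f" if "f \<in> borel_measurable M" "\<And>\<omega>. \<omega> \<in> space M \<Longrightarrow> cmod (f \<omega>) \<le> 1" for f :: "'a \<Rightarrow> complex"
    by (rule integrable_const_bound[where B = 1]) (use that in auto)
  have service: "(LINT \<omega>|M. (?F \<omega> * ?R \<omega>) * exp (- s * of_real (S n \<omega>))) = (LINT \<omega>|M. (?F \<omega> * ?R \<omega>) * ?\<beta> \<omega>)"
  proof -
    have "?F \<in> borel_measurable (history_sigma n)"
    proof (rule past_factor_measurable_from)
      show "W n \<in> borel_measurable (history_sigma n)"
        by (rule W_measurable_from[OF space_history])
          (use n in \<open>auto intro: history_measurable[OF T_background_arrival_measurable] S_history_measurable\<close>)
      show "T n \<in> borel_measurable (history_sigma n)"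
        by (rule history_measurable[OF T_background_arrival_measurable[OF n]])
    qed
    moreover have "?R \<in> borel_measurable (history_sigma n)"
      by (rule history_measurable[OF renewal_factor_background_arrival[OF n]])
    ultimately have "(\<lambda>\<omega>. ?F \<omega> * ?R \<omega>) \<in> borel_measurable (history_sigma n)" by measurable
    from service_integral[OF n s this FR_le]
    have "(LINT \<omega>|M. (?F \<omega> * ?R \<omega>) * (exp (- s * of_real (S n \<omega>)) - ?\<beta> \<omega>)) = 0" .
    moreover have "integrable M (\<lambda>\<omega>. (?F \<omega> * ?R \<omega>) * exp (- s * of_real (S n \<omega>)))"
      by (rule int) (measurable, erule le[OF FR_le], simp add: s)
    moreover have "integrable M (\<lambda>\<omega>. (?F \<omega> * ?R \<omega>) * ?\<beta> \<omega>)"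
      by (rule int) (measurable, erule le[OF FR_le], rule lst_le_1[OF s])
    ultimately show ?thesis by (simp add: right_diff_distrib)
  qed
  have renewal: "(LINT \<omega>|M. (?F \<omega> * ?\<beta> \<omega>) * ?R \<omega>) = (LINT \<omega>|M. (?F \<omega> * ?\<beta> \<omega>) * renewal_kernel ?z $ embedded X T n \<omega> $ j)"
  proof -
    have "?F \<in> borel_measurable (renewal_sigma n)"
    proof (rule past_factor_measurable_from)
      show "W n \<in> borel_measurable (renewal_sigma n)"
        by (rule W_measurable_from[OF space_renewal])
          (use n in \<open>auto intro: T_renewal_measurable[OF n] S_renewal_measurable[OF n]\<close>)
      show "T n \<in> borel_measurable (renewal_sigma n)"
        by (rule T_renewal_measurable[OF n]) (use n in simp)
    qed
    moreover have "?\<beta> \<in> borel_measurable (renewal_sigma n)"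
      by (rule measurable_compose[OF embedded_renewal_measurable[OF n], where g = "\<lambda>i. lst (B i) s"]) (use n in auto)
    ultimately have "(\<lambda>\<omega>. ?F \<omega> * ?\<beta> \<omega>) \<in> borel_measurable (renewal_sigma n)" by measurable
    from renewal_integral[OF n z this F\<beta>_le]
    have "(LINT \<omega>|M. (?F \<omega> * ?\<beta> \<omega>) * renewal_error ?z n j \<omega>) = 0" .
    moreover have "integrable M (\<lambda>\<omega>. (?F \<omega> * ?\<beta> \<omega>) * ?R \<omega>)"
      by (rule int) (measurable, rule le[OF F\<beta>_le R_le])
    moreover have "integrable M (\<lambda>\<omega>. (?F \<omega> * ?\<beta> \<omega>) * renewal_kernel ?z $ embedded X T n \<omega> $ j)"
    proof (rule integrable_const_bound[where B = "\<Sum>i\<in>UNIV. cmod (renewal_kernel ?z $ i $ j)"])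
      show "AE \<omega> in M. norm ((?F \<omega> * ?\<beta> \<omega>) * renewal_kernel ?z $ embedded X T n \<omega> $ j) \<le> (\<Sum>i\<in>UNIV. cmod (renewal_kernel ?z $ i $ j))"
      proof (rule AE_I2)
        fix \<omega> assume \<omega>: "\<omega> \<in> space M"
        have "cmod (?F \<omega> * ?\<beta> \<omega>) * cmod (renewal_kernel ?z $ embedded X T n \<omega> $ j) \<le> 1 * cmod (renewal_kernel ?z $ embedded X T n \<omega> $ j)"
          by (rule mult_right_mono[OF F\<beta>_le[OF \<omega>]]) simp
        also have "\<dots> \<le> (\<Sum>i\<in>UNIV. cmod (renewal_kernel ?z $ i $ j))"
          using member_le_sum[of "embedded X T n \<omega>" UNIV "\<lambda>i. cmod (renewal_kernel ?z $ i $ j)"] by simp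
        finally show "norm ((?F \<omega> * ?\<beta> \<omega>) * renewal_kernel ?z $ embedded X T n \<omega> $ j) \<le> (\<Sum>i\<in>UNIV. cmod (renewal_kernel ?z $ i $ j))"
          by (simp only: norm_mult)
      qed
      have "(\<lambda>\<omega>. renewal_kernel ?z $ embedded X T n \<omega> $ j) \<in> borel_measurable M"
        by (rule background_arrival_measurable_M[OF function_of_embedded_measurable[OF n, of "\<lambda>i. renewal_kernel ?z $ i $ j"]])
      then show "(\<lambda>\<omega>. (?F \<omega> * ?\<beta> \<omega>) * renewal_kernel ?z $ embedded X T n \<omega> $ j) \<in> borel_measurable M" by measurable
    qed
    ultimately show ?thesis by (simp add: renewal_error_def right_diff_distrib)
  qed
  have "(LINT \<omega>|M. exp (- s * of_real (a * W n \<omega> + S n \<omega> - interarrival T (Suc n) \<omega>) - \<eta> * of_real (T (Suc n) \<omega>))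
          * indicator {\<omega>. embedded X T (Suc n) \<omega> = j} \<omega>)
      = (LINT \<omega>|M. (?F \<omega> * ?R \<omega>) * exp (- s * of_real (S n \<omega>)))"
  proof (rule Bochner_Integration.integral_cong[OF refl])
    fix \<omega>
    have "exp (- s * of_real (a * W n \<omega> + S n \<omega> - interarrival T (Suc n) \<omega>) - \<eta> * of_real (T (Suc n) \<omega>))
        = ?F \<omega> * exp (- ?z * of_real (interarrival T (Suc n) \<omega>)) * exp (- s * of_real (S n \<omega>))"
      by (simp add: past_factor_def interarrival_def exp_add[symmetric] algebra_simps)
    then show "exp (- s * of_real (a * W n \<omega> + S n \<omega> - interarrival T (Suc n) \<omega>) - \<eta> * of_real (T (Suc n) \<omega>))
          * indicator {\<omega>. embedded X T (Suc n) \<omega> = j} \<omega> = (?F \<omega> * ?R \<omega>) * exp (- s * of_real (S n \<omega>))"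
      by (simp add: renewal_factor_def mult_ac)
  qed
  also have "\<dots> = (LINT \<omega>|M. (?F \<omega> * ?\<beta> \<omega>) * ?R \<omega>)"
    unfolding service by (simp add: mult_ac)
  also have "\<dots> = (LINT \<omega>|M. (\<Sum>i\<in>UNIV. (?F \<omega> * indicator {\<omega>. embedded X T n \<omega> = i} \<omega>) * (lst (B i) s * renewal_kernel ?z $ i $ j)))"
    unfolding renewal
  proof (rule Bochner_Integration.integral_cong[OF refl])
    fix \<omega>
    have "(\<Sum>i\<in>UNIV. (?F \<omega> * indicator {\<omega>. embedded X T n \<omega> = i} \<omega>) * (lst (B i) s * renewal_kernel ?z $ i $ j))
       = (\<Sum>i\<in>UNIV. if embedded X T n \<omega> = i then ?F \<omega> * (lst (B i) s * renewal_kernel ?z $ i $ j) else 0)"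
      by (intro sum.cong) auto
    then show "(?F \<omega> * ?\<beta> \<omega>) * renewal_kernel ?z $ embedded X T n \<omega> $ j
        = (\<Sum>i\<in>UNIV. (?F \<omega> * indicator {\<omega>. embedded X T n \<omega> = i} \<omega>) * (lst (B i) s * renewal_kernel ?z $ i $ j))"
      by (simp add: mult.assoc)
  qed
  also have "\<dots> = (\<Sum>i\<in>UNIV. (LINT \<omega>|M. ?F \<omega> * indicator {\<omega>. embedded X T n \<omega> = i} \<omega>) * (lst (B i) s * renewal_kernel ?z $ i $ j))"
  proof -
    have i: "integrable M (\<lambda>\<omega>. ?F \<omega> * indicator {\<omega>. embedded X T n \<omega> = i} \<omega>)" for i
      by (rule int) (use F_le in \<open>auto simp: indicator_def\<close>)
    show ?thesis
      by (subst Bochner_Integration.integral_sum) (use i in \<open>auto simp: integrable_mult_left\<close>)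
  qed
  finally show ?thesis by (simp add: mult.assoc)
qed

text \<open>A single index for which the conditioning event is not null makes the definite description unique.\<close>
lemma interarrival_lst_eq_kernel:
  assumes z: "0 \<le> Re z" and visited: "1 \<le> m" "0 < prob {\<omega>\<in>space M. embedded X T m \<omega> = i}"
  shows "interarrival_lst M X T i j z = renewal_kernel z $ i $ j"
proof -
  have cond: "conditional_interarrival_lst M X T n i j z = renewal_kernel z $ i $ j"
    if n: "2 \<le> n" and pos: "0 < prob {\<omega>\<in>space M. embedded X T (n - 1) \<omega> = i}" for n
  proof -
    obtain q where q: "n = Suc q" "1 \<le> q" using n by (cases n) auto
    have emb[measurable]: "embedded X T q \<in> M \<rightarrow>\<^sub>M count_space UNIV" by (rule embedded_measurable[OF q(2)])
    let ?A = "{\<omega>\<in>space M. embedded X T q \<omega> = i}"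
    have A: "?A \<in> events" by measurable
    have "{\<omega>\<in>space (renewal_sigma q). embedded X T q \<omega> = i} \<in> sets (renewal_sigma q)"
    proof -
      have [measurable]: "embedded X T q \<in> renewal_sigma q \<rightarrow>\<^sub>M count_space UNIV"
        by (rule embedded_renewal_measurable[OF q(2)]) (use q in simp)
      show ?thesis by measurable
    qed
    then have "(indicator ?A :: 'a \<Rightarrow> complex) \<in> borel_measurable (renewal_sigma q)"
      by (intro borel_measurable_indicator) simp
    from renewal_integral[OF q(2) z this, of 1 j]
    have zero: "(LINT \<omega>|M. indicator ?A \<omega> * renewal_error z q j \<omega>) = 0"
      by (simp add: indicator_def)
    have R[measurable]: "renewal_factor z q j \<in> borel_measurable M" by (rule renewal_factor_measurable[OF q(2)])
    have i1: "integrable M (\<lambda>\<omega>. indicator ?A \<omega> *\<^sub>R renewal_factor z q j \<omega>)"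
      by (intro integrable_mult_indicator[OF A] integrable_const_bound[where B = 1])
        (use renewal_factor_le_1[OF _ q(2) z] in auto)
    have i2: "integrable M (\<lambda>\<omega>. indicator ?A \<omega> *\<^sub>R renewal_kernel z $ i $ j)"
      using A by (intro integrable_scaleR_left) (simp add: integrable_real_indicator emeasure_eq_measure)
    have "(LINT \<omega>|M. exp (- z * of_real (interarrival T n \<omega>)) * indicator {\<omega>. embedded X T n \<omega> = j \<and> embedded X T (n - 1) \<omega> = i} \<omega>)
        = (LINT \<omega>|M. indicator ?A \<omega> *\<^sub>R renewal_factor z q j \<omega>)"
      by (rule Bochner_Integration.integral_cong) (auto simp: q renewal_factor_def indicator_def)
    also have "\<dots> = (LINT \<omega>|M. indicator ?A \<omega> * renewal_error z q j \<omega> + indicator ?A \<omega> *\<^sub>R renewal_kernel z $ i $ j)"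
      by (rule Bochner_Integration.integral_cong) (auto simp: renewal_error_def indicator_def)
    also have "\<dots> = (LINT \<omega>|M. indicator ?A \<omega> *\<^sub>R renewal_kernel z $ i $ j)"
    proof -
      have "(\<lambda>\<omega>. indicator ?A \<omega> * renewal_error z q j \<omega>)
          = (\<lambda>\<omega>. indicator ?A \<omega> *\<^sub>R renewal_factor z q j \<omega> - indicator ?A \<omega> *\<^sub>R renewal_kernel z $ i $ j)"
        by (auto simp: fun_eq_iff renewal_error_def indicator_def)
      then have "integrable M (\<lambda>\<omega>. indicator ?A \<omega> * renewal_error z q j \<omega>)"
        using i1 i2 by simp
      from Bochner_Integration.integral_add[OF this i2] show ?thesis by (simp only: zero add_0)
    qed
    also have "\<dots> = prob ?A *\<^sub>R renewal_kernel z $ i $ j"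
      using A by (subst integral_scaleR_left) (simp_all add: integrable_real_indicator emeasure_eq_measure)
    finally show ?thesis
      using pos by (simp add: conditional_interarrival_lst_def q scaleR_conv_of_real)
  qed
  show ?thesis
    unfolding interarrival_lst_def
  proof (rule the_equality)
    show "\<forall>n\<ge>2. 0 < prob {\<omega> \<in> space M. embedded X T (n - 1) \<omega> = i} \<longrightarrow>
        conditional_interarrival_lst M X T n i j z = renewal_kernel z $ i $ j"
      using cond by blast
    fix c assume "\<forall>n\<ge>2. 0 < prob {\<omega> \<in> space M. embedded X T (n - 1) \<omega> = i} \<longrightarrow>
        conditional_interarrival_lst M X T n i j z = c"
    then have "conditional_interarrival_lst M X T (Suc m) i j z = c"
      using visited by simp
    moreover have "conditional_interarrival_lst M X T (Suc m) i j z = renewal_kernel z $ i $ j"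
      by (rule cond) (use visited in auto)
    ultimately show "c = renewal_kernel z $ i $ j" by simp
  qed
qed

lemma Z_transform_unvisited:
  assumes "\<And>m. 1 \<le> m \<Longrightarrow> prob {\<omega>\<in>space M. embedded X T m \<omega> = i} = 0"
  shows "Z_transform M X T W r s \<eta> $ i = 0"
proof -
  have "(LINT \<omega>|M. exp (- s * of_real (W (Suc n) \<omega>) - \<eta> * of_real (T (Suc n) \<omega>))
      * indicator {\<omega>. embedded X T (Suc n) \<omega> = i} \<omega>) = 0" for n
  proof (rule integral_eq_zero_AE)
    have [measurable]: "embedded X T (Suc n) \<in> M \<rightarrow>\<^sub>M count_space UNIV" by simp
    have "AE \<omega> in M. \<omega> \<notin> {\<omega>\<in>space M. embedded X T (Suc n) \<omega> = i}"
      using assms[of "Suc n"] by (intro AE_not_in) (simp add: null_sets_def emeasure_eq_measure)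
    with AE_space show "AE \<omega> in M. exp (- s * of_real (W (Suc n) \<omega>) - \<eta> * of_real (T (Suc n) \<omega>))
      * indicator {\<omega>. embedded X T (Suc n) \<omega> = i} \<omega> = 0"
      by eventually_elim (auto simp: indicator_def)
  qed
  then show ?thesis by (simp add: Z_transform_def)
qed

lemma workload_transform_equation:
  assumes s: "Re s = 0" and \<eta>: "0 \<le> Re \<eta>" and r: "cmod r < 1"
  shows "Z_transform M X T W r s \<eta> $ j - r * initial_prob M X $ j * exp (- s * of_real w)
    = r * (\<Sum>i\<in>UNIV. Z_transform M X T W r (of_real a * s) \<eta> $ i * lst (B i) s * renewal_kernel (\<eta> - s) $ i $ j)
      + V_transform M X T S W a r s \<eta> $ j"
proof -
  define zt where "zt s n j = (LINT \<omega>|M. past_factor s \<eta> n \<omega> * indicator {\<omega>. embedded X T n \<omega> = j} \<omega>)" for s n j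
  let ?x = "\<lambda>n \<omega>. a * W n \<omega> + S n \<omega> - interarrival T (Suc n) \<omega>"
  let ?v = "\<lambda>n \<omega>. (1 - exp (- s * of_real (min 0 (?x n \<omega>)))) * exp (- \<eta> * of_real (T (Suc n) \<omega>))
                  * indicator {\<omega>. embedded X T (Suc n) \<omega> = j} \<omega>"
  define vt where "vt n = (LINT \<omega>|M. ?v n \<omega>)" for n
  have as: "Re (of_real a * s) = 0" using s by simp
  have [measurable]: "W (Suc n) \<in> borel_measurable M" "S (Suc n) \<in> borel_measurable M" "T (Suc n) \<in> borel_measurable M"
    "embedded X T (Suc n) \<in> M \<rightarrow>\<^sub>M count_space UNIV" for n
    using W_measurable S_measurable T_measurable by auto
  have PF[measurable]: "past_factor s \<eta> (Suc n) \<in> borel_measurable M" for s n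
    by (rule past_factor_measurable_from) measurable
  have e\<eta>: "cmod (exp (- \<eta> * of_real (T (Suc n) \<omega>))) \<le> 1" if "\<omega> \<in> space M" for n \<omega>
    using T_nonneg[OF that, of "Suc n"] \<eta> by (simp add: mult_nonneg_nonneg)
  have int_z: "integrable M (\<lambda>\<omega>. past_factor s \<eta> (Suc n) \<omega> * indicator {\<omega>. embedded X T (Suc n) \<omega> = i} \<omega>)"
    if "Re s = 0" for s n i
    by (rule integrable_const_bound[where B = 1])
      (use past_factor_le_1[OF _ _ that \<eta>] in \<open>auto simp: indicator_def\<close>)
  have v_le: "cmod (?v (Suc n) \<omega>) \<le> 2" if \<omega>: "\<omega> \<in> space M" for n \<omega>
  proof -
    have "cmod (1 - exp (- s * of_real (min 0 (?x (Suc n) \<omega>)))) \<le> 2"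
      using norm_triangle_ineq4[of 1 "exp (- s * of_real (min 0 (?x (Suc n) \<omega>)))"] s by simp
    then have "cmod (1 - exp (- s * of_real (min 0 (?x (Suc n) \<omega>)))) * cmod (exp (- \<eta> * of_real (T (Suc (Suc n)) \<omega>))) \<le> 2 * 1"
      by (rule mult_mono) (use e\<eta>[OF \<omega>, of "Suc n"] in auto)
    then show ?thesis by (simp add: norm_mult indicator_def del: norm_exp_eq_Re)
  qed
  have int_v: "integrable M (?v (Suc n))" for n
    by (rule integrable_const_bound[where B = 2]) (use v_le in \<open>auto simp: interarrival_def\<close>)
  have zt_le: "cmod (zt s (Suc n) i) \<le> 1" if "Re s = 0" for s n i
  proof -
    have "cmod (zt s (Suc n) i) \<le> (LINT \<omega>|M. cmod (past_factor s \<eta> (Suc n) \<omega> * indicator {\<omega>. embedded X T (Suc n) \<omega> = i} \<omega>))"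
      unfolding zt_def by (rule integral_norm_bound)
    also have "\<dots> \<le> (LINT \<omega>|M. 1)"
      by (rule integral_mono) (use int_z[OF that] past_factor_le_1[OF _ _ that \<eta>] in \<open>auto simp: indicator_def\<close>)
    finally show ?thesis by (simp add: prob_space)
  qed
  have vt_le: "cmod (vt (Suc n)) \<le> 2" for n
  proof -
    have "cmod (vt (Suc n)) \<le> (LINT \<omega>|M. cmod (?v (Suc n) \<omega>))"
      unfolding vt_def by (rule integral_norm_bound)
    also have "\<dots> \<le> (LINT \<omega>|M. 2)"
      by (rule integral_mono) (use int_v v_le in auto)
    finally show ?thesis by (simp add: prob_space)
  qed
  have step: "zt s (Suc (Suc n)) j = (\<Sum>i\<in>UNIV. zt (of_real a * s) (Suc n) i * lst (B i) s * renewal_kernel (\<eta> - s) $ i $ j) + vt (Suc n)" for n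
  proof -
    let ?u = "\<lambda>\<omega>. exp (- s * of_real (?x (Suc n) \<omega>) - \<eta> * of_real (T (Suc (Suc n)) \<omega>)) * indicator {\<omega>. embedded X T (Suc (Suc n)) \<omega> = j} \<omega>"
    have eq: "past_factor s \<eta> (Suc (Suc n)) \<omega> * indicator {\<omega>. embedded X T (Suc (Suc n)) \<omega> = j} \<omega> = ?u \<omega> + ?v (Suc n) \<omega>"
      if \<omega>: "\<omega> \<in> space M" for \<omega>
    proof -
      have "exp (- s * of_real (max 0 x)) = exp (- s * of_real x) + (1 - exp (- s * of_real (min 0 x)))" for x :: real
        by (cases "0 \<le> x") (auto simp: max_def min_def)
      note split = this[of "?x (Suc n) \<omega>"]
      let ?E = "exp (- \<eta> * of_real (T (Suc (Suc n)) \<omega>))"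
      have "W (Suc (Suc n)) \<omega> = max 0 (?x (Suc n) \<omega>)"
        by (rule W_step[OF \<omega>]) simp
      then have "past_factor s \<eta> (Suc (Suc n)) \<omega> = exp (- s * of_real (max 0 (?x (Suc n) \<omega>))) * ?E"
        by (simp only: past_factor_def mult_exp_exp) simp
      also have "\<dots> = exp (- s * of_real (?x (Suc n) \<omega>) - \<eta> * of_real (T (Suc (Suc n)) \<omega>))
          + (1 - exp (- s * of_real (min 0 (?x (Suc n) \<omega>)))) * ?E"
        unfolding split distrib_right mult_exp_exp by simp
      finally show ?thesis by (simp only: distrib_right)
    qed
    have "integrable M ?u"
    proof (rule Bochner_Integration.integrable_cong[OF refl, THEN iffD1])
      show "integrable M (\<lambda>\<omega>. past_factor s \<eta> (Suc (Suc n)) \<omega> * indicator {\<omega>. embedded X T (Suc (Suc n)) \<omega> = j} \<omega> - ?v (Suc n) \<omega>)"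
        by (rule Bochner_Integration.integrable_diff[OF int_z[OF s] int_v])
      show "past_factor s \<eta> (Suc (Suc n)) \<omega> * indicator {\<omega>. embedded X T (Suc (Suc n)) \<omega> = j} \<omega> - ?v (Suc n) \<omega> = ?u \<omega>"
        if "\<omega> \<in> space M" for \<omega>
        using eq[OF that] by (simp only: add_diff_cancel_right')
    qed
    from Bochner_Integration.integral_add[OF this int_v]
    have "(LINT \<omega>|M. ?u \<omega> + ?v (Suc n) \<omega>) = (LINT \<omega>|M. ?u \<omega>) + vt (Suc n)"
      unfolding vt_def .
    moreover have "zt s (Suc (Suc n)) j = (LINT \<omega>|M. ?u \<omega> + ?v (Suc n) \<omega>)"
      unfolding zt_def by (rule Bochner_Integration.integral_cong[OF refl eq])
    ultimately show ?thesis
      using workload_step[OF _ s \<eta>, of "Suc n" j] by (simp add: zt_def)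
  qed
  have geometric: "summable (\<lambda>n. r ^ Suc n * f n)" if "\<And>n. cmod (f n) \<le> K" for f :: "nat \<Rightarrow> complex" and K
  proof (rule summable_comparison_test')
    show "summable (\<lambda>n. cmod r ^ Suc n * K)"
      using r by (intro summable_mult2) (simp add: summable_geometric)
    show "norm (r ^ Suc n * f n) \<le> cmod r ^ Suc n * K" for n
      unfolding norm_mult norm_power by (rule mult_left_mono[OF that]) simp
  qed
  have Z: "Z_transform M X T W r s \<eta> $ i = (\<Sum>n. r ^ Suc n * zt s (Suc n) i)" for s i
    by (simp add: Z_transform_def zt_def past_factor_def)
  have V: "V_transform M X T S W a r s \<eta> $ j = (\<Sum>n. r ^ Suc (Suc n) * vt (Suc n))"
    by (simp add: V_transform_def vt_def)
  have Z_sums: "(\<lambda>n. r ^ Suc n * zt s (Suc n) i) sums Z_transform M X T W r s \<eta> $ i" if "Re s = 0" for s i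
    unfolding Z by (rule summable_sums[OF geometric[OF zt_le[OF that]]])
  have V_sums: "(\<lambda>n. r ^ Suc (Suc n) * vt (Suc n)) sums V_transform M X T S W a r s \<eta> $ j"
    unfolding V using summable_mult[OF geometric[OF vt_le], of r] by (intro summable_sums) (simp add: mult.assoc)
  have first: "zt s (Suc 0) j = initial_prob M X $ j * exp (- s * of_real w)"
  proof -
    have [measurable]: "X 0 \<in> M \<rightarrow>\<^sub>M count_space UNIV" by simp
    let ?A = "{\<omega>\<in>space M. X 0 \<omega> = j}"
    have A: "?A \<in> events" by measurable
    have "zt s (Suc 0) j = (LINT \<omega>|M. indicator ?A \<omega> *\<^sub>R exp (- s * of_real w))"
      unfolding zt_def
      by (rule Bochner_Integration.integral_cong)
        (use T_first W_first in \<open>auto simp: past_factor_def embedded_def indicator_def\<close>)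
    also have "\<dots> = prob ?A *\<^sub>R exp (- s * of_real w)"
      using A by (subst integral_scaleR_left) (simp_all add: integrable_real_indicator emeasure_eq_measure)
    finally show ?thesis by (simp add: initial_prob_def scaleR_conv_of_real)
  qed
  have "(\<lambda>n. r ^ Suc (Suc n) * zt s (Suc (Suc n)) j) sums
     (r * (\<Sum>i\<in>UNIV. Z_transform M X T W r (of_real a * s) \<eta> $ i * lst (B i) s * renewal_kernel (\<eta> - s) $ i $ j)
      + V_transform M X T S W a r s \<eta> $ j)"
  proof -
    have "(\<lambda>n. r * (\<Sum>i\<in>UNIV. (r ^ Suc n * zt (of_real a * s) (Suc n) i) * lst (B i) s * renewal_kernel (\<eta> - s) $ i $ j)
        + r ^ Suc (Suc n) * vt (Suc n)) sums
      (r * (\<Sum>i\<in>UNIV. Z_transform M X T W r (of_real a * s) \<eta> $ i * lst (B i) s * renewal_kernel (\<eta> - s) $ i $ j)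
      + V_transform M X T S W a r s \<eta> $ j)"
      by (intro sums_add sums_mult sums_sum sums_mult2 Z_sums[OF as] V_sums)
    moreover have "r * (\<Sum>i\<in>UNIV. (r ^ Suc n * zt (of_real a * s) (Suc n) i) * lst (B i) s * renewal_kernel (\<eta> - s) $ i $ j)
        + r ^ Suc (Suc n) * vt (Suc n) = r ^ Suc (Suc n) * zt s (Suc (Suc n)) j" for n
      by (simp add: step distrib_left sum_distrib_left mult.assoc)
    ultimately show ?thesis by (simp only:)
  qed
  from sums_Suc[OF this] sums_unique2[OF Z_sums[OF s, of j]]
  have "Z_transform M X T W r s \<eta> $ j =
     (r * (\<Sum>i\<in>UNIV. Z_transform M X T W r (of_real a * s) \<eta> $ i * lst (B i) s * renewal_kernel (\<eta> - s) $ i $ j)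
      + V_transform M X T S W a r s \<eta> $ j) + r ^ Suc 0 * zt s (Suc 0) j"
    by blast
  then show ?thesis by (simp add: first mult.assoc)
qed

end

section \<open>The functional equation\<close>

theorem theorem14:
  fixes M :: "'a measure"
    and Q :: "real^'n^'n"
    and lam :: "'n \<Rightarrow> real"
    and B :: "'n \<Rightarrow> real measure"
    and a w :: real
    and X :: "real \<Rightarrow> 'a \<Rightarrow> 'n"
    and T S W :: "nat \<Rightarrow> 'a \<Rightarrow> real"
    and r s \<eta> :: complex
  assumes "modulated_workload M Q lam B a w X T S W"
    and "Re s = 0" and "0 \<le> Re \<eta>" and "cmod r < 1"
  shows "(\<forall>j. Z_transform M X T W r s \<eta> $ j
              - r * initial_prob M X $ j * exp (- s * of_real w) =
            r * (\<Sum>i\<in>UNIV. Z_transform M X T W r (of_real a * s) \<eta> $ i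
                             * lst (B i) s * interarrival_lst M X T i j (\<eta> - s))
              + V_transform M X T S W a r s \<eta> $ j)
       \<and> Z_transform M X T W r s \<eta>
            - r *s ((rate_matrix lam ** matrix_inv (transpose (M_matrix Q lam (\<eta> - s)))
                       ** B_matrix B s) *v Z_transform M X T W r (of_real a * s) \<eta>) =
          (r * exp (- s * of_real w)) *s initial_prob M X + V_transform M X T S W a r s \<eta>"
proof -
  interpret modulated_workload M Q lam B a w X T S W by fact
  obtain P where P: "transition_semigroup P" "has_generator P Q" "markov_process M X P"
    using background unfolding ctmc_with_generator_def by blast
  interpret modulated_workload_semigroup M Q lam B a w X T S W P
    by unfold_locales (rule P)+
  note equation = workload_transform_equation[OF assms(2-4)]
  have z: "0 \<le> Re (\<eta> - s)" using assms(2,3) by simp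
  have kernel_lst: "Z_transform M X T W r (of_real a * s) \<eta> $ i * lst (B i) s * interarrival_lst M X T i j (\<eta> - s)
      = Z_transform M X T W r (of_real a * s) \<eta> $ i * lst (B i) s * renewal_kernel (\<eta> - s) $ i $ j" for i j
  proof (cases "\<exists>m\<ge>1. prob {\<omega>\<in>space M. embedded X T m \<omega> = i} \<noteq> 0")
    case True
    then obtain m where "1 \<le> m" "0 < prob {\<omega>\<in>space M. embedded X T m \<omega> = i}"
      using measure_nonneg less_eq_real_def by metis
    then show ?thesis by (simp only: interarrival_lst_eq_kernel[OF z])
  next
    case False
    then show ?thesis by (subst (1 2) Z_transform_unvisited) auto
  qed
  let ?Z = "Z_transform M X T W r (of_real a * s) \<eta>"
  let ?G = "rate_matrix lam ** matrix_inv (transpose (M_matrix Q lam (\<eta> - s))) ** B_matrix B s"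
  have G: "?G $ j $ i = lst (B i) s * renewal_kernel (\<eta> - s) $ i $ j" for i j
    unfolding matrix_inv_transpose[OF M_invertible[OF z]]
    by (simp add: renewal_kernel_def rate_matrix_def B_matrix_def diag_mult_left diag_mult_right transpose_def)
  have "(?G *v ?Z) $ j = (\<Sum>i\<in>UNIV. ?Z $ i * lst (B i) s * renewal_kernel (\<eta> - s) $ i $ j)" for j
    unfolding matrix_vector_mult_def by (simp add: G mult_ac)
  then have "Z_transform M X T W r s \<eta> - r *s (?G *v ?Z) =
      (r * exp (- s * of_real w)) *s initial_prob M X + V_transform M X T S W a r s \<eta>"
    using equation by (simp add: vec_eq_iff algebra_simps)
  then show ?thesis using equation by (simp only: kernel_lst) blast
qed

end
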